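(* Let $m\ge 1$ be an integer and let $b\in C^m([0,\infty))$ be real-valued with a decomposition $2b(t)=\mu(t)+\sigma(t)$, where $\mu,\sigma$ are real-valued functions on $[0,\infty)$. Assume that there are a number $\omega_\infty>0$ and positive functions $\Theta,\Xi$ on $[0,\infty)$ such that: (1) $\mu(t)>0$, $\mu'(t)<0$ and $\limsup_{t\to\infty}t\mu(t)<1$; (2) $\sup_{t}\left|\int_0^t\sigma(s)\,ds\right|<\infty$; (3) $\int_0^t\left|\exp\left(\int_0^\theta\sigma(s)\,ds\right)-\omega_\infty\right|d\theta\lesssim\Theta(t)$, with $\Theta(t)=o(t)$ as $t\to\infty$ and $\Theta$ normalised by $\Theta(0)=\mu(0)$; (4) $\left|\frac{d^k}{dt^k}b(t)\right|\le C_k\,\Xi(t)^{-k-1}$ for $k=1,2,\dots,m$, with $\Xi(t)\gtrsim\Theta(t)$; (5) $\int_t^\infty\Xi(s)^{-m-1}\,ds\lesssim\Theta(t)^{-m}$. Set $\lambda(t)=\exp\left(\frac12\int_0^t\mu(\tau)\,d\tau\right)$. Then for any fixed choice of data $u_1\in H^1(\mathbb R^n)$ and $u_2\in L^2(\mathbb R^n)$ with $(u_1,u_2)\ne(0,0)$ there exist constants $c>0$ and $C>0$ such that the solution $u$ of the Cauchy problem $$\partial_t^2u-\Delta u+2b(t)u_t=0,\qquad u(0,\cdot)=u_1,\quad u_t(0,\cdot)=u_2$$ satisfies, for all $t\ge0$, $$c\le\lambda(t)\left(\|\nabla u(t,\cdot)\|_{L^2}+\|u_t(t,\cdot)\|_{L^2}\right)\le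 C.$$
   Context: For positive functions, $f\lesssim g$ means $f\le Cg$ with a constant $C>0$ uniformly in all arguments; $f\gtrsim g$ means $g\lesssim f$. The Cauchy problem is posed for $t\ge0$, $x\in\mathbb R^n$, and is solved by partial Fourier transform in $x$, i.e. $\hat u_{tt}+|\xi|^2\hat u+2b(t)\hat u_t=0$ for each frequency $\xi\in\mathbb R^n$. *)

theory Defs
  imports "HOL-Analysis.Analysis" "HOL-Library.Landau_Symbols"
begin

section \<open>Functions on the half-line\<close>

text \<open>The derivative relative to \<open>{0..}\<close> is one-sided at \<open>0\<close> and two-sided elsewhere; values of the
  function at negative arguments play no role.\<close>

definition deriv_half :: "(real \<Rightarrow> real) \<Rightarrow> real \<Rightarrow> real" where
  "deriv_half f t = vector_derivative f (at t within {0..})"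

definition C_half :: "nat \<Rightarrow> (real \<Rightarrow> real) \<Rightarrow> bool" where
  "C_half m f \<longleftrightarrow>
     (\<forall>k<m. \<forall>t\<ge>0. (deriv_half ^^ k) f differentiable (at t within {0..})) \<and>
     (\<forall>k\<le>m. continuous_on {0..} ((deriv_half ^^ k) f))"

definition lesssim_half :: "(real \<Rightarrow> real) \<Rightarrow> (real \<Rightarrow> real) \<Rightarrow> bool" where
  "lesssim_half f g \<longleftrightarrow> (\<exists>C>0. \<forall>t\<ge>0. f t \<le> C * g t)"

definition weight :: "(real \<Rightarrow> real) \<Rightarrow> real \<Rightarrow> real" where
  "weight \<mu> t = exp (1 / 2 * integral {0..t} \<mu>)"


section \<open>Square-integrable functions on Euclidean space\<close>

text \<open>Elements of \<open>L\<^sup>2\<close> are represented by Borel measurable functions; equality in \<open>L\<^sup>2\<close> is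
  equality almost everywhere.\<close>

definition L2 :: "('a::euclidean_space \<Rightarrow> 'b::real_normed_vector) \<Rightarrow> bool" where
  "L2 f \<longleftrightarrow> f \<in> borel_measurable lborel \<and> integrable lborel (\<lambda>x. (norm (f x))\<^sup>2)"

definition L2_norm :: "('a::euclidean_space \<Rightarrow> 'b::real_normed_vector) \<Rightarrow> real" where
  "L2_norm f = sqrt (LINT x|lborel. (norm (f x))\<^sup>2)"

text \<open>Since the Bochner integral of a non-integrable function is \<open>0\<close>, convergence in \<open>L\<^sup>2\<close> has
  to demand that the differences eventually belong to \<open>L\<^sup>2\<close>.\<close>

definition L2_tendsto ::
  "('r \<Rightarrow> 'a::euclidean_space \<Rightarrow> 'b::real_normed_vector) \<Rightarrow> ('a \<Rightarrow> 'b) \<Rightarrow> 'r filter \<Rightarrow> bool" where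
  "L2_tendsto f g F \<longleftrightarrow>
     (\<forall>\<^sub>F r in F. L2 (\<lambda>x. f r x - g x)) \<and>
     ((\<lambda>r. L2_norm (\<lambda>x. f r x - g x)) \<longlongrightarrow> 0) F"


section \<open>Weak gradients and the Sobolev space of order one\<close>

definition partial_deriv :: "'n \<Rightarrow> (real ^ 'n::finite \<Rightarrow> real) \<Rightarrow> real ^ 'n \<Rightarrow> real" where
  "partial_deriv i \<phi> x = frechet_derivative \<phi> (at x) (axis i 1)"

fun C_space :: "nat \<Rightarrow> (real ^ 'n::finite \<Rightarrow> real) \<Rightarrow> bool" where
  "C_space 0 \<phi> \<longleftrightarrow> continuous_on UNIV \<phi>"
| "C_space (Suc k) \<phi> \<longleftrightarrow> \<phi> differentiable_on UNIV \<and> (\<forall>i. C_space k (partial_deriv i \<phi>))"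

definition test_function :: "(real ^ 'n::finite \<Rightarrow> real) \<Rightarrow> bool" where
  "test_function \<phi> \<longleftrightarrow> (\<forall>k. C_space k \<phi>) \<and> compact (closure {x. \<phi> x \<noteq> 0})"

text \<open>Real-valued test functions suffice for complex-valued \<open>f\<close>, by linearity.\<close>

definition weak_gradient :: "(real ^ 'n::finite \<Rightarrow> complex) \<Rightarrow> (real ^ 'n \<Rightarrow> complex ^ 'n) \<Rightarrow> bool" where
  "weak_gradient f G \<longleftrightarrow> L2 G \<and>
     (\<forall>\<phi> i. test_function \<phi> \<longrightarrow>
        (LINT x|lborel. partial_deriv i \<phi> x *\<^sub>R f x) = - (LINT x|lborel. \<phi> x *\<^sub>R (G x $ i)))"

definition H1 :: "(real ^ 'n::finite \<Rightarrow> complex) \<Rightarrow> bool" where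
  "H1 f \<longleftrightarrow> L2 f \<and> (\<exists>G. weak_gradient f G)"

text \<open>For \<open>f\<close> in \<open>H\<^sup>1\<close> the weak gradient is unique up to a null set, so the choice of the
  representative does not affect its norm.\<close>

definition grad :: "(real ^ 'n::finite \<Rightarrow> complex) \<Rightarrow> real ^ 'n \<Rightarrow> complex ^ 'n" where
  "grad f = (SOME G. weak_gradient f G)"


section \<open>The Fourier transform on square-integrable functions\<close>

definition truncated_fourier ::
  "real \<Rightarrow> (real ^ 'n::finite \<Rightarrow> complex) \<Rightarrow> real ^ 'n \<Rightarrow> complex" where
  "truncated_fourier R f \<xi> =
     complex_of_real ((1 / sqrt (2 * pi)) ^ CARD('n)) *
     (LINT x:cball 0 R|lborel. cis (- (x \<bullet> \<xi>)) * f x)"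

text \<open>The Plancherel extension as a limit in the mean; it determines \<open>v\<close> up to a null set, whence
  a relation rather than a function.\<close>

definition fourier_transform ::
  "(real ^ 'n::finite \<Rightarrow> complex) \<Rightarrow> (real ^ 'n \<Rightarrow> complex) \<Rightarrow> bool" where
  "fourier_transform f v \<longleftrightarrow>
     L2 f \<and> L2 v \<and> L2_tendsto (\<lambda>R. truncated_fourier R f) v at_top"


section \<open>The Cauchy problem\<close>

text \<open>A solution of \<open>u\<^sub>t\<^sub>t - \<Delta>u + 2b(t)u\<^sub>t = 0\<close>, \<open>u(0) = u1\<close>, \<open>u\<^sub>t(0) = u2\<close>, given as the
  pair of \<open>u\<close> and its time derivative \<open>ut\<close>, the latter taken in \<open>L\<^sup>2\<close>. The equation is
  understood through the partial Fourier transform: a suitable representative \<open>v\<close> of the transform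
  satisfies the ordinary differential equation in \<open>t\<close> at each frequency.\<close>

definition cauchy_solution ::
  "(real \<Rightarrow> real) \<Rightarrow> (real ^ 'n::finite \<Rightarrow> complex) \<Rightarrow> (real ^ 'n \<Rightarrow> complex) \<Rightarrow>
   (real \<Rightarrow> real ^ 'n \<Rightarrow> complex) \<Rightarrow> (real \<Rightarrow> real ^ 'n \<Rightarrow> complex) \<Rightarrow> bool" where
  "cauchy_solution b u1 u2 u ut \<longleftrightarrow>
     (\<forall>t\<ge>0. H1 (u t) \<and> L2 (ut t)) \<and>
     (\<forall>t\<ge>0. L2_tendsto (\<lambda>s x. (u s x - u t x) /\<^sub>R (s - t)) (ut t) (at t within {0..})) \<and>
     (AE x in lborel. u 0 x = u1 x) \<and>
     (AE x in lborel. ut 0 x = u2 x) \<and>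
     (\<exists>v v' v''.
        (\<forall>t\<ge>0. fourier_transform (u t) (v t)) \<and>
        (\<forall>t\<ge>0. fourier_transform (ut t) (v' t)) \<and>
        (\<forall>\<xi>. \<forall>t\<ge>0.
           ((\<lambda>s. v s \<xi>) has_vector_derivative v' t \<xi>) (at t within {0..}) \<and>
           ((\<lambda>s. v' s \<xi>) has_vector_derivative v'' t \<xi>) (at t within {0..}) \<and>
           v'' t \<xi> + (norm \<xi>)\<^sup>2 *\<^sub>R v t \<xi> + (2 * b t) *\<^sub>R v' t \<xi> = 0))"

end

theory Submission
  imports Defs "HOL-Probability.Probability"
begin

text \<open>
  The Fourier transform in \<open>x\<close> turns the Cauchy problem into the oscillators
  \<open>v'' + 2 b v' + r\<^sup>2 v = 0\<close> with \<open>r = \<bar>\<xi>\<bar>\<close>. By Plancherel the squared norms of the gradient and of the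
  time derivative are the integrals of \<open>r\<^sup>2 \<bar>v\<bar>\<^sup>2\<close> and \<open>\<bar>v'\<bar>\<^sup>2\<close> over all frequencies
  (\<open>weak_gradient_norm\<close>). So the theorem follows from two estimates of the energy
  \<open>\<lambda>\<^sup>2 (r\<^sup>2 \<bar>v\<bar>\<^sup>2 + \<bar>v'\<bar>\<^sup>2)\<close> of a single oscillator. The first, \<open>energy_upper_bound\<close>, bounds it at all times
  by \<open>(1 + r\<^sup>2) \<bar>v(0)\<bar>\<^sup>2 + \<bar>v'(0)\<bar>\<^sup>2\<close>, with a constant that does not depend on \<open>r\<close>; the integral of
  this expression is finite for data in \<open>H1\<close> and \<open>L2\<close>. The second, \<open>energy_lower_bound\<close>, bounds it from below by
  its initial value, with a constant that is uniform for \<open>r \<ge> \<epsilon>\<close>; as the transform of nonzero data does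
  not vanish on all sets \<open>r \<ge> \<epsilon>\<close>, the integral of this bound is positive for small \<open>\<epsilon>\<close>.

  The energy of an oscillator is followed through three zones. While \<open>r t\<close> is small, \<open>r\<^sup>2 v\<close> perturbs an
  equation that can be integrated explicitly, and \<open>limsup t \<mu>(t) < 1\<close> keeps the perturbation small
  (\<open>low_frequency_zone\<close>). Later, as long as \<open>r \<Theta>(s) < N\<close> for some time \<open>s\<close> in the future, \<open>\<sigma>\<close> is
  removed by the substitution \<open>w = \<eta> v'\<close> with \<open>\<eta> = exp (\<integral>\<sigma>)\<close>. It leaves a coupling by
  \<open>\<eta> - \<omega>\<close>, and the stabilisation condition says exactly that \<open>r \<integral> \<bar>\<eta> - \<omega>\<bar>\<close> is bounded up to that time, so
  the energy is comparable to that of a problem with the monotone dissipation \<open>\<mu>\<close>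
  (\<open>stabilised_zone\<close>). Finally, once \<open>r \<Theta> \<ge> N\<close> for all future times, the derivatives of \<open>b\<close> are small compared
  with the powers of \<open>r\<close>. The \<open>m\<close> available derivatives yield an approximate solution of the Riccati
  equation (\<open>riccati_approximation\<close>) whose residual, by the condition on the tail of \<open>\<Xi>\<^sup>-\<^sup>m\<^sup>-\<^sup>1\<close>, has a bounded
  integral (\<open>hyperbolic_zone\<close>). In the last two zones the energies at any two times are comparable
  independently of \<open>r\<close> (\<open>energy_comparable\<close>).

  The \<open>L2\<close> theory of the Fourier transform rests on Gaussians: with a Gaussian weight the squared norm
  of a Fourier integral is an average of the autocorrelation of the function, and the continuity of
  translations identifies the limit of vanishing weight.
\<close>

section \<open>Square-integrable functions\<close>

lemma L2_measurable: "L2 f \<Longrightarrow> f \<in> borel_measurable borel"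
  by (simp add: L2_def)

lemma L2_norm_nonneg: "0 \<le> L2_norm f"
  by (simp add: L2_norm_def)

lemma L2_norm_square: "(L2_norm f)\<^sup>2 = (LINT x|lborel. (norm (f x))\<^sup>2)"
  by (simp add: L2_norm_def)

lemma L2_scaleR:
  fixes f :: "'a::euclidean_space \<Rightarrow> 'b::euclidean_space"
  shows "L2 f \<Longrightarrow> L2 (\<lambda>x. c *\<^sub>R f x)"
  by (auto simp: L2_def power_mult_distrib)

lemma L2_cmult:
  fixes f :: "'a::euclidean_space \<Rightarrow> complex"
  shows "L2 f \<Longrightarrow> L2 (\<lambda>x. c * f x)"
  by (auto simp: L2_def power_mult_distrib norm_mult)

text \<open>The two target spaces may differ, so that a component can be compared with its vector field.\<close>

lemma L2_dominated:
  fixes f :: "'a::euclidean_space \<Rightarrow> 'b::euclidean_space" and g :: "'a \<Rightarrow> 'c::euclidean_space"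
  assumes "f \<in> borel_measurable borel" "L2 g" "\<And>x. norm (f x) \<le> norm (g x)"
  shows "L2 f"
  unfolding L2_def
proof
  show "f \<in> borel_measurable lborel" using assms(1) by simp
  show "integrable lborel (\<lambda>x. (norm (f x))\<^sup>2)"
    by (rule Bochner_Integration.integrable_bound[of _ "\<lambda>x. (norm (g x))\<^sup>2"])
      (use assms in \<open>auto simp: L2_def intro!: power_mono\<close>)
qed

lemma L2_add:
  fixes f g :: "'a::euclidean_space \<Rightarrow> 'b::euclidean_space"
  assumes "L2 f" "L2 g"
  shows "L2 (\<lambda>x. f x + g x)"
proof -
  have [measurable]: "f \<in> borel_measurable borel" "g \<in> borel_measurable borel"
    using assms by (auto dest: L2_measurable)
  have "(norm (f x + g x))\<^sup>2 \<le> 2 * (norm (f x))\<^sup>2 + 2 * (norm (g x))\<^sup>2" for x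
  proof -
    have "(norm (f x + g x))\<^sup>2 \<le> (norm (f x) + norm (g x))\<^sup>2"
      by (intro power_mono norm_triangle_ineq) auto
    also have "\<dots> \<le> 2 * (norm (f x))\<^sup>2 + 2 * (norm (g x))\<^sup>2"
      using sum_squares_ge_zero[of "norm (f x) - norm (g x)" 0]
      by (simp add: power2_eq_square algebra_simps)
    finally show ?thesis .
  qed
  then have le: "AE x in lborel. norm ((norm (f x + g x))\<^sup>2) \<le> norm (2 * (norm (f x))\<^sup>2 + 2 * (norm (g x))\<^sup>2)"
    by (intro AE_I2) (smt (verit) real_norm_def zero_le_power2)
  have "integrable lborel (\<lambda>x. 2 * (norm (f x))\<^sup>2 + 2 * (norm (g x))\<^sup>2)"
    using assms unfolding L2_def by auto
  then have "integrable lborel (\<lambda>x. (norm (f x + g x))\<^sup>2)"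
    by (rule Bochner_Integration.integrable_bound[OF _ _ le]) measurable
  then show ?thesis by (simp add: L2_def)
qed

lemma L2_diff:
  fixes f g :: "'a::euclidean_space \<Rightarrow> 'b::euclidean_space"
  assumes "L2 f" "L2 g"
  shows "L2 (\<lambda>x. f x - g x)"
  using L2_add[OF assms(1) L2_scaleR[OF assms(2), of "-1"]] by simp

lemma L2_norm_cmult:
  fixes f :: "'a::euclidean_space \<Rightarrow> complex"
  shows "L2_norm (\<lambda>x. c * f x) = cmod c * L2_norm f"
  by (simp add: L2_norm_def norm_mult power_mult_distrib real_sqrt_mult)

lemma L2_product_integrable:
  fixes f :: "'a::euclidean_space \<Rightarrow> 'b::euclidean_space" and g :: "'a \<Rightarrow> 'c::euclidean_space"
  assumes "L2 f" "L2 g"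
  shows "integrable lborel (\<lambda>x. norm (f x) * norm (g x))"
proof -
  have [measurable]: "f \<in> borel_measurable borel" "g \<in> borel_measurable borel"
    using assms by (auto dest: L2_measurable)
  have "norm (f x) * norm (g x) \<le> (norm (f x))\<^sup>2 + (norm (g x))\<^sup>2" for x
  proof -
    have "2 * (norm (f x) * norm (g x)) \<le> (norm (f x))\<^sup>2 + (norm (g x))\<^sup>2"
      using sum_squares_ge_zero[of "norm (f x) - norm (g x)" 0]
      by (simp add: power2_eq_square algebra_simps)
    moreover have "0 \<le> norm (f x) * norm (g x)" by simp
    ultimately show ?thesis by linarith
  qed
  then have le: "AE x in lborel. norm (norm (f x) * norm (g x)) \<le> norm ((norm (f x))\<^sup>2 + (norm (g x))\<^sup>2)"
    by (intro AE_I2) simp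
  have "integrable lborel (\<lambda>x. (norm (f x))\<^sup>2 + (norm (g x))\<^sup>2)"
    using assms unfolding L2_def by auto
  then show ?thesis
    by (rule Bochner_Integration.integrable_bound[OF _ _ le]) measurable
qed

lemma L2_mult_integrable:
  fixes f g :: "'a::euclidean_space \<Rightarrow> complex"
  assumes "L2 f" "L2 g"
  shows "integrable lborel (\<lambda>x. f x * g x)" "integrable lborel (\<lambda>x. f x * cnj (g x))"
proof -
  have [measurable]: "f \<in> borel_measurable borel" "g \<in> borel_measurable borel"
    using assms by (auto dest: L2_measurable)
  show "integrable lborel (\<lambda>x. f x * g x)"
    by (rule Bochner_Integration.integrable_bound[OF L2_product_integrable[OF assms]])
      (auto simp: norm_mult)
  have [measurable]: "(\<lambda>x. cnj (g x)) \<in> borel_measurable borel"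
    by (intro borel_measurable_continuous_on[of cnj] continuous_intros) simp_all
  show "integrable lborel (\<lambda>x. f x * cnj (g x))"
    by (rule Bochner_Integration.integrable_bound[OF L2_product_integrable[OF assms]])
      (auto simp: norm_mult)
qed

lemma L2_Cauchy_Schwarz:
  fixes f :: "'a::euclidean_space \<Rightarrow> 'b::euclidean_space" and g :: "'a \<Rightarrow> 'c::euclidean_space"
  assumes "L2 f" "L2 g"
  shows "(LINT x|lborel. norm (f x) * norm (g x)) \<le> L2_norm f * L2_norm g"
proof -
  have [measurable]: "f \<in> borel_measurable borel" "g \<in> borel_measurable borel"
    using assms by (auto dest: L2_measurable)
  let ?I = "LINT x|lborel. norm (f x) * norm (g x)"
  have I: "(\<integral>\<^sup>+x. ennreal (norm (f x)) * ennreal (norm (g x)) \<partial>lborel) = ennreal ?I"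
    by (subst nn_integral_eq_integral[OF L2_product_integrable[OF assms], symmetric])
      (auto simp: ennreal_mult)
  have sq: "(\<integral>\<^sup>+x. (ennreal (norm (h x)))\<^sup>2 \<partial>lborel) = ennreal ((L2_norm h)\<^sup>2)"
    if "L2 h" for h :: "'a \<Rightarrow> 'd::euclidean_space"
    using that by (subst L2_norm_square, subst nn_integral_eq_integral[symmetric])
      (auto simp: L2_def ennreal_power)
  have "(ennreal ?I)\<^sup>2 \<le> ennreal ((L2_norm f)\<^sup>2) * ennreal ((L2_norm g)\<^sup>2)"
    using Cauchy_Schwarz_nn_integral[of "\<lambda>x. ennreal (norm (f x))" lborel "\<lambda>x. ennreal (norm (g x))"]
    by (simp add: I sq assms)
  moreover have "0 \<le> ?I" by simp
  ultimately have "?I\<^sup>2 \<le> (L2_norm f * L2_norm g)\<^sup>2"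
    by (simp add: ennreal_power power_mult_distrib flip: ennreal_mult)
  then show ?thesis
    by (rule power2_le_imp_le) (simp add: L2_norm_nonneg)
qed

lemma L2_norm_triangle:
  fixes f g :: "'a::euclidean_space \<Rightarrow> 'b::euclidean_space"
  assumes "L2 f" "L2 g"
  shows "L2_norm (\<lambda>x. f x + g x) \<le> L2_norm f + L2_norm g"
proof -
  have i: "integrable lborel (\<lambda>x. (norm (f x))\<^sup>2)" "integrable lborel (\<lambda>x. (norm (g x))\<^sup>2)"
    "integrable lborel (\<lambda>x. (norm (f x + g x))\<^sup>2)"
    using assms L2_add[OF assms] by (auto simp: L2_def)
  have "(L2_norm (\<lambda>x. f x + g x))\<^sup>2
    \<le> (LINT x|lborel. (norm (f x))\<^sup>2 + 2 * (norm (f x) * norm (g x)) + (norm (g x))\<^sup>2)"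
    unfolding L2_norm_square
  proof (rule integral_mono)
    show "(norm (f x + g x))\<^sup>2 \<le> (norm (f x))\<^sup>2 + 2 * (norm (f x) * norm (g x)) + (norm (g x))\<^sup>2" for x
      using power_mono[OF norm_triangle_ineq[of "f x" "g x"], of 2]
      by (simp add: power2_eq_square algebra_simps)
  qed (use i L2_product_integrable[OF assms] in auto)
  also have "\<dots> = (L2_norm f)\<^sup>2 + 2 * (LINT x|lborel. norm (f x) * norm (g x)) + (L2_norm g)\<^sup>2"
    using i L2_product_integrable[OF assms] by (simp add: L2_norm_square)
  also have "\<dots> \<le> (L2_norm f + L2_norm g)\<^sup>2"
    using L2_Cauchy_Schwarz[OF assms] by (simp add: power2_eq_square algebra_simps)
  finally show ?thesis
    by (rule power2_le_imp_le) (simp add: L2_norm_nonneg)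
qed

lemma L2_norm_minus_commute:
  fixes f g :: "'a::euclidean_space \<Rightarrow> 'b::euclidean_space"
  shows "L2_norm (\<lambda>x. f x - g x) = L2_norm (\<lambda>x. g x - f x)"
  by (simp add: L2_norm_def norm_minus_commute)

lemma L2_norm_triangle_diff:
  fixes f g :: "'a::euclidean_space \<Rightarrow> 'b::euclidean_space"
  assumes f: "L2 f" and g: "L2 g"
  shows "\<bar>L2_norm f - L2_norm g\<bar> \<le> L2_norm (\<lambda>x. f x - g x)"
proof -
  have "L2_norm (\<lambda>x. (f x - g x) + g x) \<le> L2_norm (\<lambda>x. f x - g x) + L2_norm g"
    by (rule L2_norm_triangle[OF L2_diff[OF f g] g])
  moreover have "L2_norm (\<lambda>x. (g x - f x) + f x) \<le> L2_norm (\<lambda>x. g x - f x) + L2_norm f"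
    by (rule L2_norm_triangle[OF L2_diff[OF g f] f])
  moreover have "(\<lambda>x. (f x - g x) + g x) = f" "(\<lambda>x. (g x - f x) + f x) = g" by auto
  ultimately show ?thesis using L2_norm_minus_commute[of f g] by simp
qed

lemma L2_norm_eq_0_iff:
  fixes f :: "'a::euclidean_space \<Rightarrow> 'b::euclidean_space"
  assumes "L2 f"
  shows "L2_norm f = 0 \<longleftrightarrow> (AE x in lborel. f x = 0)"
proof -
  have "(LINT x|lborel. (norm (f x))\<^sup>2) = 0 \<longleftrightarrow> (AE x in lborel. (norm (f x))\<^sup>2 = 0)"
    using assms unfolding L2_def by (intro integral_nonneg_eq_0_iff_AE) auto
  then show ?thesis by (simp add: L2_norm_def)
qed

lemma L2_tendsto_norm:
  fixes f :: "'r \<Rightarrow> 'a::euclidean_space \<Rightarrow> 'b::euclidean_space"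
  assumes lim: "L2_tendsto f g F" and g: "L2 g"
  shows "((\<lambda>r. L2_norm (f r)) \<longlongrightarrow> L2_norm g) F"
proof -
  have *: "\<bar>L2_norm (f r) - L2_norm g\<bar> \<le> L2_norm (\<lambda>x. f r x - g x)"
    if "L2 (\<lambda>x. f r x - g x)" for r
  proof -
    have "L2 (\<lambda>x. (f r x - g x) + g x)" by (rule L2_add[OF that g])
    then have "L2 (f r)" by simp
    then show ?thesis by (rule L2_norm_triangle_diff[OF _ g])
  qed
  have ev: "\<forall>\<^sub>F r in F. L2 (\<lambda>x. f r x - g x)"
    and 0: "((\<lambda>r. L2_norm (\<lambda>x. f r x - g x)) \<longlongrightarrow> 0) F"
    using lim unfolding L2_tendsto_def by auto
  have "((\<lambda>r. L2_norm (f r) - L2_norm g) \<longlongrightarrow> 0) F"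
    by (rule Lim_null_comparison[OF eventually_mono[OF ev] 0]) (simp add: *)
  then show ?thesis by (simp add: LIM_zero_iff)
qed

text \<open>The inner product of \<open>\<bar>a\<bar>a - \<bar>b\<bar>b\<close> with \<open>a - b\<close> equals
  \<open>(\<bar>a\<bar> + \<bar>b\<bar>)(\<bar>a - b\<bar>\<^sup>2 + (\<bar>a\<bar> - \<bar>b\<bar>)\<^sup>2) / 2\<close>, and \<open>\<bar>a - b\<bar> \<le> \<bar>a\<bar> + \<bar>b\<bar>\<close>. The inequality transfers
  the continuity of translations from integrable to square-integrable functions.\<close>

lemma norm_scaled_diff_lower:
  fixes a b :: "'a::real_inner"
  shows "(norm (a - b))\<^sup>2 \<le> 2 * norm (norm a *\<^sub>R a - norm b *\<^sub>R b)"
proof (cases "a = b")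
  case False
  define A B d where "A = norm a" and "B = norm b" and "d = norm (a - b)"
  have ab: "a \<bullet> b = (A\<^sup>2 + B\<^sup>2 - d\<^sup>2) / 2"
    by (simp add: A_def B_def d_def power2_norm_eq_inner inner_diff inner_commute)
  have ba: "b \<bullet> a = (A\<^sup>2 + B\<^sup>2 - d\<^sup>2) / 2"
    using ab by (simp add: inner_commute)
  have aa: "a \<bullet> a = A\<^sup>2" "b \<bullet> b = B\<^sup>2"
    by (simp_all add: A_def B_def power2_norm_eq_inner)
  have "(A *\<^sub>R a - B *\<^sub>R b) \<bullet> (a - b) = A * (a \<bullet> a) - A * (a \<bullet> b) - (B * (b \<bullet> a) - B * (b \<bullet> b))"
    by (simp only: inner_diff_left inner_diff_right inner_scaleR_left right_diff_distrib)
  also have "\<dots> = (A + B) * d\<^sup>2 / 2 + (A + B) * (A - B)\<^sup>2 / 2"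
    unfolding ab ba aa by (simp add: power2_eq_square field_simps)
  also have "\<dots> \<ge> (A + B) * d\<^sup>2 / 2" by (simp add: A_def B_def)
  finally have "(A + B) * d\<^sup>2 / 2 \<le> (A *\<^sub>R a - B *\<^sub>R b) \<bullet> (a - b)" .
  also have "\<dots> \<le> norm (A *\<^sub>R a - B *\<^sub>R b) * d" unfolding d_def by (rule norm_cauchy_schwarz)
  finally have "(A + B) * d \<le> 2 * norm (A *\<^sub>R a - B *\<^sub>R b)"
    using False by (simp add: power2_eq_square d_def)
  moreover have "d * d \<le> (A + B) * d"
    unfolding A_def B_def d_def by (intro mult_right_mono norm_triangle_ineq4) auto
  ultimately show ?thesis by (simp add: power2_eq_square A_def B_def d_def)
qed simp

section \<open>Continuity of translations\<close>

lemma distr_lborel_translation: "distr lborel borel (\<lambda>x. x + h) = (lborel :: 'a::euclidean_space measure)"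
  using lborel_distr_plus[of h] by (subst (asm) add.commute[abs_def]) 

lemma integrable_translation:
  fixes f :: "'a::euclidean_space \<Rightarrow> 'b::{banach,second_countable_topology}"
  assumes "integrable lborel f"
  shows "integrable lborel (\<lambda>x. f (x + h))"
  using integrable_distr[of "\<lambda>x. x + h" lborel borel f] assms
  by (simp add: distr_lborel_translation)

lemma integral_translation:
  fixes f :: "'a::euclidean_space \<Rightarrow> 'b::{banach,second_countable_topology}"
  assumes "f \<in> borel_measurable borel"
  shows "(LINT x|lborel. f (x + h)) = (LINT x|lborel. f x)"
  using integral_distr[of "\<lambda>x. x + h" lborel borel f] assms
  by (simp add: distr_lborel_translation)

text \<open>By outer regularity it suffices to translate an open set \<open>U\<close> of finite measure. Its
  indicator is lower semicontinuous, so the part of \<open>U\<close> that leaves \<open>U\<close> under a small shift has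
  small measure, and as shifts preserve the measure of \<open>U\<close> the part that enters has the same
  measure.\<close>

lemma translation_continuous_L1_indicator:
  fixes A :: "'a::euclidean_space set"
  assumes A: "A \<in> sets borel" "emeasure lborel A < \<infinity>" and h: "h \<longlonglongrightarrow> 0"
  shows "(\<lambda>n. LINT x|lborel. \<bar>indicator A (x + h n) - indicator A x\<bar>) \<longlonglongrightarrow> (0::real)"
proof (rule tendstoI)
  fix e :: real assume e: "e > 0"
  obtain U where U: "open U" "A \<subseteq> U" "emeasure lborel (U - A) < ennreal (e / 4)"
    using outer_regular_lborel[OF A(1), of "e/4"] e by auto
  have Um [measurable]: "U \<in> sets borel" and Am [measurable]: "A \<in> sets borel" using U A by auto
  have "emeasure lborel U \<le> emeasure lborel A + emeasure lborel (U - A)"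
    using emeasure_subadditive[of A lborel "U - A"] U(2) by (simp add: Un_absorb1)
  also have "\<dots> < \<infinity>" using A(2) U(3) by (auto simp: less_top[symmetric])
  finally have Ufin: "emeasure lborel U < \<infinity>" .
  have iU: "integrable lborel (indicator U :: 'a \<Rightarrow> real)"
    and iA: "integrable lborel (indicator A :: 'a \<Rightarrow> real)"
    using Ufin A(2) by auto
  let ?D = "\<lambda>n. LINT x|lborel. \<bar>indicator U (x + h n) - indicator U x\<bar> :: real"
  have D: "?D \<longlonglongrightarrow> 0"
  proof -
    have 1: "?D n = 2 * (LINT x|lborel. indicator U x * (1 - indicator U (x + h n)))" for n
    proof -
      have "?D n = (LINT x|lborel. 2 * (indicator U x * (1 - indicator U (x + h n)))
              + (indicator U (x + h n) - indicator U x) :: real)"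
        by (intro Bochner_Integration.integral_cong) (auto split: split_indicator)
      also have "\<dots> = 2 * (LINT x|lborel. indicator U x * (1 - indicator U (x + h n)))
              + ((LINT x|lborel. indicator U (x + h n)) - (LINT x|lborel. indicator U x))"
      proof -
        have "integrable lborel (\<lambda>x. indicator U x * (1 - indicator U (x + h n)) :: real)"
          by (rule Bochner_Integration.integrable_bound[OF iU])
            (auto split: split_indicator)
        then show ?thesis using iU integrable_translation[OF iU, of "h n"] by simp
      qed
      also have "(LINT x|lborel. indicator U (x + h n)) = (LINT x|lborel. indicator U x :: real)"
        by (rule integral_translation) simp
      finally show ?thesis by simp
    qed
    have "(\<lambda>n. LINT x|lborel. indicator U x * (1 - indicator U (x + h n))) \<longlonglongrightarrow> (LINT x|(lborel::'a measure). 0 :: real)"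
    proof (rule integral_dominated_convergence[where w = "indicator U"])
      show "AE x in lborel. (\<lambda>n. indicator U x * (1 - indicator U (x + h n)) :: real) \<longlonglongrightarrow> 0"
      proof (intro AE_I2)
        fix x :: 'a
        show "(\<lambda>n. indicator U x * (1 - indicator U (x + h n)) :: real) \<longlonglongrightarrow> 0"
        proof (cases "x \<in> U")
          case True
          have "(\<lambda>n. x + h n) \<longlonglongrightarrow> x + 0" by (intro tendsto_intros h)
          then have "\<forall>\<^sub>F n in sequentially. x + h n \<in> U"
            using U(1) True by (simp add: topological_tendstoD)
          then show ?thesis
            by (intro tendsto_eventually, elim eventually_mono) simp
        qed simp
      qed
    qed (use iU in \<open>auto split: split_indicator\<close>)
    then show ?thesis unfolding 1 using tendsto_mult_right_zero[of _ _ "2::real"] by auto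
  qed
  have dUA: "(LINT x|lborel. \<bar>indicator U x - indicator A x\<bar> :: real) < e / 4"
  proof -
    have "(LINT x|lborel. \<bar>indicator U x - indicator A x\<bar> :: real) = (LINT x|lborel. indicator (U - A) x)"
      using U(2) by (intro Bochner_Integration.integral_cong) (auto split: split_indicator)
    also have "\<dots> = measure lborel (U - A)" by simp
    also have "\<dots> < e / 4"
    proof -
      have "emeasure lborel (U - A) \<noteq> \<infinity>" using U(3) by auto
      then have "ennreal (measure lborel (U - A)) < ennreal (e / 4)"
        using U(3) emeasure_eq_ennreal_measure[of lborel "U - A"] by simp
      then show ?thesis using e by (simp add: ennreal_less_iff)
    qed
    finally show ?thesis .
  qed
  have i1: "integrable lborel (\<lambda>x. \<bar>indicator U x - indicator A x\<bar> :: real)" using iU iA by auto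
  show "\<forall>\<^sub>F n in sequentially. dist (LINT x|lborel. \<bar>indicator A (x + h n) - indicator A x\<bar>) (0::real) < e"
    using order_tendstoD(2)[OF D half_gt_zero[OF e]]
  proof (elim eventually_mono)
    fix n assume n: "?D n < e / 2"
    have i2: "integrable lborel (\<lambda>x. \<bar>indicator U (x + h n) - indicator A (x + h n)\<bar> :: real)"
      using integrable_translation[OF i1] .
    have i3: "integrable lborel (\<lambda>x. \<bar>indicator U (x + h n) - indicator U x\<bar> :: real)"
      using iU integrable_translation[OF iU] by auto
    have i4: "integrable lborel (\<lambda>x. \<bar>indicator A (x + h n) - indicator A x\<bar> :: real)"
      using iA integrable_translation[OF iA] by auto
    have "(LINT x|lborel. \<bar>indicator A (x + h n) - indicator A x\<bar> :: real)
       \<le> (LINT x|lborel. \<bar>indicator U (x + h n) - indicator A (x + h n)\<bar>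
           + \<bar>indicator U (x + h n) - indicator U x\<bar> + \<bar>indicator U x - indicator A x\<bar>)"
      using i1 i2 i3 i4 by (intro integral_mono) auto
    also have "\<dots> = (LINT x|lborel. \<bar>indicator U (x + h n) - indicator A (x + h n)\<bar>)
           + ?D n + (LINT x|lborel. \<bar>indicator U x - indicator A x\<bar>)"
      using i1 i2 i3 by simp
    also have "(LINT x|lborel. \<bar>indicator U (x + h n) - indicator A (x + h n)\<bar> :: real)
        = (LINT x|lborel. \<bar>indicator U x - indicator A x\<bar>)"
      by (rule integral_translation) simp
    finally have "(LINT x|lborel. \<bar>indicator A (x + h n) - indicator A x\<bar> :: real) < e"
      using dUA n by simp
    then show "dist (LINT x|lborel. \<bar>indicator A (x + h n) - indicator A x\<bar>) (0::real) < e"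
      by simp
  qed
qed

text \<open>The claim passes from indicator functions to all integrable functions by linearity and by
  approximation, since a translation does not change the error of the approximation.\<close>

lemma translation_continuous_L1:
  fixes f :: "'a::euclidean_space \<Rightarrow> 'b::{banach,second_countable_topology}"
  assumes "integrable lborel f" and h: "h \<longlonglongrightarrow> 0"
  shows "(\<lambda>n. LINT x|lborel. norm (f (x + h n) - f x)) \<longlonglongrightarrow> 0"
  using assms(1)
proof induction
  case (base A c)
  then have "(\<lambda>n. LINT x|lborel. \<bar>indicator A (x + h n) - indicator A x\<bar>) \<longlonglongrightarrow> (0::real)"
    using h by (intro translation_continuous_L1_indicator) auto
  then have "(\<lambda>n. (LINT x|lborel. \<bar>indicator A (x + h n) - indicator A x\<bar>) * norm c) \<longlonglongrightarrow> (0::real)"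
    by (rule tendsto_mult_left_zero)
  then show ?case by (simp flip: scaleR_left_diff_distrib)
next
  case (add f g)
  show ?case
  proof (rule tendsto_sandwich[OF _ _ tendsto_const])
    show "(\<lambda>n. (LINT x|lborel. norm (f (x + h n) - f x)) + (LINT x|lborel. norm (g (x + h n) - g x))) \<longlonglongrightarrow> 0"
      using tendsto_add[OF add.IH] by simp
    show "\<forall>\<^sub>F n in sequentially. (LINT x|lborel. norm (f (x + h n) + g (x + h n) - (f x + g x)))
      \<le> (LINT x|lborel. norm (f (x + h n) - f x)) + (LINT x|lborel. norm (g (x + h n) - g x))"
    proof (intro always_eventually allI)
      fix n
      have i: "integrable lborel (\<lambda>x. f (x + h n))" "integrable lborel (\<lambda>x. g (x + h n))"
        using add.hyps by (auto intro: integrable_translation)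
      have "(LINT x|lborel. norm (f (x + h n) + g (x + h n) - (f x + g x)))
        \<le> (LINT x|lborel. norm (f (x + h n) - f x) + norm (g (x + h n) - g x))"
        using i add.hyps by (intro integral_mono) (auto intro!: norm_diff_triangle_ineq)
      also have "\<dots> = (LINT x|lborel. norm (f (x + h n) - f x)) + (LINT x|lborel. norm (g (x + h n) - g x))"
        using i add.hyps by simp
      finally show "(LINT x|lborel. norm (f (x + h n) + g (x + h n) - (f x + g x)))
        \<le> (LINT x|lborel. norm (f (x + h n) - f x)) + (LINT x|lborel. norm (g (x + h n) - g x))" .
    qed
  qed simp
next
  case (lim f s)
  have L: "(\<lambda>i. LINT x|lborel. norm (s i x - f x)) \<longlonglongrightarrow> (LINT x|(lborel::'a measure). 0 :: real)"
  proof (rule integral_dominated_convergence[where w = "\<lambda>x. 3 * norm (f x)"])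
    show "AE x in lborel. (\<lambda>i. norm (s i x - f x)) \<longlonglongrightarrow> 0"
      by (intro AE_I2 tendsto_norm_zero LIM_zero lim.hyps(2)) auto
    show "AE x in lborel. norm (norm (s i x - f x)) \<le> 3 * norm (f x)" for i
    proof (intro AE_I2)
      fix x show "norm (norm (s i x - f x)) \<le> 3 * norm (f x)"
        using lim.hyps(3)[of x i] norm_triangle_ineq4[of "s i x" "f x"] by simp
    qed
  qed (use lim.hyps in auto)
  show ?case
  proof (rule tendstoI)
    fix e :: real assume e: "e > 0"
    obtain i where i: "(LINT x|lborel. norm (s i x - f x)) < e / 4"
      using order_tendstoD(2)[OF L, of "e/4"] e by (auto simp: eventually_sequentially)
    have m: "(\<lambda>x. norm (s i x - f x)) \<in> borel_measurable borel"
      using borel_measurable_integrable[OF lim.hyps(1)[of i]] borel_measurable_integrable[OF lim.hyps(4)] by simp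
    show "\<forall>\<^sub>F n in sequentially. dist (LINT x|lborel. norm (f (x + h n) - f x)) 0 < e"
      using order_tendstoD(2)[OF lim.IH[of i] half_gt_zero[OF e]]
    proof (elim eventually_mono)
      fix n assume n: "(LINT x|lborel. norm (s i (x + h n) - s i x)) < e / 2"
      have I: "integrable lborel (\<lambda>x. f (x + h n))" "integrable lborel (\<lambda>x. s i (x + h n))"
        using lim.hyps by (auto intro: integrable_translation)
      have "(LINT x|lborel. norm (f (x + h n) - f x))
        \<le> (LINT x|lborel. norm (s i (x + h n) - f (x + h n)) + norm (s i (x + h n) - s i x)
              + norm (s i x - f x))"
      proof (rule integral_mono)
        fix x
        have "f (x + h n) - f x = - (s i (x + h n) - f (x + h n)) + (s i (x + h n) - s i x) + (s i x - f x)"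
          by simp
        then show "norm (f (x + h n) - f x) \<le> norm (s i (x + h n) - f (x + h n)) + norm (s i (x + h n) - s i x)
              + norm (s i x - f x)"
          by (metis (no_types, lifting) norm_minus_cancel norm_triangle_le norm_triangle_ineq add_mono_thms_linordered_semiring(3))
      qed (use I lim.hyps(1)[of i] lim.hyps(4) in auto)
      also have "\<dots> = (LINT x|lborel. norm (s i (x + h n) - f (x + h n))) + (LINT x|lborel. norm (s i (x + h n) - s i x))
         + (LINT x|lborel. norm (s i x - f x))"
        using I lim.hyps(1)[of i] lim.hyps(4) by simp
      also have "(LINT x|lborel. norm (s i (x + h n) - f (x + h n))) = (LINT x|lborel. norm (s i x - f x))"
        by (rule integral_translation[OF m])
      finally show "dist (LINT x|lborel. norm (f (x + h n) - f x)) 0 < e"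
        using n i by simp
    qed
  qed
qed

lemma L2_translation:
  fixes f :: "'a::euclidean_space \<Rightarrow> 'b::euclidean_space"
  assumes "L2 f"
  shows "L2 (\<lambda>x. f (x + h))" "L2_norm (\<lambda>x. f (x + h)) = L2_norm f"
proof -
  have m [measurable]: "f \<in> borel_measurable borel" using assms by (rule L2_measurable)
  have "integrable lborel (\<lambda>x. (norm (f (x + h)))\<^sup>2)"
    using assms unfolding L2_def by (intro integrable_translation[of "\<lambda>x. (norm (f x))\<^sup>2"]) auto
  then show "L2 (\<lambda>x. f (x + h))" unfolding L2_def by auto
  show "L2_norm (\<lambda>x. f (x + h)) = L2_norm f"
    unfolding L2_norm_def by (subst integral_translation[of "\<lambda>x. (norm (f x))\<^sup>2"]) auto
qed

text \<open>The map \<open>a \<mapsto> \<bar>a\<bar>a\<close> turns square-integrable functions into integrable ones and does not shrink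
  squared distances by more than a factor, so the claim is the one for integrable functions.\<close>

lemma translation_continuous_L2:
  fixes f :: "'a::euclidean_space \<Rightarrow> 'b::euclidean_space"
  assumes f: "L2 f" and h: "h \<longlonglongrightarrow> 0"
  shows "(\<lambda>n. L2_norm (\<lambda>x. f (x + h n) - f x)) \<longlonglongrightarrow> 0"
proof -
  have m [measurable]: "f \<in> borel_measurable borel" using f by (rule L2_measurable)
  define g where "g x = norm (f x) *\<^sub>R f x" for x
  have mg [measurable]: "g \<in> borel_measurable borel" unfolding g_def by simp
  have g: "integrable lborel g"
    by (rule Bochner_Integration.integrable_bound[of _ "\<lambda>x. (norm (f x))\<^sup>2"])
      (use f in \<open>auto simp: L2_def g_def power2_eq_square\<close>)
  have "(\<lambda>n. 2 * (LINT x|lborel. norm (g (x + h n) - g x))) \<longlonglongrightarrow> 2 * 0"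
    by (intro tendsto_mult tendsto_const translation_continuous_L1 g h)
  then have up: "(\<lambda>n. 2 * (LINT x|lborel. norm (g (x + h n) - g x))) \<longlonglongrightarrow> 0" by simp
  have "(\<lambda>n. (L2_norm (\<lambda>x. f (x + h n) - f x))\<^sup>2) \<longlonglongrightarrow> 0"
  proof (rule tendsto_sandwich[OF _ _ tendsto_const up])
    show "\<forall>\<^sub>F n in sequentially. (L2_norm (\<lambda>x. f (x + h n) - f x))\<^sup>2 \<le> 2 * (LINT x|lborel. norm (g (x + h n) - g x))"
    proof (intro always_eventually allI)
      fix n
      have "(L2_norm (\<lambda>x. f (x + h n) - f x))\<^sup>2 \<le> (LINT x|lborel. 2 * norm (g (x + h n) - g x))"
        unfolding L2_norm_square
      proof (rule integral_mono)
        show "integrable lborel (\<lambda>x. (norm (f (x + h n) - f x))\<^sup>2)"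
          using L2_diff[OF L2_translation(1)[OF f] f] by (simp add: L2_def)
        show "integrable lborel (\<lambda>x. 2 * norm (g (x + h n) - g x))"
          using g integrable_translation[OF g] by auto
        show "(norm (f (x + h n) - f x))\<^sup>2 \<le> 2 * norm (g (x + h n) - g x)" for x
          unfolding g_def by (rule norm_scaled_diff_lower)
      qed
      then show "(L2_norm (\<lambda>x. f (x + h n) - f x))\<^sup>2 \<le> 2 * (LINT x|lborel. norm (g (x + h n) - g x))"
        by simp
    qed
  qed simp
  then have "(\<lambda>n. sqrt ((L2_norm (\<lambda>x. f (x + h n) - f x))\<^sup>2)) \<longlonglongrightarrow> sqrt 0"
    by (rule tendsto_real_sqrt)
  then show ?thesis by (simp add: L2_norm_nonneg)
qed

section \<open>Gaussians and the Fourier integral\<close>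

text \<open>Gaussians and the test functions below are products of functions of one coordinate, so
  their Fourier integrals reduce to integrals over the line.\<close>

lemma lborel_prod_integral:
  fixes f :: "'a::euclidean_space \<Rightarrow> real \<Rightarrow> 'b::{real_normed_field,banach,second_countable_topology}"
  assumes f: "\<And>b. b \<in> Basis \<Longrightarrow> integrable lborel (f b)"
  shows integrable_lborel_prod: "integrable lborel (\<lambda>x. \<Prod>b\<in>Basis. f b (x \<bullet> b))"
    and integral_lborel_prod:
      "(LINT x|lborel. (\<Prod>b\<in>Basis. f b (x \<bullet> b))) = (\<Prod>b\<in>Basis. LINT t|lborel. f b t)"
proof -
  interpret P: product_sigma_finite "\<lambda>_::'a. lborel :: real measure" by standard
  let ?M = "\<Pi>\<^sub>M b\<in>(Basis::'a set). (lborel :: real measure)"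
  let ?T = "\<lambda>g. \<Sum>b\<in>(Basis::'a set). g b *\<^sub>R b"
  have m [measurable]: "f b \<in> borel_measurable borel" if "b \<in> Basis" for b
    using borel_measurable_integrable[OF f[OF that]] by simp
  have T: "?T \<in> measurable ?M borel" by measurable
  have P: "(\<lambda>x. \<Prod>b\<in>Basis. f b (x \<bullet> b)) \<in> borel_measurable borel" by measurable
  have e: "(\<Prod>b\<in>Basis. f b (?T g \<bullet> b)) = (\<Prod>b\<in>Basis. f b (g b))" for g
    by (intro prod.cong refl) (simp add: inner_sum_left_Basis)
  have i: "integrable ?M (\<lambda>g. \<Prod>b\<in>Basis. f b (g b))"
    by (rule P.product_integrable_prod) (use f in auto)
  show "integrable lborel (\<lambda>x. \<Prod>b\<in>Basis. f b (x \<bullet> b))"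
    by (subst lborel_eq, subst integrable_distr_eq[OF T P]) (simp only: e i)
  show "(LINT x|lborel. (\<Prod>b\<in>Basis. f b (x \<bullet> b))) = (\<Prod>b\<in>Basis. LINT t|lborel. f b t)"
    by (subst lborel_eq, subst integral_distr[OF T P], simp only: e,
        rule P.product_integral_prod) (use f in auto)
qed

lemma cis_inner_prod:
  "cis (x \<bullet> y) = (\<Prod>b\<in>Basis. cis ((x \<bullet> b) * (y \<bullet> b)))"
proof -
  have "cis (x \<bullet> y) = exp (\<Sum>b\<in>Basis. \<i> * complex_of_real ((x \<bullet> b) * (y \<bullet> b)))"
    unfolding cis_conv_exp by (subst euclidean_inner) (simp add: sum_distrib_left)
  also have "\<dots> = (\<Prod>b\<in>Basis. cis ((x \<bullet> b) * (y \<bullet> b)))"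
    by (simp add: exp_sum cis_conv_exp)
  finally show ?thesis .
qed

lemma cis_measurable [measurable (raw)]: "f \<in> borel_measurable M \<Longrightarrow> (\<lambda>x. cis (f x)) \<in> borel_measurable M"
  by (rule measurable_compose[where g = cis]) (auto intro!: borel_measurable_continuous_onI continuous_intros)

definition gauss :: "'a::euclidean_space \<Rightarrow> real" where
  "gauss x = (\<Prod>b\<in>Basis. std_normal_density (x \<bullet> b))"

lemma gauss_eq: "gauss (x::'a::euclidean_space) = (1 / sqrt (2 * pi)) ^ DIM('a) * exp (- (norm x)\<^sup>2 / 2)"
proof -
  have "gauss x = (1 / sqrt (2 * pi)) ^ DIM('a) * (\<Prod>b\<in>Basis. exp (- (x \<bullet> b)\<^sup>2 / 2))"
    by (simp only: gauss_def std_normal_density_def prod.distrib prod_constant)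
  also have "(\<Prod>b\<in>Basis. exp (- (x \<bullet> b)\<^sup>2 / 2)) = exp (\<Sum>b\<in>Basis. - (x \<bullet> b)\<^sup>2 / 2)"
    by (simp add: exp_sum)
  also have "(\<Sum>b\<in>Basis. - (x \<bullet> b)\<^sup>2 / 2) = - (norm x)\<^sup>2 / 2"
    by (simp add: norm_eq_sqrt_inner euclidean_inner[of x x] sum_nonneg power2_eq_square sum_negf
        flip: sum_divide_distrib)
  finally show ?thesis .
qed

lemma gauss_nonneg [simp]: "0 \<le> gauss x"
  by (simp add: gauss_eq)

lemma gauss_measurable [measurable]: "gauss \<in> borel_measurable borel"
  unfolding gauss_def[abs_def] by measurable

lemma gauss_integrable: "integrable lborel (gauss :: 'a::euclidean_space \<Rightarrow> real)"
  and gauss_integral: "(LINT x|lborel. gauss (x::'a)) = 1"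
  using integrable_lborel_prod[of "\<lambda>_::'a. std_normal_density"]
    integral_lborel_prod[of "\<lambda>_::'a. std_normal_density"]
  unfolding gauss_def[abs_def] by auto

lemma gauss_fourier:
  fixes y :: "'a::euclidean_space"
  shows "(LINT x|lborel. cis (x \<bullet> y) * complex_of_real (gauss x)) = complex_of_real (exp (- (norm y)\<^sup>2 / 2))"
proof -
  have 1: "(LINT t|lborel. cis (t * s) * complex_of_real (std_normal_density t)) = complex_of_real (exp (- s\<^sup>2 / 2))"
    for s
  proof -
    have "complex_of_real (exp (- s\<^sup>2 / 2)) = char (density lborel (\<lambda>x. ennreal (std_normal_density x))) s"
      by (simp add: char_std_normal_distribution)
    also have "\<dots> = (LINT t|lborel. std_normal_density t *\<^sub>R exp (\<i> * complex_of_real (s * t)))"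
      unfolding char_def by (subst integral_density) (auto simp: normal_density_nonneg)
    also have "\<dots> = (LINT t|lborel. cis (t * s) * complex_of_real (std_normal_density t))"
      by (intro Bochner_Integration.integral_cong) (auto simp: cis_conv_exp scaleR_conv_of_real mult_ac)
    finally show ?thesis by simp
  qed
  have "(LINT x|lborel. cis (x \<bullet> y) * complex_of_real (gauss x))
     = (LINT x|lborel. (\<Prod>b\<in>Basis. cis ((x \<bullet> b) * (y \<bullet> b)) * complex_of_real (std_normal_density (x \<bullet> b))))"
    by (simp add: cis_inner_prod[of _ y] gauss_def prod.distrib)
  also have "\<dots> = (\<Prod>b\<in>Basis. LINT t|lborel. cis (t * (y \<bullet> b)) * complex_of_real (std_normal_density t))"
  proof (rule integral_lborel_prod)
    fix b :: 'a
    show "integrable lborel (\<lambda>t. cis (t * (y \<bullet> b)) * complex_of_real (std_normal_density t))"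
      by (rule Bochner_Integration.integrable_bound[of _ std_normal_density]) (auto simp: norm_mult)
  qed
  also have "\<dots> = complex_of_real (\<Prod>b\<in>Basis. exp (- (y \<bullet> b)\<^sup>2 / 2))"
    by (simp add: 1)
  also have "(\<Prod>b\<in>Basis. exp (- (y \<bullet> b)\<^sup>2 / 2)) = exp (\<Sum>b\<in>Basis. - (y \<bullet> b)\<^sup>2 / 2)"
    by (simp add: exp_sum)
  also have "(\<Sum>b\<in>Basis. - (y \<bullet> b)\<^sup>2 / 2) = - (norm y)\<^sup>2 / 2"
    by (simp add: norm_eq_sqrt_inner euclidean_inner[of y y] sum_nonneg power2_eq_square sum_negf
        flip: sum_divide_distrib)
  finally show ?thesis .
qed

lemma integral_scale_translation:
  fixes f :: "'a::euclidean_space \<Rightarrow> 'b::{banach,second_countable_topology}"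
  assumes [measurable]: "f \<in> borel_measurable borel" and c: "c > 0"
  shows "(LINT x|lborel. f x) = c ^ DIM('a) *\<^sub>R (LINT x|lborel. f (t + c *\<^sub>R x))"
proof -
  have "(LINT x|lborel. f x) = (LINT x|density (distr lborel borel (\<lambda>x. t + c *\<^sub>R x)) (\<lambda>_. \<bar>c\<bar>^DIM('a)). f x)"
    using lborel_affine[of c t] c by simp
  also have "\<dots> = (LINT x|lborel. c ^ DIM('a) *\<^sub>R f (t + c *\<^sub>R x))"
    using c by (subst integral_density) (auto simp: integral_distr ennreal_power)
  finally show ?thesis by simp
qed

definition fourier_const :: "'n::finite itself \<Rightarrow> real" where
  "fourier_const _ = (1 / sqrt (2 * pi)) ^ CARD('n)"

lemma fourier_const_pos: "0 < fourier_const TYPE('n::finite)"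
  by (simp add: fourier_const_def)

text \<open>The Fourier integral itself, before any limit in the mean: it is meaningful for integrable
  functions, and the truncated transform is its value at a truncated function.\<close>

definition fourier_L1 :: "(real ^ 'n::finite \<Rightarrow> complex) \<Rightarrow> real ^ 'n \<Rightarrow> complex" where
  "fourier_L1 f \<xi> = complex_of_real (fourier_const TYPE('n)) * (LINT x|lborel. cis (- (x \<bullet> \<xi>)) * f x)"

lemma cnj_measurable [measurable (raw)]: "f \<in> borel_measurable M \<Longrightarrow> (\<lambda>x. cnj (f x)) \<in> borel_measurable M"
  by (rule measurable_compose[where g = cnj]) (auto intro!: borel_measurable_continuous_onI continuous_intros)

lemma integrable_cis_mult:
  assumes "integrable lborel f" "g \<in> borel_measurable borel"
  shows "integrable lborel (\<lambda>x. cis (g x) * f x)"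
  by (rule Bochner_Integration.integrable_bound[OF assms(1)])
    (use assms borel_measurable_integrable[OF assms(1)] in \<open>auto simp: norm_mult\<close>)

lemma fourier_L1_measurable [measurable]:
  assumes [measurable]: "f \<in> borel_measurable borel"
  shows "fourier_L1 f \<in> borel_measurable borel"
proof -
  have "(\<lambda>\<xi>. LINT x|lborel. cis (- (x \<bullet> \<xi>)) * f x) \<in> borel_measurable borel"
    by (rule lborel.borel_measurable_lebesgue_integral) measurable
  then show ?thesis unfolding fourier_L1_def[abs_def] by measurable
qed

lemma fourier_L1_bound:
  fixes f :: "real ^ 'n::finite \<Rightarrow> complex"
  assumes "integrable lborel f"
  shows "norm (fourier_L1 f \<xi>) \<le> fourier_const TYPE('n) * (LINT x|lborel. norm (f x))"
proof -
  have "norm (LINT x|lborel. cis (- (x \<bullet> \<xi>)) * f x) \<le> (LINT x|lborel. norm (cis (- (x \<bullet> \<xi>)) * f x))"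
    by (rule integral_norm_bound)
  then show ?thesis
    using fourier_const_pos[where 'n='n] by (simp add: fourier_L1_def norm_mult)
qed

text \<open>Both sides are the double integral of \<open>cis (- (x \<bullet> \<xi>)) f(x) g(\<xi>)\<close>, which converges absolutely.
  It moves the transform from a function about which little is known to a Gaussian.\<close>

lemma fourier_L1_multiplication:
  fixes f g :: "real ^ 'n::finite \<Rightarrow> complex"
  assumes f: "integrable lborel f" and g: "integrable lborel g"
  shows "(LINT \<xi>|lborel. g \<xi> * fourier_L1 f \<xi>) = (LINT x|lborel. fourier_L1 g x * f x)"
proof -
  have [measurable]: "f \<in> borel_measurable borel" "g \<in> borel_measurable borel"
    using f g by auto
  let ?k = "complex_of_real (fourier_const TYPE('n))"
  let ?h = "\<lambda>x \<xi>. ?k * (cis (- (x \<bullet> \<xi>)) * f x * g \<xi>)"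
  have h: "integrable (lborel \<Otimes>\<^sub>M lborel) (case_prod ?h)"
  proof (rule lborel_pair.Fubini_integrable)
    have e: "norm (?h x \<xi>) = fourier_const TYPE('n) * norm (f x) * norm (g \<xi>)" for x \<xi>
      using fourier_const_pos[where 'n='n] by (simp add: norm_mult)
    show "integrable lborel (\<lambda>x. LINT \<xi>|lborel. norm (case (x, \<xi>) of (x, \<xi>) \<Rightarrow> ?h x \<xi>))"
      unfolding prod.case e using f by simp
    show "AE x in lborel. integrable lborel (\<lambda>\<xi>. case (x, \<xi>) of (x, \<xi>) \<Rightarrow> ?h x \<xi>)"
    proof (intro AE_I2)
      fix x
      show "integrable lborel (\<lambda>\<xi>. case (x, \<xi>) of (x, \<xi>) \<Rightarrow> ?h x \<xi>)"
        using integrable_cis_mult[OF g, of "\<lambda>\<xi>. - (x \<bullet> \<xi>)"]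
        by (simp add: mult.assoc mult.left_commute[of _ "f x"])
    qed
  qed measurable
  have "(LINT \<xi>|lborel. g \<xi> * fourier_L1 f \<xi>) = (LINT \<xi>|lborel. LINT x|lborel. ?h x \<xi>)"
    by (intro Bochner_Integration.integral_cong refl)
      (simp add: fourier_L1_def mult_ac flip: integral_mult_right_zero)
  also have "\<dots> = (LINT x|lborel. LINT \<xi>|lborel. ?h x \<xi>)"
    by (rule lborel_pair.Fubini_integral[OF h])
  also have "\<dots> = (LINT x|lborel. fourier_L1 g x * f x)"
    by (intro Bochner_Integration.integral_cong refl)
      (simp add: fourier_L1_def mult_ac inner_commute flip: integral_mult_right_zero)
  finally show ?thesis .
qed

section \<open>The isometry property for the Fourier integral\<close>

lemma gauss_weight_integrable:
  assumes "e > 0"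
  shows "integrable lborel (\<lambda>\<xi>::'a::euclidean_space. exp (- (e * norm \<xi>)\<^sup>2 / 2))"
proof -
  have 0: "integrable lborel (\<lambda>\<xi>::'a. sqrt (2 * pi) ^ DIM('a) * gauss \<xi>)"
    using gauss_integrable by simp
  have e: "sqrt (2 * pi) ^ DIM('a) * gauss x = exp (- (norm x)\<^sup>2 / 2)" for x :: 'a
    by (simp add: gauss_eq power_one_over)
  have 1: "integrable lborel (\<lambda>x::'a. exp (- (norm x)\<^sup>2 / 2))" using 0 by (simp only: e)
  have "integrable (density (distr lborel borel (\<lambda>x::'a. 0 + (1/e) *\<^sub>R x)) (\<lambda>_. \<bar>1/e\<bar>^DIM('a))) (\<lambda>x. exp (- (e * norm x)\<^sup>2 / 2))"
    using assms 1 
    by (subst integrable_density) (auto simp: integrable_distr_eq ennreal_power)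
  then show ?thesis using lborel_affine[of "1/e" "0::'a"] assms by simp
qed

lemma gauss_weight_fourier:
  fixes y :: "real ^ 'n::finite"
  assumes "e > 0"
  shows "fourier_L1 (\<lambda>\<xi>. complex_of_real (exp (- (e * norm \<xi>)\<^sup>2 / 2))) y
    = complex_of_real (exp (- (norm y / e)\<^sup>2 / 2) / e ^ CARD('n))"
proof -
  have "(LINT \<xi>|lborel. cis (- (\<xi> \<bullet> y)) * complex_of_real (exp (- (e * norm \<xi>)\<^sup>2 / 2)))
     = (1/e) ^ CARD('n) *\<^sub>R (LINT \<xi>|lborel. cis (- ((0 + (1/e) *\<^sub>R \<xi>) \<bullet> y)) * complex_of_real (exp (- (e * norm (0 + (1/e) *\<^sub>R \<xi>))\<^sup>2 / 2)))"
    (is "?L = _")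
  proof -
    have "(\<lambda>\<xi>. cis (- (\<xi> \<bullet> y)) * complex_of_real (exp (- (e * norm \<xi>)\<^sup>2 / 2))) \<in> borel_measurable borel"
      by measurable
    from integral_scale_translation[OF this, of "1/e" 0] assms show ?thesis by simp
  qed
  also have "(LINT \<xi>|lborel. cis (- ((0 + (1/e) *\<^sub>R \<xi>) \<bullet> y)) * complex_of_real (exp (- (e * norm (0 + (1/e) *\<^sub>R \<xi>))\<^sup>2 / 2)))
     = (LINT \<xi>|lborel. complex_of_real (1 / fourier_const TYPE('n)) * (cis (\<xi> \<bullet> (- (1/e) *\<^sub>R y)) * complex_of_real (gauss \<xi>)))"
  proof (intro Bochner_Integration.integral_cong refl)
    fix \<xi> :: "real ^ 'n"
    have "complex_of_real (exp (- (norm \<xi>)\<^sup>2 / 2)) = complex_of_real (1 / fourier_const TYPE('n)) * complex_of_real (gauss \<xi>)"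
      using fourier_const_pos[where 'n='n] unfolding of_real_mult[symmetric] by (simp add: gauss_eq fourier_const_def)
    moreover have "- ((0 + (1/e) *\<^sub>R \<xi>) \<bullet> y) = \<xi> \<bullet> (- (1/e) *\<^sub>R y)" "e * norm (0 + (1/e) *\<^sub>R \<xi>) = norm \<xi>"
      using assms by auto
    ultimately show "cis (- ((0 + (1/e) *\<^sub>R \<xi>) \<bullet> y)) * complex_of_real (exp (- (e * norm (0 + (1/e) *\<^sub>R \<xi>))\<^sup>2 / 2))
      = complex_of_real (1 / fourier_const TYPE('n)) * (cis (\<xi> \<bullet> (- (1/e) *\<^sub>R y)) * complex_of_real (gauss \<xi>))"
      by (simp only: mult.left_commute)
  qed
  also have "\<dots> = complex_of_real (1 / fourier_const TYPE('n)) * complex_of_real (exp (- (norm y / e)\<^sup>2 / 2))"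
    using assms by (simp only: integral_mult_right_zero gauss_fourier) (simp add: power_divide)
  finally show ?thesis
    using assms fourier_const_pos[where 'n='n] by (simp add: fourier_L1_def scaleR_conv_of_real power_divide)
qed

text \<open>The transform of \<open>f\<close> need not be integrable, so the inverse Fourier integral is taken with a
  Gaussian weight. By the multiplication formula it returns the average of \<open>f\<close> at scale \<open>e\<close>.\<close>

lemma fourier_L1_gauss_inversion:
  fixes f :: "real ^ 'n::finite \<Rightarrow> complex"
  assumes f: "integrable lborel f" and e: "e > 0"
  shows "complex_of_real (fourier_const TYPE('n)) *
      (LINT \<xi>|lborel. cis (x \<bullet> \<xi>) * complex_of_real (exp (- (e * norm \<xi>)\<^sup>2 / 2)) * fourier_L1 f \<xi>)
    = (LINT z|lborel. complex_of_real (gauss z) * f (x + e *\<^sub>R z))"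
proof -
  have fm [measurable]: "f \<in> borel_measurable borel" using f by auto
  let ?w = "\<lambda>\<xi>::real^'n. complex_of_real (exp (- (e * norm \<xi>)\<^sup>2 / 2))"
  let ?k = "complex_of_real (fourier_const TYPE('n))"
  have w: "integrable lborel ?w" by (rule integrable_of_real[OF gauss_weight_integrable[OF e]])
  have "(LINT \<xi>|lborel. cis (x \<bullet> \<xi>) * ?w \<xi> * fourier_L1 f \<xi>)
      = (LINT y|lborel. fourier_L1 (\<lambda>\<xi>. cis (x \<bullet> \<xi>) * ?w \<xi>) y * f y)"
    by (rule fourier_L1_multiplication[OF f integrable_cis_mult[OF w]]) measurable
  also have "\<dots> = (LINT y|lborel. complex_of_real (exp (- (norm (y - x) / e)\<^sup>2 / 2) / e ^ CARD('n)) * f y)"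
  proof -
    have "fourier_L1 (\<lambda>\<xi>. cis (x \<bullet> \<xi>) * ?w \<xi>) y = fourier_L1 ?w (y - x)" for y
    proof -
      have "cis (- (\<xi> \<bullet> y)) * (cis (x \<bullet> \<xi>) * ?w \<xi>) = cis (- (\<xi> \<bullet> (y - x))) * ?w \<xi>" for \<xi>
        by (simp add: inner_diff_right inner_commute[of x] mult.assoc[symmetric] cis_mult)
      then show ?thesis unfolding fourier_L1_def by (simp only:)
    qed
    then show ?thesis by (simp only: gauss_weight_fourier[OF e])
  qed
  also have "\<dots> = e ^ CARD('n) *\<^sub>R (LINT z|lborel. complex_of_real (exp (- (norm ((x + e *\<^sub>R z) - x) / e)\<^sup>2 / 2) / e ^ CARD('n)) * f (x + e *\<^sub>R z))"
    by (subst integral_scale_translation[OF _ e, of _ x]) auto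
  also have "\<dots> = (LINT z|lborel. e ^ CARD('n) *\<^sub>R (complex_of_real (exp (- (norm ((x + e *\<^sub>R z) - x) / e)\<^sup>2 / 2) / e ^ CARD('n)) * f (x + e *\<^sub>R z)))"
    by simp
  finally have "?k * (LINT \<xi>|lborel. cis (x \<bullet> \<xi>) * ?w \<xi> * fourier_L1 f \<xi>)
    = (LINT z|lborel. ?k * (e ^ CARD('n) *\<^sub>R (complex_of_real (exp (- (norm ((x + e *\<^sub>R z) - x) / e)\<^sup>2 / 2) / e ^ CARD('n)) * f (x + e *\<^sub>R z))))"
    by (simp only: integral_mult_right_zero)
  also have "\<dots> = (LINT z|lborel. complex_of_real (gauss z) * f (x + e *\<^sub>R z))"
  proof (intro Bochner_Integration.integral_cong refl)
    fix z :: "real ^ 'n"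
    have "norm ((x + e *\<^sub>R z) - x) / e = norm z" using e by simp
    then show "?k * (e ^ CARD('n) *\<^sub>R (complex_of_real (exp (- (norm ((x + e *\<^sub>R z) - x) / e)\<^sup>2 / 2) / e ^ CARD('n)) * f (x + e *\<^sub>R z)))
      = complex_of_real (gauss z) * f (x + e *\<^sub>R z)"
      using e by (simp only:) (simp add: gauss_eq fourier_const_def scaleR_conv_of_real[where 'a=complex])
  qed
  finally show ?thesis .
qed

text \<open>The autocorrelation of \<open>f\<close> is bounded by its value at \<open>0\<close> and continuous there. This is
  what the limit of vanishing Gaussian weight needs.\<close>

lemma L2_correlation_bound:
  fixes f :: "real ^ 'n::finite \<Rightarrow> complex"
  assumes "L2 f"
  shows "(LINT x|lborel. norm (f x) * norm (f (x + h))) \<le> (L2_norm f)\<^sup>2"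
  using L2_Cauchy_Schwarz[OF assms L2_translation(1)[OF assms]]
  by (simp add: L2_translation(2)[OF assms] power2_eq_square)

lemma L2_correlation_continuous:
  fixes f :: "real ^ 'n::finite \<Rightarrow> complex"
  assumes f: "L2 f" and h: "h \<longlonglongrightarrow> 0"
  shows "(\<lambda>n. LINT x|lborel. f x * cnj (f (x + h n))) \<longlonglongrightarrow> complex_of_real ((L2_norm f)\<^sup>2)"
proof -
  have "norm ((LINT x|lborel. f x * cnj (f (x + h n))) - complex_of_real ((L2_norm f)\<^sup>2))
      \<le> L2_norm f * L2_norm (\<lambda>x. f (x + h n) - f x)" for n
  proof -
    have i: "L2 (\<lambda>x. f (x + h n))" by (rule L2_translation(1)[OF f])
    have d: "L2 (\<lambda>x. f (x + h n) - f x)" by (rule L2_diff[OF i f])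
    have "complex_of_real ((L2_norm f)\<^sup>2) = (LINT x|lborel. f x * cnj (f x))"
      unfolding L2_norm_square integral_complex_of_real[symmetric] by (simp only: complex_norm_square)
    then have "(LINT x|lborel. f x * cnj (f (x + h n))) - complex_of_real ((L2_norm f)\<^sup>2)
       = (LINT x|lborel. f x * cnj (f (x + h n) - f x))"
      by (simp add: algebra_simps L2_mult_integrable(2)[OF f i] L2_mult_integrable(2)[OF f f])
    also have "norm \<dots> \<le> (LINT x|lborel. norm (f x * cnj (f (x + h n) - f x)))"
      by (rule integral_norm_bound)
    also have "\<dots> = (LINT x|lborel. norm (f x) * norm (f (x + h n) - f x))"
      by (simp only: norm_mult complex_mod_cnj)
    also have "\<dots> \<le> L2_norm f * L2_norm (\<lambda>x. f (x + h n) - f x)"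
      by (rule L2_Cauchy_Schwarz[OF f d])
    finally show ?thesis .
  qed
  moreover have "(\<lambda>n. L2_norm f * L2_norm (\<lambda>x. f (x + h n) - f x)) \<longlonglongrightarrow> 0"
    by (rule tendsto_mult_right_zero[OF translation_continuous_L2[OF f h]])
  ultimately have "(\<lambda>n. (LINT x|lborel. f x * cnj (f (x + h n))) - complex_of_real ((L2_norm f)\<^sup>2)) \<longlonglongrightarrow> 0"
    by (rule Lim_null_comparison[OF always_eventually[OF allI]])
  then show ?thesis by (rule LIM_zero_cancel)
qed

text \<open>The multiplication formula, applied twice, turns the weighted norm of the transform into a
  Gaussian average of the autocorrelation of \<open>f\<close>.\<close>

lemma fourier_L1_weighted_norm:
  fixes f :: "real ^ 'n::finite \<Rightarrow> complex"
  assumes f: "integrable lborel f" "L2 f" and e: "e > 0"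
  shows "complex_of_real (LINT \<xi>|lborel. exp (- (e * norm \<xi>)\<^sup>2 / 2) * (norm (fourier_L1 f \<xi>))\<^sup>2)
    = (LINT z|lborel. gauss z *\<^sub>R (LINT x|lborel. f x * cnj (f (x + e *\<^sub>R z))))"
proof -
  have fm [measurable]: "f \<in> borel_measurable borel" using f by auto
  let ?w = "\<lambda>\<xi>::real^'n. complex_of_real (exp (- (e * norm \<xi>)\<^sup>2 / 2))"
  let ?k = "complex_of_real (fourier_const TYPE('n))"
  have w: "integrable lborel ?w" by (rule integrable_of_real[OF gauss_weight_integrable[OF e]])
  define G where "G \<xi> = ?w \<xi> * cnj (fourier_L1 f \<xi>)" for \<xi>
  have G: "integrable lborel G"
  proof (rule Bochner_Integration.integrable_bound)
    show "integrable lborel (\<lambda>\<xi>. ?w \<xi> * complex_of_real (fourier_const TYPE('n) * (LINT x|lborel. norm (f x))))"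
      using w by simp
    show "AE \<xi> in lborel. norm (G \<xi>) \<le> norm (?w \<xi> * complex_of_real (fourier_const TYPE('n) * (LINT x|lborel. norm (f x))))"
    proof (intro AE_I2)
      fix \<xi>
      have "norm (fourier_L1 f \<xi>) \<le> \<bar>fourier_const TYPE('n) * (LINT x|lborel. norm (f x))\<bar>"
        using fourier_L1_bound[OF f(1), of \<xi>] by linarith
      then show "norm (G \<xi>) \<le> norm (?w \<xi> * complex_of_real (fourier_const TYPE('n) * (LINT x|lborel. norm (f x))))"
        unfolding G_def norm_mult norm_of_real complex_mod_cnj by (intro mult_left_mono) auto
    qed
    show "G \<in> borel_measurable lborel" unfolding G_def[abs_def] by measurable
  qed
  have FG: "fourier_L1 G x = cnj (LINT z|lborel. complex_of_real (gauss z) * f (x + e *\<^sub>R z))" for x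
  proof -
    have "fourier_L1 G x = ?k * (LINT \<xi>|lborel. cnj (cis (x \<bullet> \<xi>) * ?w \<xi> * fourier_L1 f \<xi>))"
    proof -
      have "cis (- (\<xi> \<bullet> x)) * G \<xi> = cnj (cis (x \<bullet> \<xi>) * ?w \<xi> * fourier_L1 f \<xi>)" for \<xi>
        by (simp add: G_def cis_cnj inner_commute[of x] mult.assoc)
      then show ?thesis unfolding fourier_L1_def[of G] by (simp only:)
    qed
    also have "\<dots> = cnj (?k * (LINT \<xi>|lborel. cis (x \<bullet> \<xi>) * ?w \<xi> * fourier_L1 f \<xi>))"
      by (simp only: Bochner_Integration.integral_cnj complex_cnj_mult[of ?k] complex_cnj_complex_of_real)
    finally show ?thesis by (simp only: fourier_L1_gauss_inversion[OF f(1) e])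
  qed
  let ?h = "\<lambda>x z. gauss z *\<^sub>R (f x * cnj (f (x + e *\<^sub>R z)))"
  have h: "integrable (lborel \<Otimes>\<^sub>M lborel) (\<lambda>(z, x). ?h x z)"
  proof (rule lborel_pair.Fubini_integrable)
    show "(\<lambda>(z, x). ?h x z) \<in> borel_measurable (lborel \<Otimes>\<^sub>M lborel)" by measurable
    show "AE z in lborel. integrable lborel (\<lambda>x. case (z, x) of (z, x) \<Rightarrow> ?h x z)"
      using L2_mult_integrable(2)[OF f(2) L2_translation(1)[OF f(2)]] by (intro AE_I2) auto
    show "integrable lborel (\<lambda>z. LINT x|lborel. norm (case (z, x) of (z, x) \<Rightarrow> ?h x z))"
    proof (rule Bochner_Integration.integrable_bound)
      show "integrable lborel (\<lambda>z::real^'n. gauss z * (L2_norm f)\<^sup>2)" using gauss_integrable[where 'a="real^'n"] by simp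
      show "(\<lambda>z. LINT x|lborel. norm (case (z, x) of (z, x) \<Rightarrow> ?h x z)) \<in> borel_measurable lborel"
        by measurable
      show "AE z in lborel. norm (LINT x|lborel. norm (case (z, x) of (z, x) \<Rightarrow> ?h x z))
          \<le> norm (gauss z * (L2_norm f)\<^sup>2)"
      proof (intro AE_I2)
        fix z :: "real^'n"
        have "(LINT x|lborel. norm (?h x z)) = gauss z * (LINT x|lborel. norm (f x) * norm (f (x + e *\<^sub>R z)))"
          by (simp add: norm_mult)
        also have "\<dots> \<le> gauss z * (L2_norm f)\<^sup>2"
          by (intro mult_left_mono L2_correlation_bound f) simp
        finally show "norm (LINT x|lborel. norm (case (z, x) of (z, x) \<Rightarrow> ?h x z)) \<le> norm (gauss z * (L2_norm f)\<^sup>2)"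
          by simp
      qed
    qed
  qed
  have "complex_of_real (LINT \<xi>|lborel. exp (- (e * norm \<xi>)\<^sup>2 / 2) * (norm (fourier_L1 f \<xi>))\<^sup>2)
     = (LINT \<xi>|lborel. G \<xi> * fourier_L1 f \<xi>)"
    unfolding integral_complex_of_real[symmetric]
    by (intro Bochner_Integration.integral_cong refl) (simp only: G_def of_real_mult complex_norm_square mult.commute[of "fourier_L1 f _"] mult.assoc)
  also have "\<dots> = (LINT x|lborel. fourier_L1 G x * f x)"
    by (rule fourier_L1_multiplication[OF f(1) G])
  also have "\<dots> = (LINT x|lborel. LINT z|lborel. ?h x z)"
  proof (intro Bochner_Integration.integral_cong refl)
    fix x
    have "fourier_L1 G x * f x = f x * (LINT z|lborel. cnj (complex_of_real (gauss z) * f (x + e *\<^sub>R z)))"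
      by (simp only: FG Bochner_Integration.integral_cnj mult.commute)
    also have "\<dots> = (LINT z|lborel. f x * cnj (complex_of_real (gauss z) * f (x + e *\<^sub>R z)))"
      by (rule integral_mult_right_zero[symmetric])
    also have "\<dots> = (LINT z|lborel. ?h x z)"
      by (intro Bochner_Integration.integral_cong refl) (simp add: scaleR_conv_of_real[where 'a=complex])
    finally show "fourier_L1 G x * f x = (LINT z|lborel. ?h x z)" .
  qed
  also have "\<dots> = (LINT z|lborel. LINT x|lborel. ?h x z)"
    by (rule lborel_pair.Fubini_integral[OF h])
  also have "\<dots> = (LINT z|lborel. gauss z *\<^sub>R (LINT x|lborel. f x * cnj (f (x + e *\<^sub>R z))))"
    by simp
  finally show ?thesis .
qed

text \<open>As \<open>e\<close> tends to \<open>0\<close> the weighted norm increases to the norm of the transform, while the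
  average of the autocorrelation tends to its value at \<open>0\<close>, the squared norm of \<open>f\<close>.\<close>

theorem Plancherel_L1_L2:
  fixes f :: "real ^ 'n::finite \<Rightarrow> complex"
  assumes f: "integrable lborel f" "L2 f"
  shows "L2 (fourier_L1 f)" "L2_norm (fourier_L1 f) = L2_norm f"
proof -
  have fm [measurable]: "f \<in> borel_measurable borel" using f by auto
  define e where "e j = 1 / real (Suc j)" for j
  have e: "e j > 0" for j by (simp add: e_def)
  have e0: "e \<longlonglongrightarrow> 0" unfolding e_def[abs_def] by (rule LIMSEQ_inverse_real_of_nat[unfolded inverse_eq_divide])
  let ?W = "\<lambda>j \<xi>. exp (- (e j * norm \<xi>)\<^sup>2 / 2) * (norm (fourier_L1 f \<xi>))\<^sup>2"
  let ?\<Phi> = "\<lambda>h. LINT x|lborel. f x * cnj (f (x + h))"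
  have lim: "(\<lambda>j. LINT z|lborel. gauss z *\<^sub>R ?\<Phi> (e j *\<^sub>R z)) \<longlonglongrightarrow>
      (LINT z|lborel. gauss (z::real^'n) *\<^sub>R complex_of_real ((L2_norm f)\<^sup>2))"
  proof (rule integral_dominated_convergence)
    show "integrable lborel (\<lambda>z::real^'n. gauss z * (L2_norm f)\<^sup>2)" using gauss_integrable[where 'a="real^'n"] by simp
    show "AE z in lborel. (\<lambda>j. gauss z *\<^sub>R ?\<Phi> (e j *\<^sub>R z)) \<longlonglongrightarrow> gauss z *\<^sub>R complex_of_real ((L2_norm f)\<^sup>2)"
    proof (intro AE_I2 tendsto_scaleR tendsto_const L2_correlation_continuous f)
      fix z :: "real^'n"
      show "(\<lambda>j. e j *\<^sub>R z) \<longlonglongrightarrow> 0" using tendsto_scaleR[OF e0 tendsto_const[of z]] by simp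
    qed
    show "AE z in lborel. norm (gauss z *\<^sub>R ?\<Phi> (e j *\<^sub>R z)) \<le> gauss z * (L2_norm f)\<^sup>2" for j
    proof (intro AE_I2)
      fix z :: "real^'n"
      have "norm (?\<Phi> (e j *\<^sub>R z)) \<le> (LINT x|lborel. norm (f x * cnj (f (x + e j *\<^sub>R z))))"
        by (rule integral_norm_bound)
      also have "\<dots> \<le> (L2_norm f)\<^sup>2"
        using L2_correlation_bound[OF f(2)] by (simp add: norm_mult)
      finally show "norm (gauss z *\<^sub>R ?\<Phi> (e j *\<^sub>R z)) \<le> gauss z * (L2_norm f)\<^sup>2"
        by (simp add: mult_left_mono)
    qed
  qed measurable
  have "(LINT z|lborel. gauss (z::real^'n) *\<^sub>R complex_of_real ((L2_norm f)\<^sup>2)) = complex_of_real ((L2_norm f)\<^sup>2)"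
    using gauss_integral[where 'a="real^'n"] gauss_integrable[where 'a="real^'n"] by simp
  with lim have "(\<lambda>j. complex_of_real (LINT \<xi>|lborel. ?W j \<xi>)) \<longlonglongrightarrow> complex_of_real ((L2_norm f)\<^sup>2)"
    by (simp only: fourier_L1_weighted_norm[OF f e])
  then have lim': "(\<lambda>j. LINT \<xi>|lborel. ?W j \<xi>) \<longlonglongrightarrow> (L2_norm f)\<^sup>2"
    by (simp only: tendsto_of_real_iff)
  have W: "integrable lborel (?W j)" for j
  proof (rule Bochner_Integration.integrable_bound)
    let ?c = "(fourier_const TYPE('n) * (LINT x|lborel. norm (f x)))\<^sup>2"
    show "integrable lborel (\<lambda>\<xi>::real^'n. exp (- (e j * norm \<xi>)\<^sup>2 / 2) * ?c)"
      by (intro integrable_mult_left gauss_weight_integrable e)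
    show "AE \<xi> in lborel. norm (?W j \<xi>) \<le> norm (exp (- (e j * norm \<xi>)\<^sup>2 / 2) * ?c)"
      by (intro AE_I2) (auto intro!: mult_left_mono power_mono fourier_L1_bound f)
  qed measurable
  have *: "integrable lborel (\<lambda>\<xi>. (norm (fourier_L1 f \<xi>))\<^sup>2)"
    "(LINT \<xi>|lborel. (norm (fourier_L1 f \<xi>))\<^sup>2) = (L2_norm f)\<^sup>2"
  proof -
    have mono: "AE \<xi> in lborel. mono (\<lambda>j. ?W j \<xi>)"
    proof (intro AE_I2 monoI)
      fix \<xi> :: "real^'n" and i j :: nat assume "i \<le> j"
      then have "e j \<le> e i" by (simp add: e_def field_simps)
      then have "(e j * norm \<xi>)\<^sup>2 \<le> (e i * norm \<xi>)\<^sup>2"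
        using e[of j] by (intro power_mono mult_right_mono) auto
      then show "?W i \<xi> \<le> ?W j \<xi>" by (intro mult_right_mono) auto
    qed
    have pos: "AE \<xi> in lborel. 0 \<le> ?W j \<xi>" for j by simp
    have conv: "AE \<xi> in lborel. (\<lambda>j. ?W j \<xi>) \<longlonglongrightarrow> (norm (fourier_L1 f \<xi>))\<^sup>2"
    proof (intro AE_I2)
      fix \<xi> :: "real^'n"
      have "(\<lambda>j. exp (- (e j * norm \<xi>)\<^sup>2 / 2) * (norm (fourier_L1 f \<xi>))\<^sup>2) \<longlonglongrightarrow> exp (- (0 * norm \<xi>)\<^sup>2 / 2) * (norm (fourier_L1 f \<xi>))\<^sup>2"
        by (intro tendsto_intros e0) auto
      then show "(\<lambda>j. ?W j \<xi>) \<longlonglongrightarrow> (norm (fourier_L1 f \<xi>))\<^sup>2" by simp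
    qed
    have m: "(\<lambda>\<xi>. (norm (fourier_L1 f \<xi>))\<^sup>2) \<in> borel_measurable lborel" by measurable
    show "integrable lborel (\<lambda>\<xi>. (norm (fourier_L1 f \<xi>))\<^sup>2)"
      "(LINT \<xi>|lborel. (norm (fourier_L1 f \<xi>))\<^sup>2) = (L2_norm f)\<^sup>2"
      by (rule integral_monotone_convergence_nonneg[OF W mono pos conv lim' m])+
  qed
  show "L2 (fourier_L1 f)" using *(1) by (simp add: L2_def)
  show "L2_norm (fourier_L1 f) = L2_norm f"
    unfolding L2_norm_def[of "fourier_L1 f"] *(2) by (simp add: L2_norm_nonneg)
qed

section \<open>The Fourier transform on square-integrable functions\<close>

lemma cball_measurable [measurable]: "cball (a::'a::euclidean_space) r \<in> sets borel"
  by (rule borel_closed) simp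

definition ball_cut :: "real \<Rightarrow> (real ^ 'n::finite \<Rightarrow> complex) \<Rightarrow> real ^ 'n \<Rightarrow> complex" where
  "ball_cut R f x = indicator (cball 0 R) x *\<^sub>R f x"

lemma truncated_fourier_eq: "truncated_fourier R f = fourier_L1 (ball_cut R f)"
  by (rule ext) (simp add: truncated_fourier_def fourier_L1_def fourier_const_def ball_cut_def
      set_lebesgue_integral_def)

lemma cut_L2:
  assumes f: "L2 f"
  shows "L2 (ball_cut R f)"
proof (rule L2_dominated[OF _ f])
  have [measurable]: "f \<in> borel_measurable borel" using f by (rule L2_measurable)
  show "ball_cut R f \<in> borel_measurable borel" unfolding ball_cut_def[abs_def] by measurable
qed (simp add: ball_cut_def indicator_def)

lemma cut_integrable:
  fixes f :: "real ^ 'n::finite \<Rightarrow> complex"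
  assumes f: "L2 f"
  shows "integrable lborel (ball_cut R f)"
proof -
  have "L2 (\<lambda>x::real^'n. complex_of_real (indicator (cball 0 R) x))"
    unfolding L2_def
  proof
    have "integrable lborel (indicator (cball (0::real^'n) R) :: _ \<Rightarrow> real)"
      using emeasure_bounded_finite[of "cball (0::real^'n) R"] by (simp add: less_top[symmetric])
    moreover have "(\<lambda>x::real^'n. (norm (complex_of_real (indicator (cball 0 R) x)))\<^sup>2) = indicator (cball 0 R)"
      by (auto split: split_indicator)
    ultimately show "integrable lborel (\<lambda>x::real^'n. (norm (complex_of_real (indicator (cball 0 R) x)))\<^sup>2)"
      by simp
  qed measurable
  from L2_mult_integrable(1)[OF this f] show ?thesis
    unfolding ball_cut_def[abs_def] by (simp add: scaleR_conv_of_real)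
qed

lemma cut_tendsto:
  fixes f :: "real ^ 'n::finite \<Rightarrow> complex"
  assumes f: "L2 f"
  shows "L2_tendsto (\<lambda>R. ball_cut R f) f at_top"
  unfolding L2_tendsto_def
proof
  have [measurable]: "f \<in> borel_measurable borel" using f by (rule L2_measurable)
  show "\<forall>\<^sub>F R in at_top. L2 (\<lambda>x. ball_cut R f x - f x)"
    by (intro always_eventually allI L2_diff cut_L2 f)
  have "((\<lambda>R. LINT x|lborel. (norm (ball_cut R f x - f x))\<^sup>2) \<longlongrightarrow> (LINT x|(lborel::(real^'n) measure). 0)) at_top"
  proof (rule integral_dominated_convergence_at_top[where w = "\<lambda>x. (norm (f x))\<^sup>2"])
    show "integrable lborel (\<lambda>x. (norm (f x))\<^sup>2)" using f by (simp add: L2_def)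
    show "\<forall>\<^sub>F R in at_top. AE x in lborel. norm ((norm (ball_cut R f x - f x))\<^sup>2) \<le> (norm (f x))\<^sup>2"
      by (intro always_eventually allI AE_I2) (simp add: ball_cut_def split: split_indicator)
    show "AE x in lborel. ((\<lambda>R. (norm (ball_cut R f x - f x))\<^sup>2) \<longlongrightarrow> 0) at_top"
    proof (intro AE_I2 tendsto_eventually)
      fix x :: "real^'n"
      show "\<forall>\<^sub>F R in at_top. (norm (ball_cut R f x - f x))\<^sup>2 = 0"
        using eventually_ge_at_top[of "norm x"] by (elim eventually_mono) (simp add: ball_cut_def)
    qed
    show "(\<lambda>x. (norm (ball_cut R f x - f x))\<^sup>2) \<in> borel_measurable lborel" for R
      unfolding ball_cut_def by measurable
  qed measurable
  then have "((\<lambda>R. sqrt (LINT x|lborel. (norm (ball_cut R f x - f x))\<^sup>2)) \<longlongrightarrow> sqrt 0) at_top"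
    by (intro tendsto_real_sqrt) simp
  then show "((\<lambda>R. L2_norm (\<lambda>x. ball_cut R f x - f x)) \<longlongrightarrow> 0) at_top"
    by (simp add: L2_norm_def)
qed

lemma fourier_L1_lincomb:
  assumes "integrable lborel f" "integrable lborel g"
  shows "fourier_L1 (\<lambda>x. c * f x + g x) \<xi> = c * fourier_L1 f \<xi> + fourier_L1 g \<xi>"
proof -
  have i: "integrable lborel (\<lambda>x. cis (- (x \<bullet> \<xi>)) * f x)" "integrable lborel (\<lambda>x. cis (- (x \<bullet> \<xi>)) * g x)"
    by (intro integrable_cis_mult assms; measurable)+
  have "(LINT x|lborel. cis (- (x \<bullet> \<xi>)) * (c * f x + g x))
     = (LINT x|lborel. c * (cis (- (x \<bullet> \<xi>)) * f x) + cis (- (x \<bullet> \<xi>)) * g x)"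
    by (intro Bochner_Integration.integral_cong refl) (simp add: algebra_simps)
  also have "\<dots> = c * (LINT x|lborel. cis (- (x \<bullet> \<xi>)) * f x) + (LINT x|lborel. cis (- (x \<bullet> \<xi>)) * g x)"
    using i by simp
  finally show ?thesis by (simp add: fourier_L1_def algebra_simps)
qed

lemma fourier_L1_diff:
  assumes "integrable lborel f" "integrable lborel g"
  shows "fourier_L1 (\<lambda>x. f x - g x) \<xi> = fourier_L1 f \<xi> - fourier_L1 g \<xi>"
  using fourier_L1_lincomb[OF assms(2,1), of "-1"] by simp

lemma L2_tendsto_lincomb:
  fixes f g :: "'r \<Rightarrow> 'a::euclidean_space \<Rightarrow> complex"
  assumes "L2_tendsto f v F" "L2_tendsto g w F"
  shows "L2_tendsto (\<lambda>r x. c * f r x + g r x) (\<lambda>x. c * v x + w x) F"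
proof -
  have e: "(\<lambda>x. (c * f r x + g r x) - (c * v x + w x)) = (\<lambda>x. c * (f r x - v x) + (g r x - w x))" for r
    by (auto simp: algebra_simps)
  have ev: "\<forall>\<^sub>F r in F. L2 (\<lambda>x. f r x - v x) \<and> L2 (\<lambda>x. g r x - w x)"
    using assms by (auto simp: L2_tendsto_def eventually_conj_iff)
  have lim: "((\<lambda>r. cmod c * L2_norm (\<lambda>x. f r x - v x) + L2_norm (\<lambda>x. g r x - w x)) \<longlongrightarrow> cmod c * 0 + 0) F"
    using assms by (intro tendsto_intros) (auto simp: L2_tendsto_def)
  have le: "norm (L2_norm (\<lambda>x. c * (f r x - v x) + (g r x - w x)))
      \<le> cmod c * L2_norm (\<lambda>x. f r x - v x) + L2_norm (\<lambda>x. g r x - w x)"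
    if "L2 (\<lambda>x. f r x - v x) \<and> L2 (\<lambda>x. g r x - w x)" for r
    using L2_norm_triangle[OF L2_cmult[of "\<lambda>x. f r x - v x" c] conjunct2[OF that]] that
    by (simp add: L2_norm_cmult L2_norm_nonneg)
  show ?thesis
    unfolding L2_tendsto_def e
  proof
    show "\<forall>\<^sub>F r in F. L2 (\<lambda>x. c * (f r x - v x) + (g r x - w x))"
      using ev by (elim eventually_mono) (auto intro!: L2_add L2_cmult)
    show "((\<lambda>r. L2_norm (\<lambda>x. c * (f r x - v x) + (g r x - w x))) \<longlongrightarrow> 0) F"
      by (rule Lim_null_comparison[OF eventually_mono[OF ev le]]) (use lim in simp_all)
  qed
qed

lemma fourier_transform_lincomb:
  fixes f g :: "real ^ 'n::finite \<Rightarrow> complex"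
  assumes f: "fourier_transform f v" and g: "fourier_transform g w"
  shows "fourier_transform (\<lambda>x. c * f x + g x) (\<lambda>\<xi>. c * v \<xi> + w \<xi>)"
proof -
  have e: "truncated_fourier R (\<lambda>x. c * f x + g x) = (\<lambda>\<xi>. c * truncated_fourier R f \<xi> + truncated_fourier R g \<xi>)" for R
  proof -
    have "ball_cut R (\<lambda>x. c * f x + g x) = (\<lambda>x. c * ball_cut R f x + ball_cut R g x)"
      by (auto simp: ball_cut_def algebra_simps)
    moreover have "L2 f" "L2 g" using f g by (auto simp: fourier_transform_def)
    ultimately show ?thesis
      unfolding truncated_fourier_eq
      by (simp only:) (intro ext fourier_L1_lincomb cut_integrable)
  qed
  show ?thesis
    using f g unfolding fourier_transform_def e
    by (intro conjI L2_add L2_cmult L2_tendsto_lincomb) auto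
qed

theorem Plancherel:
  fixes f :: "real ^ 'n::finite \<Rightarrow> complex"
  assumes "fourier_transform f v"
  shows "L2_norm v = L2_norm f"
proof -
  have f: "L2 f" and v: "L2 v" and lim: "L2_tendsto (\<lambda>R. fourier_L1 (ball_cut R f)) v at_top"
    using assms by (auto simp: fourier_transform_def truncated_fourier_eq)
  have "((\<lambda>R. L2_norm (ball_cut R f)) \<longlongrightarrow> L2_norm v) at_top"
    using L2_tendsto_norm[OF lim v] by (simp only: Plancherel_L1_L2(2)[OF cut_integrable[OF f] cut_L2[OF f]])
  moreover have "((\<lambda>R. L2_norm (ball_cut R f)) \<longlongrightarrow> L2_norm f) at_top"
    by (rule L2_tendsto_norm[OF cut_tendsto[OF f] f])
  ultimately show ?thesis by (intro tendsto_unique[of at_top]) auto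
qed

text \<open>The limit in the mean depends on \<open>f\<close> only up to null sets, and it is itself determined up to
  null sets: both follow from the isometry applied to the difference.\<close>

lemma fourier_transform_unique:
  fixes f g :: "real ^ 'n::finite \<Rightarrow> complex"
  assumes f: "fourier_transform f v" and g: "fourier_transform g w" and e: "AE x in lborel. f x = g x"
  shows "AE \<xi> in lborel. v \<xi> = w \<xi>"
proof -
  have d: "fourier_transform (\<lambda>x. (-1) * f x + g x) (\<lambda>\<xi>. (-1) * v \<xi> + w \<xi>)"
    by (rule fourier_transform_lincomb[OF f g])
  then have L: "L2 (\<lambda>x. (-1) * f x + g x)" "L2 (\<lambda>\<xi>. (-1) * v \<xi> + w \<xi>)"
    by (auto simp: fourier_transform_def)
  have "L2_norm (\<lambda>x. (-1) * f x + g x) = 0"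
    using L2_norm_eq_0_iff[OF L(1)] e by auto
  then have "L2_norm (\<lambda>\<xi>. (-1) * v \<xi> + w \<xi>) = 0" using Plancherel[OF d] by simp
  then show ?thesis using L2_norm_eq_0_iff[OF L(2)] by auto
qed

text \<open>With \<open>c = 1\<close> and \<open>c = \<i>\<close> the norms determine the real and the imaginary part of the inner
  product, so an isometry preserves inner products.\<close>

lemma L2_inner_polarization:
  fixes f g :: "'a::euclidean_space \<Rightarrow> complex"
  assumes f: "L2 f" and g: "L2 g"
  shows "(L2_norm (\<lambda>x. c * g x + f x))\<^sup>2
    = (L2_norm f)\<^sup>2 + (cmod c)\<^sup>2 * (L2_norm g)\<^sup>2 + 2 * Re (cnj c * (LINT x|lborel. f x * cnj (g x)))"
proof -
  have i: "integrable lborel (\<lambda>x. (norm (f x))\<^sup>2)" "integrable lborel (\<lambda>x. (norm (g x))\<^sup>2)"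
    using f g by (auto simp: L2_def)
  have j: "integrable lborel (\<lambda>x. cnj c * (f x * cnj (g x)))"
    using L2_mult_integrable(2)[OF f g] by simp
  have e: "(norm (c * g x + f x))\<^sup>2 = (norm (f x))\<^sup>2 + (cmod c)\<^sup>2 * (norm (g x))\<^sup>2 + 2 * Re (cnj c * (f x * cnj (g x)))" for x
    by (simp add: cmod_power2) (simp add: power2_eq_square algebra_simps)
  have "(LINT x|lborel. Re (cnj c * (f x * cnj (g x)))) = Re (LINT x|lborel. cnj c * (f x * cnj (g x)))"
    by (rule integral_Re[OF j])
  then have r: "(LINT x|lborel. Re (cnj c * (f x * cnj (g x)))) = Re (cnj c * (LINT x|lborel. f x * cnj (g x)))"
    by simp
  have "(L2_norm (\<lambda>x. c * g x + f x))\<^sup>2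
    = (LINT x|lborel. (norm (f x))\<^sup>2 + (cmod c)\<^sup>2 * (norm (g x))\<^sup>2 + 2 * Re (cnj c * (f x * cnj (g x))))"
    unfolding L2_norm_square e ..
  also have "\<dots> = (LINT x|lborel. (norm (f x))\<^sup>2) + (cmod c)\<^sup>2 * (LINT x|lborel. (norm (g x))\<^sup>2)
     + 2 * (LINT x|lborel. Re (cnj c * (f x * cnj (g x))))"
  proof -
    have "integrable lborel (\<lambda>x. Re (cnj c * (f x * cnj (g x))))" by (rule integrable_Re[OF j])
    then show ?thesis using i by (simp del: Re_complex_of_real times_complex.sel)
  qed
  finally show ?thesis unfolding r L2_norm_square .
qed

theorem Parseval:
  fixes f g :: "real ^ 'n::finite \<Rightarrow> complex"
  assumes f: "fourier_transform f v" and g: "fourier_transform g w"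
  shows "(LINT x|lborel. f x * cnj (g x)) = (LINT \<xi>|lborel. v \<xi> * cnj (w \<xi>))"
proof -
  have L: "L2 f" "L2 g" "L2 v" "L2 w" using f g by (auto simp: fourier_transform_def)
  have "Re (cnj c * (LINT x|lborel. f x * cnj (g x))) = Re (cnj c * (LINT \<xi>|lborel. v \<xi> * cnj (w \<xi>)))" for c
    using L2_inner_polarization[OF L(1,2), of c] L2_inner_polarization[OF L(3,4), of c]
      Plancherel[OF f] Plancherel[OF g] Plancherel[OF fourier_transform_lincomb[OF g f, of c]]
    by (simp del: times_complex.sel)
  from this[of 1] this[of \<i>] show ?thesis by (simp add: complex_eq_iff)
qed

text \<open>The isometry, applied to the part of \<open>f\<close> outside a ball, shows that for integrable \<open>f\<close> the
  limit in the mean is the Fourier integral.\<close>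

lemma fourier_transform_L1:
  fixes f :: "real ^ 'n::finite \<Rightarrow> complex"
  assumes f: "integrable lborel f" "L2 f"
  shows "fourier_transform f (fourier_L1 f)"
  unfolding fourier_transform_def L2_tendsto_def truncated_fourier_eq
proof (intro conjI)
  have e: "(\<lambda>\<xi>. fourier_L1 (ball_cut R f) \<xi> - fourier_L1 f \<xi>) = fourier_L1 (\<lambda>x. ball_cut R f x - f x)" for R
    by (rule ext) (rule fourier_L1_diff[OF cut_integrable[OF f(2)] f(1), symmetric])
  have d: "integrable lborel (\<lambda>x. ball_cut R f x - f x)" "L2 (\<lambda>x. ball_cut R f x - f x)" for R
    by (intro Bochner_Integration.integrable_diff L2_diff cut_integrable cut_L2 f)+
  show "\<forall>\<^sub>F R in at_top. L2 (\<lambda>x. fourier_L1 (ball_cut R f) x - fourier_L1 f x)"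
    unfolding e by (intro always_eventually allI Plancherel_L1_L2(1) d)
  show "((\<lambda>R. L2_norm (\<lambda>x. fourier_L1 (ball_cut R f) x - fourier_L1 f x)) \<longlongrightarrow> 0) at_top"
    unfolding e Plancherel_L1_L2(2)[OF d] using cut_tendsto[OF f(2)] by (simp add: L2_tendsto_def)
qed (fact f(2), rule Plancherel_L1_L2(1)[OF f])

text \<open>By the isometry the truncated transforms are Cauchy in \<open>L2\<close>. A subsequence converges so fast
  that it converges almost everywhere, and by the lemma of Fatou its pointwise limit is the limit in
  the mean.\<close>

theorem fourier_transform_exists:
  fixes f :: "real ^ 'n::finite \<Rightarrow> complex"
  assumes f: "L2 f"
  shows "\<exists>v. fourier_transform f v"
proof -
  define a where "a R = L2_norm (\<lambda>x. ball_cut R f x - f x)" for R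
  have a0: "a R \<ge> 0" for R by (simp add: a_def L2_norm_nonneg)
  have a: "(a \<longlongrightarrow> 0) at_top" using cut_tendsto[OF f] by (simp add: L2_tendsto_def a_def[abs_def])
  define F where "F R = fourier_L1 (ball_cut R f)" for R
  have F: "L2 (F R)" for R
    unfolding F_def by (rule Plancherel_L1_L2(1)[OF cut_integrable[OF f] cut_L2[OF f]])
  have Fm [measurable]: "F R \<in> borel_measurable borel" for R using L2_measurable[OF F] .
  have Fd: "L2_norm (\<lambda>\<xi>. F R \<xi> - F S \<xi>) \<le> a R + a S" for R S
  proof -
    have "(\<lambda>\<xi>. F R \<xi> - F S \<xi>) = fourier_L1 (\<lambda>x. ball_cut R f x - ball_cut S f x)"
      unfolding F_def by (rule ext) (rule fourier_L1_diff[OF cut_integrable[OF f] cut_integrable[OF f], symmetric])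
    moreover have "L2_norm (fourier_L1 (\<lambda>x. ball_cut R f x - ball_cut S f x)) = L2_norm (\<lambda>x. ball_cut R f x - ball_cut S f x)"
      by (intro Plancherel_L1_L2(2) Bochner_Integration.integrable_diff L2_diff cut_integrable cut_L2 f)
    moreover have "L2_norm (\<lambda>x. (ball_cut R f x - f x) + (f x - ball_cut S f x)) \<le> a R + L2_norm (\<lambda>x. f x - ball_cut S f x)"
      unfolding a_def by (intro L2_norm_triangle L2_diff cut_L2 f)
    ultimately show ?thesis by (simp add: a_def L2_norm_minus_commute[of f])
  qed
  (* The rate 4^-k leaves room for the weight 2^k, which makes the increments summable pointwise. *)
  have "\<exists>R. a R \<le> (1/4)^k" for k :: nat
    using order_tendstoD(2)[OF a, of "(1/4)^k"] by (auto simp: eventually_at_top_linorder intro: less_imp_le)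
  then obtain \<rho> where \<rho>: "a (\<rho> k) \<le> (1/4)^k" for k :: nat by metis
  define d where "d k \<xi> = F (\<rho> (Suc k)) \<xi> - F (\<rho> k) \<xi>" for k \<xi>
  have d: "L2 (d k)" for k unfolding d_def[abs_def] by (rule L2_diff[OF F F])
  have dm [measurable]: "d k \<in> borel_measurable borel" for k using L2_measurable[OF d] .
  have dn: "(L2_norm (d k))\<^sup>2 \<le> 4 * (1/16)^k" for k
  proof -
    have "a (\<rho> (Suc k)) \<le> (1/4)^k" using \<rho>[of "Suc k"] by (simp add: field_simps)
    then have "L2_norm (d k) \<le> 2 * (1/4)^k"
      using Fd[of "\<rho> (Suc k)" "\<rho> k"] \<rho>[of k] unfolding d_def[abs_def] by linarith
    then have "(L2_norm (d k))\<^sup>2 \<le> (2 * (1/4)^k)\<^sup>2" by (intro power_mono L2_norm_nonneg)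
    also have "\<dots> = 4 * (1/16)^k" by (simp add: power_mult_distrib power_mult[symmetric] mult.commute[of k] power_divide)
      (simp add: power_mult)
    finally show ?thesis .
  qed
  have nn: "(\<integral>\<^sup>+\<xi>. (\<Sum>k. ennreal (2^k * (norm (d k \<xi>))\<^sup>2)) \<partial>lborel) < \<infinity>"
  proof -
    have "(\<integral>\<^sup>+\<xi>. (\<Sum>k. ennreal (2^k * (norm (d k \<xi>))\<^sup>2)) \<partial>lborel) = (\<Sum>k. \<integral>\<^sup>+\<xi>. ennreal (2^k * (norm (d k \<xi>))\<^sup>2) \<partial>lborel)"
      by (rule nn_integral_suminf) measurable
    also have "\<dots> \<le> (\<Sum>k. ennreal (4 * (1/8)^k))"
    proof (intro suminf_le summableI)
      fix k
      have "(\<integral>\<^sup>+\<xi>. ennreal (2^k * (norm (d k \<xi>))\<^sup>2) \<partial>lborel) = ennreal (LINT \<xi>|lborel. 2^k * (norm (d k \<xi>))\<^sup>2)"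
        using d[of k] by (intro nn_integral_eq_integral) (auto simp: L2_def)
      also have "(LINT \<xi>|lborel. 2^k * (norm (d k \<xi>))\<^sup>2) = 2^k * (L2_norm (d k))\<^sup>2"
        by (simp add: L2_norm_square)
      also have "\<dots> \<le> 2^k * (4 * (1/16)^k)" by (intro mult_left_mono dn) simp
      also have "\<dots> = 4 * (2 * (1/16))^k" by (simp only: power_mult_distrib mult.left_commute)
      finally show "(\<integral>\<^sup>+\<xi>. ennreal (2^k * (norm (d k \<xi>))\<^sup>2) \<partial>lborel) \<le> ennreal (4 * (1/8)^k)"
        by (simp add: ennreal_leI)
    qed
    also have "\<dots> = ennreal (\<Sum>k. 4 * (1/8)^k)"
      by (intro suminf_ennreal2 summable_mult summable_geometric) auto
    also have "\<dots> < \<infinity>" by simp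
    finally show ?thesis .
  qed
  have "AE \<xi> in lborel. (\<Sum>k. ennreal (2^k * (norm (d k \<xi>))\<^sup>2)) \<noteq> \<infinity>"
    by (rule nn_integral_PInf_AE) (use nn in \<open>auto\<close>)
  then have conv: "AE \<xi> in lborel. convergent (\<lambda>k. F (\<rho> k) \<xi>)"
  proof (rule AE_mp, intro AE_I2 impI)
    fix \<xi> assume "(\<Sum>k. ennreal (2^k * (norm (d k \<xi>))\<^sup>2)) \<noteq> \<infinity>"
    then have s: "summable (\<lambda>k. 2^k * (norm (d k \<xi>))\<^sup>2)"
      by (intro summable_suminf_not_top) auto
    have "summable (\<lambda>k. norm (d k \<xi>))"
    proof (rule summable_comparison_test'[where N = 0])
      show "summable (\<lambda>k. 2^k * (norm (d k \<xi>))\<^sup>2 + (1/2)^k)"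
        by (intro summable_add s summable_geometric) auto
      fix k :: nat
      show "norm (norm (d k \<xi>)) \<le> 2^k * (norm (d k \<xi>))\<^sup>2 + (1/2)^k"
      proof (cases "norm (d k \<xi>) \<le> (1/2)^k")
        case False
        then have "(1/2)^k * norm (d k \<xi>) \<le> norm (d k \<xi>) * norm (d k \<xi>)"
          by (intro mult_right_mono) auto
        then have "2^k * ((1/2)^k * norm (d k \<xi>)) \<le> 2^k * (norm (d k \<xi>))\<^sup>2"
          unfolding power2_eq_square by (intro mult_left_mono) auto
        moreover have "2^k * ((1/2)^k * norm (d k \<xi>)) = norm (d k \<xi>)"
          by (simp add: power_divide)
        moreover have "0 \<le> (1/2::real)^k" by simp
        ultimately show ?thesis unfolding real_norm_def abs_norm_cancel by linarith
      qed (simp add: add_increasing)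
    qed
    then have "summable (\<lambda>k. d k \<xi>)" by (rule summable_norm_cancel)
    then have "convergent (\<lambda>n. \<Sum>k<n. d k \<xi>)" by (simp add: summable_iff_convergent)
    then have "convergent (\<lambda>n. (\<Sum>k<n. d k \<xi>) + F (\<rho> 0) \<xi>)" by (intro convergent_add convergent_const)
    moreover have "(\<Sum>k<n. d k \<xi>) + F (\<rho> 0) \<xi> = F (\<rho> n) \<xi>" for n
      unfolding d_def by (subst sum_lessThan_telescope) simp
    ultimately show "convergent (\<lambda>k. F (\<rho> k) \<xi>)" by simp
  qed
  define w where "w \<xi> = lim (\<lambda>k. F (\<rho> k) \<xi>)" for \<xi>
  have wm [measurable]: "w \<in> borel_measurable borel" unfolding w_def[abs_def] by measurable
  have conv_w: "AE \<xi> in lborel. (\<lambda>k. F (\<rho> k) \<xi>) \<longlonglongrightarrow> w \<xi>"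
    using conv by (auto simp: convergent_LIMSEQ_iff w_def)
  have bound: "L2 (\<lambda>\<xi>. F R \<xi> - w \<xi>) \<and> L2_norm (\<lambda>\<xi>. F R \<xi> - w \<xi>) \<le> a R" for R
  proof -
    have "(\<integral>\<^sup>+\<xi>. ennreal ((norm (F R \<xi> - w \<xi>))\<^sup>2) \<partial>lborel)
       = (\<integral>\<^sup>+\<xi>. liminf (\<lambda>k. ennreal ((norm (F R \<xi> - F (\<rho> k) \<xi>))\<^sup>2)) \<partial>lborel)"
    proof (rule nn_integral_cong_AE, use conv_w in \<open>rule AE_mp\<close>, intro AE_I2 impI)
      fix \<xi> assume "(\<lambda>k. F (\<rho> k) \<xi>) \<longlonglongrightarrow> w \<xi>"
      then have "(\<lambda>k. ennreal ((norm (F R \<xi> - F (\<rho> k) \<xi>))\<^sup>2)) \<longlonglongrightarrow> ennreal ((norm (F R \<xi> - w \<xi>))\<^sup>2)"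
        by (intro tendsto_ennrealI tendsto_intros)
      then show "ennreal ((norm (F R \<xi> - w \<xi>))\<^sup>2) = liminf (\<lambda>k. ennreal ((norm (F R \<xi> - F (\<rho> k) \<xi>))\<^sup>2))"
        by (intro lim_imp_Liminf[symmetric]) auto
    qed
    also have "\<dots> \<le> liminf (\<lambda>k. \<integral>\<^sup>+\<xi>. ennreal ((norm (F R \<xi> - F (\<rho> k) \<xi>))\<^sup>2) \<partial>lborel)"
      by (rule nn_integral_liminf) measurable
    also have "\<dots> \<le> liminf (\<lambda>k. ennreal ((a R + (1/4)^k)\<^sup>2))"
    proof (rule Liminf_mono, intro always_eventually allI)
      fix k
      have "(\<integral>\<^sup>+\<xi>. ennreal ((norm (F R \<xi> - F (\<rho> k) \<xi>))\<^sup>2) \<partial>lborel) = ennreal ((L2_norm (\<lambda>\<xi>. F R \<xi> - F (\<rho> k) \<xi>))\<^sup>2)"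
        unfolding L2_norm_square using L2_diff[OF F[of R] F[of "\<rho> k"]]
        by (intro nn_integral_eq_integral) (auto simp: L2_def)
      also have "\<dots> \<le> ennreal ((a R + (1/4)^k)\<^sup>2)"
        using Fd[of R "\<rho> k"] \<rho>[of k] by (intro ennreal_leI power_mono L2_norm_nonneg) linarith
      finally show "(\<integral>\<^sup>+\<xi>. ennreal ((norm (F R \<xi> - F (\<rho> k) \<xi>))\<^sup>2) \<partial>lborel) \<le> ennreal ((a R + (1/4)^k)\<^sup>2)" .
    qed
    also have "\<dots> = ennreal ((a R)\<^sup>2)"
    proof (rule lim_imp_Liminf)
      have "(\<lambda>k. ennreal ((a R + (1/4)^k)\<^sup>2)) \<longlonglongrightarrow> ennreal ((a R + 0)\<^sup>2)"
        by (intro tendsto_ennrealI tendsto_intros LIMSEQ_realpow_zero) auto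
      then show "(\<lambda>k. ennreal ((a R + (1/4)^k)\<^sup>2)) \<longlonglongrightarrow> ennreal ((a R)\<^sup>2)" by simp
    qed simp
    finally have le: "(\<integral>\<^sup>+\<xi>. ennreal ((norm (F R \<xi> - w \<xi>))\<^sup>2) \<partial>lborel) \<le> ennreal ((a R)\<^sup>2)" .
    then have i: "integrable lborel (\<lambda>\<xi>. (norm (F R \<xi> - w \<xi>))\<^sup>2)"
      by (intro integrableI_bounded) (auto simp: top_unique less_top[symmetric])
    have "ennreal ((L2_norm (\<lambda>\<xi>. F R \<xi> - w \<xi>))\<^sup>2) \<le> ennreal ((a R)\<^sup>2)"
      using le unfolding L2_norm_square by (subst (asm) nn_integral_eq_integral[OF i]) auto
    then have "(L2_norm (\<lambda>\<xi>. F R \<xi> - w \<xi>))\<^sup>2 \<le> (a R)\<^sup>2" by simp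
    then have "L2_norm (\<lambda>\<xi>. F R \<xi> - w \<xi>) \<le> a R" by (rule power2_le_imp_le[OF _ a0])
    moreover have "L2 (\<lambda>\<xi>. F R \<xi> - w \<xi>)" using i by (simp add: L2_def)
    ultimately show ?thesis by blast
  qed
  have "L2 (\<lambda>\<xi>. F 0 \<xi> - (F 0 \<xi> - w \<xi>))" by (rule L2_diff[OF F]) (use bound in blast)
  then have w: "L2 w" by simp
  have "L2_tendsto F w at_top"
    unfolding L2_tendsto_def
  proof
    show "\<forall>\<^sub>F R in at_top. L2 (\<lambda>x. F R x - w x)" using bound by simp
    show "((\<lambda>R. L2_norm (\<lambda>x. F R x - w x)) \<longlongrightarrow> 0) at_top"
      by (rule Lim_null_comparison[OF always_eventually[OF allI] a]) (simp add: bound L2_norm_nonneg)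
  qed
  then have "fourier_transform f w"
    using f w unfolding fourier_transform_def truncated_fourier_eq F_def[abs_def] by blast
  then show ?thesis by (rule exI[of _ w])
qed

section \<open>Smooth bump functions on the line\<close>

text \<open>The function \<open>exp (- 1 / (1 - x\<^sup>2))\<close> on the open interval, extended by zero, together with the
  rational factors that its derivatives acquire. The family is closed under differentiation, so
  smoothness needs no formula for the higher derivatives.\<close>

definition bump_poly :: "real poly \<Rightarrow> nat \<Rightarrow> real \<Rightarrow> real" where
  "bump_poly p k x = (if \<bar>x\<bar> < 1 then poly p x / (1 - x\<^sup>2) ^ k * exp (- (1 / (1 - x\<^sup>2))) else 0)"

lemma exp_minus_inverse_le:
  assumes "y > (0::real)"
  shows "exp (- (1 / y)) \<le> fact n * y ^ n"
proof -
  have "(1 / y) ^ n / fact n \<le> exp (1 / y)"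
  proof -
    have "(1 / y) ^ n /\<^sub>R fact n \<le> (\<Sum>k. (1 / y) ^ k /\<^sub>R fact k)"
      using sum_le_suminf[OF summable_exp_generic[of "1 / y"], of "{n}"] assms by simp
    then show ?thesis by (simp add: exp_def divide_inverse mult.commute)
  qed
  then show ?thesis using assms by (simp add: exp_minus field_simps)
qed

text \<open>The exponential beats every power of \<open>1 - x\<^sup>2\<close>, so the function is bounded by a multiple of
  \<open>(x - a)\<^sup>2\<close> near the end point \<open>a\<close>.\<close>

lemma bump_poly_deriv_at_edge:
  assumes "\<bar>a\<bar> = 1"
  shows "(bump_poly p k has_real_derivative 0) (at a)"
proof -
  have ba: "bump_poly p k a = 0" using assms by (simp add: bump_poly_def)
  obtain M where M: "\<And>x. x \<in> {-1..1} \<Longrightarrow> \<bar>poly p x\<bar> \<le> M"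
  proof -
    have "compact (poly p ` {-1..1})"
      by (intro compact_continuous_image continuous_intros) auto
    then have "bounded (poly p ` {-1..1})" by (rule compact_imp_bounded)
    then obtain M where "\<forall>x\<in>{-1..1}. \<bar>poly p x\<bar> \<le> M" by (auto simp: bounded_iff)
    then show ?thesis by (intro that[of M]) auto
  qed
  have M0: "0 \<le> M" using M[of 0] by auto
  have le: "\<bar>bump_poly p k x\<bar> \<le> (4 * M * fact (k + 2)) * \<bar>x - a\<bar>\<^sup>2" for x
  proof (cases "\<bar>x\<bar> < 1")
    case True
    define y where "y = 1 - x\<^sup>2"
    have y: "y > 0" using True by (simp add: y_def abs_square_less_1)
    have ya: "y \<le> 2 * \<bar>x - a\<bar>"
    proof -
      have "y = (1 - x) * (1 + x)" by (simp add: y_def power2_eq_square algebra_simps)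
      moreover have "(1 - x) * (1 + x) \<le> (1 - x) * 2"
        by (rule mult_left_mono) (use True in auto)
      moreover have "(1 - x) * (1 + x) \<le> 2 * (1 + x)"
        by (rule mult_right_mono) (use True in auto)
      moreover have "a = 1 \<or> a = -1" using assms by auto
      ultimately show ?thesis using True by auto
    qed
    have "\<bar>bump_poly p k x\<bar> = \<bar>poly p x\<bar> / y ^ k * exp (- (1 / y))"
      using True y by (simp add: bump_poly_def y_def[symmetric] abs_mult)
    also have "\<dots> \<le> M / y ^ k * (fact (k + 2) * y ^ (k + 2))"
      using True y M0 by (intro mult_mono divide_right_mono M exp_minus_inverse_le) auto
    also have "\<dots> = M * fact (k + 2) * y\<^sup>2" using y by (simp add: power_add power2_eq_square)
    also have "\<dots> \<le> M * fact (k + 2) * (2 * \<bar>x - a\<bar>)\<^sup>2"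
      using y ya M0 by (intro mult_left_mono power_mono) auto
    finally show ?thesis by (simp add: power_mult_distrib)
  qed (use M0 in \<open>simp add: bump_poly_def\<close>)
  have "((\<lambda>x. (bump_poly p k x - bump_poly p k a) / (x - a)) \<longlongrightarrow> 0) (at a)"
  proof (rule Lim_null_comparison)
    show "\<forall>\<^sub>F x in at a. norm ((bump_poly p k x - bump_poly p k a) / (x - a)) \<le> (4 * M * fact (k + 2)) * \<bar>x - a\<bar>"
      using le ba by (auto simp: eventually_at_filter divide_simps abs_mult power2_eq_square mult.assoc
          intro!: always_eventually)
    have "((\<lambda>x. (4 * M * fact (k + 2)) * \<bar>x - a\<bar>) \<longlongrightarrow> (4 * M * fact (k + 2)) * \<bar>a - a\<bar>) (at a)"
      by (intro tendsto_intros)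
    then show "((\<lambda>x. (4 * M * fact (k + 2)) * \<bar>x - a\<bar>) \<longlongrightarrow> 0) (at a)" by simp
  qed
  then show ?thesis by (simp add: has_field_derivative_iff)
qed

lemma bump_poly_deriv:
  "(bump_poly p k has_real_derivative
    bump_poly (pderiv p * [:1, 0, -1:] ^ 2 + smult (2 * real k) [:0, 1:] * p * [:1, 0, -1:] - [:0, 2:] * p) (k + 2) x) (at x)"
  (is "(_ has_real_derivative bump_poly ?q _ _) _")
proof -
  have q: "poly ?q x = poly (pderiv p) x * (1 - x\<^sup>2)\<^sup>2 + 2 * real k * x * poly p x * (1 - x\<^sup>2) - 2 * x * poly p x"
    by (simp add: power2_eq_square algebra_simps)
  consider "\<bar>x\<bar> < 1" | "\<bar>x\<bar> = 1" | "\<bar>x\<bar> > 1" by linarith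
  then show ?thesis
  proof cases
    case 1
    define y where "y = 1 - x\<^sup>2"
    have y: "y > 0" using 1 by (simp add: y_def abs_square_less_1)
    have qy: "poly ?q x = poly (pderiv p) x * y\<^sup>2 + 2 * real k * x * poly p x * y - 2 * x * poly p x"
      unfolding q y_def ..
    have byy: "bump_poly ?q (k + 2) x = (poly (pderiv p) x * y\<^sup>2 + 2 * real k * x * poly p x * y - 2 * x * poly p x) / y ^ (k + 2) * exp (- (1 / y))"
      using 1 unfolding bump_poly_def qy y_def by simp
    have d: "((\<lambda>x. poly p x / (1 - x\<^sup>2) ^ k * exp (- (1 / (1 - x\<^sup>2)))) has_real_derivative
      bump_poly ?q (k + 2) x) (at x)"
    proof (cases k)
      case 0
      have "((\<lambda>x. poly p x * exp (- (1 / (1 - x\<^sup>2)))) has_real_derivative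
          poly (pderiv p) x * exp (- (1 / y)) + poly p x * (exp (- (1 / y)) * (- (2 * x / y\<^sup>2)))) (at x)"
        using y unfolding y_def
        by (auto intro!: derivative_eq_intros poly_DERIV simp: power2_eq_square)
      moreover have "poly (pderiv p) x * exp (- (1 / y)) + poly p x * (exp (- (1 / y)) * (- (2 * x / y\<^sup>2))) = bump_poly ?q (k + 2) x"
        unfolding byy using y 0 by (simp add: field_simps power2_eq_square)
      ultimately show ?thesis using 0 by simp
    next
      case (Suc j)
      have 1: "((\<lambda>x. 1 - x\<^sup>2) has_real_derivative (- 2 * x)) (at x)"
        by (auto intro!: derivative_eq_intros)
      have 2: "((\<lambda>x. exp (- (1 / (1 - x\<^sup>2)))) has_real_derivative exp (- (1 / y)) * (- (2 * x / y\<^sup>2))) (at x)"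
        using y unfolding y_def by (auto intro!: derivative_eq_intros simp: power2_eq_square)
      have "((\<lambda>x. poly p x / (1 - x\<^sup>2) ^ Suc j * exp (- (1 / (1 - x\<^sup>2)))) has_real_derivative
          ((poly (pderiv p) x * y ^ Suc j - ((1 + real j) * ((- 2 * x) * y ^ j)) * poly p x) / (y ^ Suc j) ^ Suc (Suc 0)) * exp (- (1 / y))
           + (exp (- (1 / y)) * (- (2 * x / y\<^sup>2))) * (poly p x / y ^ Suc j)) (at x)"
        using y DERIV_mult[OF DERIV_quotient[OF poly_DERIV[of p] DERIV_power_Suc[OF 1, of j]] 2]
        unfolding y_def by simp
      moreover have "((poly (pderiv p) x * y ^ Suc j - ((1 + real j) * ((- 2 * x) * y ^ j)) * poly p x) / (y ^ Suc j) ^ Suc (Suc 0)) * exp (- (1 / y))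
           + (exp (- (1 / y)) * (- (2 * x / y\<^sup>2))) * (poly p x / y ^ Suc j) = bump_poly ?q (k + 2) x"
        unfolding byy using y Suc by (simp add: field_simps power2_eq_square)
      ultimately show ?thesis using Suc by simp
    qed
    have "\<forall>\<^sub>F z in nhds x. \<bar>z\<bar> < 1"
      using 1 by (intro eventually_nhds_in_open[of "{z. \<bar>z\<bar> < 1}" x, simplified] open_Collect_less continuous_intros) auto
    then have "\<forall>\<^sub>F z in nhds x. bump_poly p k z = poly p z / (1 - z\<^sup>2) ^ k * exp (- (1 / (1 - z\<^sup>2)))"
      by (elim eventually_mono) (simp add: bump_poly_def)
    then show ?thesis using d by (subst DERIV_cong_ev[OF refl _ refl]) auto
  next
    case 2
    then show ?thesis using bump_poly_deriv_at_edge[of x p k] by (simp add: bump_poly_def)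
  next
    case 3
    have "\<forall>\<^sub>F z in nhds x. \<bar>z\<bar> > 1"
      using 3 by (intro eventually_nhds_in_open[of "{z. 1 < \<bar>z\<bar>}" x, simplified] open_Collect_less continuous_intros) auto
    then have "\<forall>\<^sub>F z in nhds x. bump_poly p k z = 0"
      by (elim eventually_mono) (simp add: bump_poly_def)
    moreover have "bump_poly ?q (k + 2) x = 0" using 3 by (simp add: bump_poly_def)
    ultimately show ?thesis by (subst DERIV_cong_ev[OF refl _ refl]) auto
  qed
qed

text \<open>The closure of the family under rescaling and translation, which test functions at every
  scale and position require.\<close>

definition bump_like :: "(real \<Rightarrow> real) \<Rightarrow> bool" where
  "bump_like g \<longleftrightarrow> (\<exists>c s y p k. s > 0 \<and> g = (\<lambda>t. c * bump_poly p k (s * (t - y))))"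

lemma bump_like_deriv:
  assumes "bump_like g"
  shows "\<exists>g'. bump_like g' \<and> (\<forall>t. (g has_real_derivative g' t) (at t))"
proof -
  obtain c s y p k where s: "s > 0" and g: "g = (\<lambda>t. c * bump_poly p k (s * (t - y)))"
    using assms by (auto simp: bump_like_def)
  obtain q where q: "\<And>x. (bump_poly p k has_real_derivative bump_poly q (k + 2) x) (at x)"
    using bump_poly_deriv by blast
  have "(g has_real_derivative (c * s) * bump_poly q (k + 2) (s * (t - y))) (at t)" for t
  proof -
    have "((\<lambda>t. bump_poly p k (s * (t - y))) has_real_derivative bump_poly q (k + 2) (s * (t - y)) * s) (at t)"
      by (rule DERIV_chain2[OF q]) (auto intro!: derivative_eq_intros)
    then show ?thesis unfolding g by (auto intro!: derivative_eq_intros)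
  qed
  moreover have "bump_like (\<lambda>t. (c * s) * bump_poly q (k + 2) (s * (t - y)))"
    unfolding bump_like_def using s by blast
  ultimately show ?thesis by blast
qed

lemma bump_like_support:
  assumes "bump_like g"
  shows "\<exists>R>0. \<forall>t. \<bar>t\<bar> \<ge> R \<longrightarrow> g t = 0"
proof -
  obtain c s y p k where s: "s > 0" and g: "g = (\<lambda>t. c * bump_poly p k (s * (t - y)))"
    using assms by (auto simp: bump_like_def)
  have "g t = 0" if "\<bar>t\<bar> \<ge> \<bar>y\<bar> + 1 / s" for t
  proof -
    have "1 / s \<le> \<bar>t - y\<bar>" using that by linarith
    then have "s * (1 / s) \<le> s * \<bar>t - y\<bar>" using s by (intro mult_left_mono) auto
    then have "1 \<le> \<bar>s * (t - y)\<bar>" using s by (simp only: abs_mult) simp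
    then have "\<not> \<bar>s * (t - y)\<bar> < 1" by simp
    then show ?thesis by (simp only: g bump_poly_def if_False mult_zero_right)
  qed
  then show ?thesis using s by (intro exI[of _ "\<bar>y\<bar> + 1 / s"]) (auto intro: add_nonneg_pos)
qed

lemma bump_like_continuous: "bump_like g \<Longrightarrow> continuous_on UNIV g"
  using bump_like_deriv[of g] by (metis DERIV_isCont continuous_at_imp_continuous_on)

lemma compact_support_integrable:
  fixes g :: "real \<Rightarrow> 'b::euclidean_space"
  assumes "continuous_on UNIV g" "\<And>t. \<bar>t\<bar> \<ge> R \<Longrightarrow> g t = 0"
  shows "integrable lborel g"
proof -
  have "set_integrable lborel {-R..R} g"
    by (intro borel_integrable_atLeastAtMost' continuous_on_subset[OF assms(1)]) auto
  moreover have "(\<lambda>t. indicator {-R..R} t *\<^sub>R g t) = g"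
    using assms(2) by (force simp: indicator_def fun_eq_iff)
  ultimately show ?thesis by (simp add: set_integrable_def)
qed

text \<open>Integration by parts without boundary terms: the derivative of \<open>cis (- t s) g(t)\<close> has integral
  zero, because \<open>g\<close> vanishes outside a bounded interval.\<close>

lemma bump_like_fourier_deriv:
  assumes g: "bump_like g" and g': "bump_like g'" and d: "\<And>t. (g has_real_derivative g' t) (at t)"
  shows "integrable lborel (\<lambda>t. cis (- (t * s)) * complex_of_real (g t))"
    and "(LINT t|lborel. cis (- (t * s)) * complex_of_real (g' t))
      = \<i> * complex_of_real s * (LINT t|lborel. cis (- (t * s)) * complex_of_real (g t))"
proof -
  obtain R1 where R1: "\<And>t. \<bar>t\<bar> \<ge> R1 \<Longrightarrow> g t = 0" "R1 > 0" using bump_like_support[OF g] by auto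
  obtain R2 where R2: "\<And>t. \<bar>t\<bar> \<ge> R2 \<Longrightarrow> g' t = 0" "R2 > 0" using bump_like_support[OF g'] by auto
  define R where "R = max R1 R2"
  have c: "continuous_on UNIV (\<lambda>t. cis (- (t * s)) * complex_of_real (g t))"
    "continuous_on UNIV (\<lambda>t. cis (- (t * s)) * complex_of_real (g' t))"
    using bump_like_continuous[OF g] bump_like_continuous[OF g'] by (auto intro!: continuous_intros)
  show i: "integrable lborel (\<lambda>t. cis (- (t * s)) * complex_of_real (g t))"
    by (rule compact_support_integrable[OF c(1), of R]) (auto simp: R_def R1)
  have i': "integrable lborel (\<lambda>t. cis (- (t * s)) * complex_of_real (g' t))"
    by (rule compact_support_integrable[OF c(2), of R]) (auto simp: R_def R2)
  let ?D = "\<lambda>t. cis (- (t * s)) * complex_of_real (g' t) - \<i> * complex_of_real s * (cis (- (t * s)) * complex_of_real (g t))"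
  have D: "((\<lambda>t. cis (- (t * s)) * complex_of_real (g t)) has_vector_derivative ?D t) (at t within S)" for t S
  proof -
    have "((\<lambda>t. cis (- (t * s))) has_vector_derivative (- s) *\<^sub>R (\<i> * cis (- (t * s)))) (at t within S)"
    proof -
      have "((\<lambda>t. - (t * s)) has_derivative (\<lambda>h. - (h * s))) (at t within S)"
        by (auto intro!: derivative_eq_intros)
      from has_derivative_cis[OF this] show ?thesis
        by (simp add: has_vector_derivative_def)
    qed
    moreover have "((\<lambda>t. complex_of_real (g t)) has_vector_derivative complex_of_real (g' t)) (at t within S)"
      using d[of t] by (intro has_vector_derivative_of_real) (auto intro: has_vector_derivative_at_within DERIV_subset)
    ultimately show ?thesis
      by (rule has_vector_derivative_eq_rhs[OF has_vector_derivative_mult]) (simp add: scaleR_conv_of_real algebra_simps)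
  qed
  have "(?D has_integral (cis (- (R * s)) * complex_of_real (g R) - cis (- ((- R) * s)) * complex_of_real (g (- R)))) {-R..R}"
    by (rule fundamental_theorem_of_calculus) (use R1 in \<open>auto intro!: D simp: R_def\<close>)
  then have "(?D has_integral 0) {-R..R}" using R1(2) by (simp add: R1(1) R_def)
  then have "(?D has_integral 0) UNIV"
    by (rule has_integral_on_superset) (auto simp: R_def R1 R2)
  moreover have "(?D has_integral (LINT t|lborel. ?D t)) UNIV"
    using i i' by (intro has_integral_integral_lborel) auto
  ultimately have "(LINT t|lborel. ?D t) = 0" by (rule has_integral_unique[symmetric])
  then show "(LINT t|lborel. cis (- (t * s)) * complex_of_real (g' t))
      = \<i> * complex_of_real s * (LINT t|lborel. cis (- (t * s)) * complex_of_real (g t))"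
    using i i' by simp
qed

section \<open>Test functions of product form\<close>

definition tensor :: "(real ^ 'n::finite \<Rightarrow> real \<Rightarrow> real) \<Rightarrow> real ^ 'n \<Rightarrow> real" where
  "tensor g x = (\<Prod>b\<in>Basis. g b (x \<bullet> b))"

text \<open>Differentiating a product of functions of the single coordinates replaces one factor by its
  derivative, so the class of such products is closed under partial derivatives.\<close>

lemma tensor_has_derivative:
  fixes g g' :: "real ^ 'n::finite \<Rightarrow> real \<Rightarrow> real"
  assumes d: "\<forall>b\<in>Basis. \<forall>t. (g b has_real_derivative g' b t) (at t)"
  shows "(tensor g has_derivative (\<lambda>y. \<Sum>b\<in>Basis. (y \<bullet> b) * tensor (g(b := g' b)) x)) (at x)"
proof -
  have "((\<lambda>x. \<Prod>b\<in>Basis. g b (x \<bullet> b)) has_derivative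
      (\<lambda>y. \<Sum>b\<in>Basis. (g' b (x \<bullet> b) * (y \<bullet> b)) * (\<Prod>c\<in>Basis - {b}. g c (x \<bullet> c)))) (at x)"
  proof (rule has_derivative_prod)
    fix b :: "real ^ 'n" assume b: "b \<in> Basis"
    have "((\<lambda>x. x \<bullet> b) has_derivative (\<lambda>y. y \<bullet> b)) (at x)"
      by (auto intro!: derivative_eq_intros)
    have "(g b has_derivative (*) (g' b (x \<bullet> b))) (at (x \<bullet> b))"
      using d b by (auto intro: has_field_derivative_imp_has_derivative)
    from has_derivative_compose[OF \<open>((\<lambda>x. x \<bullet> b) has_derivative (\<lambda>y. y \<bullet> b)) (at x)\<close> this]
    show "((\<lambda>x. g b (x \<bullet> b)) has_derivative (\<lambda>y. g' b (x \<bullet> b) * (y \<bullet> b))) (at x)" .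
  qed
  moreover have "(\<lambda>y. \<Sum>b\<in>Basis. (g' b (x \<bullet> b) * (y \<bullet> b)) * (\<Prod>c\<in>Basis - {b}. g c (x \<bullet> c)))
    = (\<lambda>y. \<Sum>b\<in>Basis. (y \<bullet> b) * tensor (g(b := g' b)) x)"
  proof (rule ext, rule sum.cong[OF refl])
    fix y b :: "real ^ 'n" assume b: "b \<in> Basis"
    have "tensor (g(b := g' b)) x = g' b (x \<bullet> b) * (\<Prod>c\<in>Basis - {b}. (g(b := g' b)) c (x \<bullet> c))"
      unfolding tensor_def by (subst prod.remove[OF _ b]) auto
    also have "(\<Prod>c\<in>Basis - {b}. (g(b := g' b)) c (x \<bullet> c)) = (\<Prod>c\<in>Basis - {b}. g c (x \<bullet> c))"
      by (intro prod.cong) auto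
    finally show "(g' b (x \<bullet> b) * (y \<bullet> b)) * (\<Prod>c\<in>Basis - {b}. g c (x \<bullet> c)) = (y \<bullet> b) * tensor (g(b := g' b)) x"
      by (simp only: mult_ac)
  qed
  ultimately show ?thesis by (simp only: tensor_def[abs_def])
qed

lemma tensor_partial_deriv:
  fixes g g' :: "real ^ 'n::finite \<Rightarrow> real \<Rightarrow> real"
  assumes d: "\<forall>b\<in>Basis. \<forall>t. (g b has_real_derivative g' b t) (at t)"
  shows "partial_deriv i (tensor g) = tensor (g(axis i 1 := g' (axis i 1)))"
proof
  fix x :: "real ^ 'n"
  have i: "axis i (1::real) \<in> (Basis :: (real ^ 'n) set)" by (simp add: axis_in_Basis_iff)
  have "partial_deriv i (tensor g) x = (\<Sum>b\<in>Basis. (axis i 1 \<bullet> b) * tensor (g(b := g' b)) x)"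
    unfolding partial_deriv_def
    by (simp only: frechet_derivative_at[OF tensor_has_derivative[OF d], symmetric])
  also have "\<dots> = (\<Sum>b\<in>Basis. if b = axis i 1 then tensor (g(b := g' b)) x else 0)"
    by (intro sum.cong refl) (auto simp: inner_Basis i)
  also have "\<dots> = tensor (g(axis i 1 := g' (axis i 1))) x"
    using i by simp
  finally show "partial_deriv i (tensor g) x = tensor (g(axis i 1 := g' (axis i 1))) x" .
qed

lemma tensor_C_space:
  fixes g :: "real ^ 'n::finite \<Rightarrow> real \<Rightarrow> real"
  assumes g: "\<forall>b\<in>Basis. bump_like (g b)"
  shows "C_space k (tensor g)"
  using assms
proof (induction k arbitrary: g)
  case 0
  have "continuous_on UNIV (\<lambda>x. g b (x \<bullet> b))" if "b \<in> Basis" for b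
  proof -
    have "continuous_on UNIV (g b)" using bump_like_continuous[of "g b"] 0 that by blast
    moreover have "continuous_on UNIV (\<lambda>x. x \<bullet> b)" by (intro continuous_intros)
    ultimately show ?thesis by (rule continuous_on_compose2) simp
  qed
  then show ?case
    unfolding tensor_def[abs_def] by (auto intro!: continuous_on_prod)
next
  case (Suc k)
  have "\<forall>b\<in>Basis. \<exists>h. bump_like h \<and> (\<forall>t. (g b has_real_derivative h t) (at t))"
    using bump_like_deriv Suc.prems by blast
  from bchoice[OF this] obtain g' where g': "\<forall>b\<in>Basis. bump_like (g' b) \<and> (\<forall>t. (g b has_real_derivative g' b t) (at t))" by blast
  then have d: "\<forall>b\<in>Basis. \<forall>t. (g b has_real_derivative g' b t) (at t)" by blast
  have "tensor g differentiable_on UNIV"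
    using tensor_has_derivative[OF d] by (auto simp: differentiable_on_def differentiable_def)
  moreover have "C_space k (partial_deriv i (tensor g))" for i
    unfolding tensor_partial_deriv[OF d]
    by (rule Suc.IH) (use Suc.prems g' in \<open>auto simp: axis_in_Basis_iff\<close>)
  ultimately show ?case by simp
qed

lemma tensor_support:
  fixes g :: "real ^ 'n::finite \<Rightarrow> real \<Rightarrow> real"
  assumes g: "\<forall>b\<in>Basis. bump_like (g b)"
  shows "\<exists>R. {x. tensor g x \<noteq> 0} \<subseteq> cball 0 R"
proof -
  have "\<forall>b\<in>Basis. \<exists>R. \<forall>t. \<bar>t\<bar> \<ge> R \<longrightarrow> g b t = 0"
    using bump_like_support g by blast
  from bchoice[OF this] obtain R where "\<forall>b\<in>Basis. \<forall>t. \<bar>t\<bar> \<ge> R b \<longrightarrow> g b t = 0" by blast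
  then have R: "\<And>b. b \<in> Basis \<Longrightarrow> \<forall>t. \<bar>t\<bar> \<ge> R b \<longrightarrow> g b t = 0" by blast
  have "norm x \<le> (\<Sum>b\<in>Basis. R b)" if "tensor g x \<noteq> 0" for x :: "real ^ 'n"
  proof -
    have "\<bar>x \<bullet> b\<bar> \<le> R b" if b: "b \<in> Basis" for b
    proof (rule ccontr)
      assume "\<not> \<bar>x \<bullet> b\<bar> \<le> R b"
      then have "g b (x \<bullet> b) = 0" using R[OF b] by simp
      then have "tensor g x = 0" unfolding tensor_def using b by auto
      then show False using \<open>tensor g x \<noteq> 0\<close> by simp
    qed
    then show ?thesis using norm_le_l1[of x] by (meson order_trans sum_mono)
  qed
  then show ?thesis by (intro exI[of _ "\<Sum>b\<in>(Basis :: (real ^ 'n) set). R b"]) auto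
qed

lemma tensor_test_function:
  fixes g :: "real ^ 'n::finite \<Rightarrow> real \<Rightarrow> real"
  assumes g: "\<forall>b\<in>Basis. bump_like (g b)"
  shows "test_function (tensor g)"
  unfolding test_function_def
proof
  show "\<forall>k. C_space k (tensor g)" using tensor_C_space[OF g] by blast
  show "compact (closure {x. tensor g x \<noteq> 0})"
    using tensor_support[OF g] by (metis bounded_cball bounded_subset compact_closure)
qed

lemma tensor_L2:
  fixes g :: "real ^ 'n::finite \<Rightarrow> real \<Rightarrow> real"
  assumes g: "\<forall>b\<in>Basis. bump_like (g b)"
  shows "integrable lborel (\<lambda>x. complex_of_real (tensor g x))" "L2 (\<lambda>x. complex_of_real (tensor g x))"
proof -
  have c: "continuous_on UNIV (tensor g)" using tensor_C_space[OF g, of 0] by simp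
  have m [measurable]: "tensor g \<in> borel_measurable borel" by (rule borel_measurable_continuous_onI[OF c])
  obtain R where R: "{x. tensor g x \<noteq> 0} \<subseteq> cball 0 R" using tensor_support[OF g] by auto
  have i: "integrable lborel (\<lambda>x. indicator (cball 0 R) x *\<^sub>R h x)" if "continuous_on UNIV h" for h :: "real^'n \<Rightarrow> real"
    using borel_integrable_compact[OF compact_cball continuous_on_subset[OF that subset_UNIV], of 0 R] by simp
  have "integrable lborel (tensor g)"
  proof -
    have "(\<lambda>x. indicator (cball 0 R) x *\<^sub>R tensor g x) = tensor g"
      using R by (auto simp: indicator_def fun_eq_iff)
    then show ?thesis using i[OF c] by simp
  qed
  then show "integrable lborel (\<lambda>x. complex_of_real (tensor g x))" by (rule integrable_of_real)
  have "integrable lborel (\<lambda>x. (tensor g x)\<^sup>2)"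
  proof -
    have "(\<lambda>x. indicator (cball 0 R) x *\<^sub>R (tensor g x)\<^sup>2) = (\<lambda>x. (tensor g x)\<^sup>2)"
      using R by (auto simp: indicator_def fun_eq_iff)
    then show ?thesis using i[of "\<lambda>x. (tensor g x)\<^sup>2"] c by (simp add: continuous_on_power)
  qed
  then show "L2 (\<lambda>x. complex_of_real (tensor g x))" unfolding L2_def by simp
qed

lemma tensor_fourier:
  fixes g :: "real ^ 'n::finite \<Rightarrow> real \<Rightarrow> real"
  assumes g: "\<forall>b\<in>Basis. bump_like (g b)"
  shows "fourier_L1 (\<lambda>x. complex_of_real (tensor g x)) \<xi>
    = complex_of_real (fourier_const TYPE('n)) * (\<Prod>b\<in>Basis. LINT t|lborel. cis (- (t * (\<xi> \<bullet> b))) * complex_of_real (g b t))"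
proof -
  have i: "integrable lborel (\<lambda>t. cis (- (t * (\<xi> \<bullet> b))) * complex_of_real (g b t))" if "b \<in> Basis" for b
    using bump_like_deriv[of "g b"] bump_like_fourier_deriv(1)[of "g b"] g that by blast
  have "cis (- (x \<bullet> \<xi>)) * complex_of_real (tensor g x)
     = (\<Prod>b\<in>Basis. cis (- ((x \<bullet> b) * (\<xi> \<bullet> b))) * complex_of_real (g b (x \<bullet> b)))" for x
    using cis_inner_prod[of x "- \<xi>"] by (simp add: tensor_def prod.distrib)
  then have "(LINT x|lborel. cis (- (x \<bullet> \<xi>)) * complex_of_real (tensor g x))
    = (\<Prod>b\<in>Basis. LINT t|lborel. cis (- (t * (\<xi> \<bullet> b))) * complex_of_real (g b t))"
    by (simp only:) (rule integral_lborel_prod[OF i])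
  then show ?thesis by (simp add: fourier_L1_def)
qed

lemma tensor_partial_deriv_fourier:
  fixes g :: "real ^ 'n::finite \<Rightarrow> real \<Rightarrow> real"
  assumes g: "\<forall>b\<in>Basis. bump_like (g b)"
  shows "fourier_L1 (\<lambda>x. complex_of_real (partial_deriv i (tensor g) x)) \<xi>
      = \<i> * complex_of_real (\<xi> $ i) * fourier_L1 (\<lambda>x. complex_of_real (tensor g x)) \<xi>"
    and "integrable lborel (\<lambda>x. complex_of_real (partial_deriv i (tensor g) x))"
    and "L2 (\<lambda>x. complex_of_real (partial_deriv i (tensor g) x))"
proof -
  have "\<forall>b\<in>Basis. \<exists>h. bump_like h \<and> (\<forall>t. (g b has_real_derivative h t) (at t))"
    using bump_like_deriv g by blast
  from bchoice[OF this] obtain g' where g': "\<forall>b\<in>Basis. bump_like (g' b) \<and> (\<forall>t. (g b has_real_derivative g' b t) (at t))" by blast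
  then have d: "\<forall>b\<in>Basis. \<forall>t. (g b has_real_derivative g' b t) (at t)" by blast
  let ?i = "axis i (1::real) :: real ^ 'n"
  have i: "?i \<in> Basis" by (simp add: axis_in_Basis_iff)
  have G: "\<forall>b\<in>Basis. bump_like ((g(?i := g' ?i)) b)"
    using g g' by auto
  show "integrable lborel (\<lambda>x. complex_of_real (partial_deriv i (tensor g) x))"
    "L2 (\<lambda>x. complex_of_real (partial_deriv i (tensor g) x))"
    unfolding tensor_partial_deriv[OF d] by (rule tensor_L2[OF G])+
  let ?I = "\<lambda>h b. LINT t|lborel. cis (- (t * (\<xi> \<bullet> b))) * complex_of_real (h b t)"
  have "(\<Prod>b\<in>Basis. ?I (g(?i := g' ?i)) b) = ?I g' ?i * (\<Prod>b\<in>Basis - {?i}. ?I (g(?i := g' ?i)) b)"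
    by (subst prod.remove[OF _ i]) auto
  also have "(\<Prod>b\<in>Basis - {?i}. ?I (g(?i := g' ?i)) b) = (\<Prod>b\<in>Basis - {?i}. ?I g b)"
    by (intro prod.cong) auto
  also have "?I g' ?i = \<i> * complex_of_real (\<xi> \<bullet> ?i) * ?I g ?i"
    using g g' i by (intro bump_like_fourier_deriv) auto
  also have "\<i> * complex_of_real (\<xi> \<bullet> ?i) * ?I g ?i * (\<Prod>b\<in>Basis - {?i}. ?I g b)
     = \<i> * complex_of_real (\<xi> \<bullet> ?i) * (\<Prod>b\<in>Basis. ?I g b)"
    using prod.remove[OF finite_Basis i, of "?I g"] by (simp only: mult.assoc)
  finally have "(\<Prod>b\<in>Basis. ?I (g(?i := g' ?i)) b) = \<i> * complex_of_real (\<xi> \<bullet> ?i) * (\<Prod>b\<in>Basis. ?I g b)" .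
  then show "fourier_L1 (\<lambda>x. complex_of_real (partial_deriv i (tensor g) x)) \<xi>
      = \<i> * complex_of_real (\<xi> $ i) * fourier_L1 (\<lambda>x. complex_of_real (tensor g x)) \<xi>"
    unfolding tensor_partial_deriv[OF d] tensor_fourier[OF G] tensor_fourier[OF g]
    by (simp add: inner_axis mult_ac)
qed

lemma fourier_L1_translation:
  fixes f :: "real ^ 'n::finite \<Rightarrow> complex"
  assumes [measurable]: "f \<in> borel_measurable borel"
  shows "fourier_L1 (\<lambda>x. f (x - y)) \<xi> = cis (- (y \<bullet> \<xi>)) * fourier_L1 f \<xi>"
proof -
  have "(LINT x|lborel. cis (- (x \<bullet> \<xi>)) * f (x - y)) = (LINT x|lborel. cis (- ((x + y) \<bullet> \<xi>)) * f (x + y - y))"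
    by (rule integral_translation[symmetric]) measurable
  also have "\<dots> = (LINT x|lborel. cis (- (y \<bullet> \<xi>)) * (cis (- (x \<bullet> \<xi>)) * f x))"
    by (intro Bochner_Integration.integral_cong refl) (simp add: inner_add_left mult.assoc[symmetric] cis_mult add.commute)
  finally show ?thesis by (simp add: fourier_L1_def)
qed

text \<open>The parameter is the inverse of the radius of the support.\<close>

definition bump :: "real \<Rightarrow> real \<Rightarrow> real" where
  "bump s t = bump_poly [:1:] 0 (s * t)"

text \<open>On the support \<open>\<bar>t\<bar> \<le> 1 / s\<close> the phase \<open>t \<tau>\<close> stays in \<open>[-1, 1]\<close>, where the cosine is at
  least \<open>1/2\<close>, so the real part of the integral is positive. Hence no frequency is invisible to
  narrow test functions.\<close>

lemma bump_fourier_nonzero: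
  assumes s: "s > 0" "\<bar>\<tau>\<bar> \<le> s"
  shows "(LINT t|lborel. cis (- (t * \<tau>)) * complex_of_real (bump s t)) \<noteq> 0"
proof -
  have bl: "bump_like (bump s)"
    unfolding bump_like_def using s
    by (intro exI[of _ 1] exI[of _ s] exI[of _ 0] exI[of _ "[:1:]"] exI[of _ "0::nat"]) (auto simp: bump_def)
  then obtain g' where "bump_like g'" "\<And>t. (bump s has_real_derivative g' t) (at t)"
    using bump_like_deriv by blast
  from bump_like_fourier_deriv(1)[OF bl this]
  have i: "integrable lborel (\<lambda>t. cis (- (t * \<tau>)) * complex_of_real (bump s t))" .
  have le: "exp (-2) / 2 * indicator {0..1 / (2 * s)} t \<le> Re (cis (- (t * \<tau>)) * complex_of_real (bump s t))" for t
  proof (cases "\<bar>s * t\<bar> < 1")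
    case True
    have "\<bar>t * \<tau>\<bar> \<le> \<bar>s * t\<bar>" using s by (simp add: abs_mult mult.commute[of s] mult_left_mono)
    then have "\<bar>t * \<tau>\<bar> \<le> pi / 3" using True pi_gt3 by linarith
    then have "cos (pi / 3) \<le> cos \<bar>t * \<tau>\<bar>" by (intro cos_monotone_0_pi_le) (use pi_gt3 in auto)
    then have c: "1 / 2 \<le> cos (t * \<tau>)" by (simp add: cos_60 abs_if split: if_splits)
    have b0: "0 \<le> bump s t" by (simp add: bump_def bump_poly_def)
    have "exp (-2) / 2 * indicator {0..1 / (2 * s)} t \<le> 1 / 2 * bump s t"
    proof (cases "t \<in> {0..1 / (2 * s)}")
      case t: True
      then have "\<bar>s * t\<bar> \<le> 1 / 2" using s by (simp add: field_simps)
      then have "(s * t)\<^sup>2 \<le> (1/2)\<^sup>2" by (metis abs_le_square_iff abs_of_pos half_gt_zero zero_less_one)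
      then have "1 / 2 \<le> 1 - (s * t)\<^sup>2" by (simp add: power2_eq_square)
      then have "1 / (1 - (s * t)\<^sup>2) \<le> 2" by (simp add: divide_simps)
      then have "exp (-2) \<le> bump s t" using True by (simp add: bump_def bump_poly_def)
      then show ?thesis using t by simp
    qed (use b0 in simp)
    also have "\<dots> \<le> cos (t * \<tau>) * bump s t" by (rule mult_right_mono[OF c b0])
    finally show ?thesis by simp
  next
    case False
    have "t \<notin> {0..1 / (2 * s)}"
    proof
      assume "t \<in> {0..1 / (2 * s)}"
      then have "0 \<le> s * t" "s * t \<le> 1 / 2" using s(1) by (auto simp: field_simps)
      then show False using False by simp
    qed
    then show ?thesis using False by (simp add: bump_def bump_poly_def)
  qed
  have "0 < exp (-2) / 2 * (1 / (2 * s))" using s by simp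
  also have "\<dots> = (LINT t|lborel. exp (-2) / 2 * indicator {0..1 / (2 * s)} t)"
    using s by simp
  also have "\<dots> \<le> (LINT t|lborel. Re (cis (- (t * \<tau>)) * complex_of_real (bump s t)))"
    by (rule integral_mono[OF _ integrable_Re[OF i] le]) (intro integrable_mult_right integrable_real_indicator; simp add: emeasure_lborel_Icc_eq)
  also have "\<dots> = Re (LINT t|lborel. cis (- (t * \<tau>)) * complex_of_real (bump s t))"
    by (rule integral_Re[OF i])
  finally show ?thesis by auto
qed

section \<open>The Fourier transform of a weak gradient\<close>

text \<open>Parseval turns the definition of the weak gradient, tested against all translates of a bump
  \<open>\<phi>\<close>, into the vanishing of the Fourier integral of \<open>(w - \<i> \<xi>\<^sub>i v) cnj \<phi>h\<close>, where \<open>\<phi>h\<close> is the transform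
  of \<open>\<phi>\<close>. That product is integrable and square-integrable, so it vanishes by the isometry. Bumps
  of decreasing width remove the factor \<open>\<phi>h\<close>.\<close>

lemma weak_gradient_fourier:
  fixes f :: "real ^ 'n::finite \<Rightarrow> complex"
  assumes G: "weak_gradient f G" and f: "fourier_transform f v" and w: "fourier_transform (\<lambda>x. G x $ i) w"
  shows "AE \<xi> in lborel. w \<xi> = \<i> * complex_of_real (\<xi> $ i) * v \<xi>"
proof -
  have v2: "L2 v" and w2: "L2 w" and f2: "L2 f" using f w by (auto simp: fourier_transform_def)
  have [measurable]: "v \<in> borel_measurable borel" "w \<in> borel_measurable borel"
    using v2 w2 by (auto dest: L2_measurable)
  define D where "D \<xi> = w \<xi> - \<i> * complex_of_real (\<xi> $ i) * v \<xi>" for \<xi>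
  have Dm [measurable]: "D \<in> borel_measurable borel" unfolding D_def[abs_def] by measurable
  define \<phi> where "\<phi> s = tensor (\<lambda>_::real^'n. bump s)" for s
  have vanish: "AE \<xi> in lborel. D \<xi> * cnj (fourier_L1 (\<lambda>x. complex_of_real (\<phi> s x)) \<xi>) = 0" if s: "s > 0" for s
  proof -
    define \<phi>h where "\<phi>h = fourier_L1 (\<lambda>x. complex_of_real (\<phi> s x))"
    have bs: "bump_like (bump s)"
      unfolding bump_like_def using s
      by (intro exI[of _ 1] exI[of _ s] exI[of _ 0] exI[of _ "[:1:]"] exI[of _ "0::nat"]) (auto simp: bump_def)
    then have bl: "\<forall>b\<in>Basis. bump_like ((\<lambda>_::real^'n. bump s) b)" by blast
    have \<phi>i: "integrable lborel (\<lambda>x. complex_of_real (\<phi> s x))" "L2 (\<lambda>x. complex_of_real (\<phi> s x))"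
      unfolding \<phi>_def by (rule tensor_L2[OF bl])+
    define \<psi> where "\<psi> = partial_deriv i (\<phi> s)"
    have \<psi>i: "integrable lborel (\<lambda>x. complex_of_real (\<psi> x))" "L2 (\<lambda>x. complex_of_real (\<psi> x))"
      unfolding \<psi>_def \<phi>_def by (rule tensor_partial_deriv_fourier[OF bl])+
    have \<psi>h: "fourier_L1 (\<lambda>x. complex_of_real (\<psi> x)) \<xi> = \<i> * complex_of_real (\<xi> $ i) * \<phi>h \<xi>" for \<xi>
      unfolding \<psi>_def \<phi>_def \<phi>h_def by (rule tensor_partial_deriv_fourier[OF bl])
    have \<phi>m [measurable]: "(\<lambda>x. complex_of_real (\<phi> s x)) \<in> borel_measurable borel"
      "(\<lambda>x. complex_of_real (\<psi> x)) \<in> borel_measurable borel"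
      using \<phi>i \<psi>i by (auto dest: L2_measurable)
    have \<phi>h2: "L2 \<phi>h" and \<psi>h2: "L2 (fourier_L1 (\<lambda>x. complex_of_real (\<psi> x)))"
      unfolding \<phi>h_def using Plancherel_L1_L2(1)[OF \<phi>i] Plancherel_L1_L2(1)[OF \<psi>i] by auto
    have \<phi>hm [measurable]: "\<phi>h \<in> borel_measurable borel" using \<phi>h2 by (rule L2_measurable)
    define H where "H \<xi> = D \<xi> * cnj (\<phi>h \<xi>)" for \<xi>
    have H: "H \<xi> = w \<xi> * cnj (\<phi>h \<xi>) + v \<xi> * cnj (fourier_L1 (\<lambda>x. complex_of_real (\<psi> x)) \<xi>)" for \<xi>
      unfolding H_def D_def \<psi>h by (simp add: algebra_simps)
    have H1: "integrable lborel H"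
      unfolding H[abs_def]
      by (intro Bochner_Integration.integrable_add L2_mult_integrable(2) v2 w2 \<phi>h2 \<psi>h2)
    have bdd: "L2 (\<lambda>\<xi>. u \<xi> * cnj (fourier_L1 h \<xi>))"
      if u: "L2 u" and h: "integrable lborel h" for u h :: "real^'n \<Rightarrow> complex"
    proof (rule L2_dominated)
      have [measurable]: "u \<in> borel_measurable borel" "h \<in> borel_measurable borel"
        using u h by (auto dest: L2_measurable)
      show "(\<lambda>\<xi>. u \<xi> * cnj (fourier_L1 h \<xi>)) \<in> borel_measurable borel" by measurable
      show "L2 (\<lambda>\<xi>. complex_of_real (fourier_const TYPE('n) * (LINT x|lborel. norm (h x))) * u \<xi>)"
        by (rule L2_cmult[OF u])
      show "norm (u \<xi> * cnj (fourier_L1 h \<xi>)) \<le> norm (complex_of_real (fourier_const TYPE('n) * (LINT x|lborel. norm (h x))) * u \<xi>)" for \<xi>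
      proof -
        have "norm (fourier_L1 h \<xi>) \<le> \<bar>fourier_const TYPE('n) * (LINT x|lborel. norm (h x))\<bar>"
          using fourier_L1_bound[OF h, of \<xi>] by linarith
        then show ?thesis unfolding norm_mult norm_of_real complex_mod_cnj
          by (subst mult.commute) (intro mult_right_mono, auto)
      qed
    qed
    have H2: "L2 H"
      unfolding H[abs_def] \<phi>h_def by (intro L2_add bdd v2 w2 \<phi>i \<psi>i)
    have "(LINT \<xi>|lborel. cis (y \<bullet> \<xi>) * H \<xi>) = 0" for y
    proof -
      define g where "g = (\<lambda>b::real^'n. \<lambda>t. bump_poly [:1:] 0 (s * (t - y \<bullet> b)))"
      have gl: "\<forall>b\<in>Basis. bump_like (g b)"
        unfolding bump_like_def g_def using s
        by (intro ballI, rule_tac x=1 in exI, rule_tac x=s in exI, rule_tac x="y \<bullet> b" in exI) auto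
      have g\<phi>: "tensor g = (\<lambda>x. \<phi> s (x - y))"
        by (simp add: tensor_def[abs_def] g_def \<phi>_def bump_def inner_diff_left)
      have gi: "integrable lborel (\<lambda>x. complex_of_real (tensor g x))" "L2 (\<lambda>x. complex_of_real (tensor g x))"
        by (rule tensor_L2[OF gl])+
      have pi: "integrable lborel (\<lambda>x. complex_of_real (partial_deriv i (tensor g) x))"
        "L2 (\<lambda>x. complex_of_real (partial_deriv i (tensor g) x))"
        by (rule tensor_partial_deriv_fourier[OF gl])+
      have gh: "fourier_L1 (\<lambda>x. complex_of_real (tensor g x)) \<xi> = cis (- (y \<bullet> \<xi>)) * \<phi>h \<xi>" for \<xi>
        unfolding g\<phi> \<phi>h_def by (rule fourier_L1_translation) measurable
      have ph: "fourier_L1 (\<lambda>x. complex_of_real (partial_deriv i (tensor g) x)) \<xi>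
          = cis (- (y \<bullet> \<xi>)) * fourier_L1 (\<lambda>x. complex_of_real (\<psi> x)) \<xi>" for \<xi>
        unfolding tensor_partial_deriv_fourier(1)[OF gl] gh \<psi>h by simp
      have a: "(LINT x|lborel. partial_deriv i (tensor g) x *\<^sub>R f x) = - (LINT x|lborel. tensor g x *\<^sub>R (G x $ i))"
        using G tensor_test_function[OF gl] by (simp add: weak_gradient_def)
      have b: "(LINT x|lborel. partial_deriv i (tensor g) x *\<^sub>R f x)
          = (LINT x|lborel. f x * cnj (complex_of_real (partial_deriv i (tensor g) x)))"
        by (simp add: scaleR_conv_of_real mult.commute)
      have c: "(LINT x|lborel. tensor g x *\<^sub>R (G x $ i))
          = (LINT x|lborel. G x $ i * cnj (complex_of_real (tensor g x)))"
        by (simp add: scaleR_conv_of_real mult.commute)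
      note d = Parseval[OF f fourier_transform_L1[OF pi]] and e = Parseval[OF w fourier_transform_L1[OF gi]]
      have "(LINT \<xi>|lborel. v \<xi> * cnj (fourier_L1 (\<lambda>x. complex_of_real (partial_deriv i (tensor g) x)) \<xi>))
         + (LINT \<xi>|lborel. w \<xi> * cnj (fourier_L1 (\<lambda>x. complex_of_real (tensor g x)) \<xi>)) = 0"
        by (simp only: d[symmetric] e[symmetric] b[symmetric] c[symmetric] a add.left_inverse)
      also have "(LINT \<xi>|lborel. v \<xi> * cnj (fourier_L1 (\<lambda>x. complex_of_real (partial_deriv i (tensor g) x)) \<xi>))
         + (LINT \<xi>|lborel. w \<xi> * cnj (fourier_L1 (\<lambda>x. complex_of_real (tensor g x)) \<xi>))
        = (LINT \<xi>|lborel. v \<xi> * cnj (fourier_L1 (\<lambda>x. complex_of_real (partial_deriv i (tensor g) x)) \<xi>)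
              + w \<xi> * cnj (fourier_L1 (\<lambda>x. complex_of_real (tensor g x)) \<xi>))"
        by (intro Bochner_Integration.integral_add[symmetric] L2_mult_integrable(2) v2 w2
            Plancherel_L1_L2(1)[OF pi] Plancherel_L1_L2(1)[OF gi])
      also have "\<dots> = (LINT \<xi>|lborel. cis (y \<bullet> \<xi>) * H \<xi>)"
        unfolding ph gh H by (intro Bochner_Integration.integral_cong refl) (simp add: cis_cnj algebra_simps)
      finally show ?thesis .
    qed
    note zero = this
    have "(LINT \<xi>|lborel. cis (- (\<xi> \<bullet> x)) * H \<xi>) = 0" for x
    proof -
      have "(\<lambda>\<xi>. cis (- (\<xi> \<bullet> x)) * H \<xi>) = (\<lambda>\<xi>. cis ((- x) \<bullet> \<xi>) * H \<xi>)"
        by (rule ext) (simp add: inner_commute[of x])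
      then show ?thesis by (simp only: zero)
    qed
    then have "fourier_L1 H = (\<lambda>_. 0)" by (simp add: fourier_L1_def[abs_def])
    then have "L2_norm H = 0" using Plancherel_L1_L2(2)[OF H1 H2] by (simp add: L2_norm_def)
    then show ?thesis using L2_norm_eq_0_iff[OF H2] by (simp add: H_def \<phi>h_def)
  qed
  have "AE \<xi> in lborel. \<forall>j. D \<xi> * cnj (fourier_L1 (\<lambda>x. complex_of_real (\<phi> (real (Suc j)) x)) \<xi>) = 0"
    unfolding AE_all_countable by (intro allI vanish) simp
  then show ?thesis
  proof (rule AE_mp, intro AE_I2 impI)
    fix \<xi> :: "real^'n"
    assume 0: "\<forall>j. D \<xi> * cnj (fourier_L1 (\<lambda>x. complex_of_real (\<phi> (real (Suc j)) x)) \<xi>) = 0"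
    obtain j where j: "norm \<xi> \<le> real (Suc j)"
      by (meson less_imp_le of_nat_le_iff order_trans real_arch_simple lessI)
    have bs: "bump_like (bump (real (Suc j)))"
      unfolding bump_like_def
      by (intro exI[of _ 1] exI[of _ "real (Suc j)"] exI[of _ 0] exI[of _ "[:1:]"] exI[of _ "0::nat"]) (auto simp: bump_def)
    then have bl: "\<forall>b\<in>Basis. bump_like ((\<lambda>_::real^'n. bump (real (Suc j))) b)" by blast
    have "fourier_L1 (\<lambda>x. complex_of_real (\<phi> (real (Suc j)) x)) \<xi> \<noteq> 0"
      unfolding \<phi>_def tensor_fourier[OF bl]
    proof -
      have "(LINT t|lborel. cis (- (t * (\<xi> \<bullet> b))) * complex_of_real (bump (real (Suc j)) t)) \<noteq> 0" if "b \<in> Basis" for b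
        using j Basis_le_norm[OF that, of \<xi>] by (intro bump_fourier_nonzero) auto
      then show "complex_of_real (fourier_const TYPE('n)) *
          (\<Prod>b\<in>Basis. LINT t|lborel. cis (- (t * (\<xi> \<bullet> b))) * complex_of_real (bump (real (Suc j)) t)) \<noteq> 0"
        using fourier_const_pos[where 'n='n] by (simp add: prod_zero_iff)
    qed
    then have "D \<xi> = 0" using 0 by auto
    then show "w \<xi> = \<i> * complex_of_real (\<xi> $ i) * v \<xi>" by (simp add: D_def)
  qed
qed

text \<open>The components of the gradient have transforms \<open>\<i> \<xi>\<^sub>i v\<close>; summing their squared norms gives
  \<open>\<bar>\<xi>\<bar>\<^sup>2 \<bar>v\<bar>\<^sup>2\<close>.\<close>

theorem weak_gradient_norm:
  fixes f :: "real ^ 'n::finite \<Rightarrow> complex"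
  assumes G: "weak_gradient f G" and f: "fourier_transform f v"
  shows "L2 (\<lambda>\<xi>. norm \<xi> *\<^sub>R v \<xi>)" "L2_norm G = L2_norm (\<lambda>\<xi>. norm \<xi> *\<^sub>R v \<xi>)"
proof -
  have G2: "L2 G" using G by (simp add: weak_gradient_def)
  have v2: "L2 v" using f by (simp add: fourier_transform_def)
  have Gm [measurable]: "G \<in> borel_measurable borel" and vm [measurable]: "v \<in> borel_measurable borel"
    using G2 v2 by (auto dest: L2_measurable)
  have Gi: "L2 (\<lambda>x. G x $ i)" for i
  proof (rule L2_dominated[OF _ G2])
    show "(\<lambda>x. G x $ i) \<in> borel_measurable borel"
      by (rule measurable_compose[OF Gm]) (intro borel_measurable_continuous_onI continuous_intros)
  qed (rule Finite_Cartesian_Product.norm_nth_le)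
  have "\<exists>w. fourier_transform (\<lambda>x. G x $ i) w" for i by (rule fourier_transform_exists[OF Gi])
  then obtain w where w: "\<And>i. fourier_transform (\<lambda>x. G x $ i) (w i)" by metis
  have w2: "L2 (w i)" for i using w[of i] by (simp add: fourier_transform_def)
  have wm [measurable]: "w i \<in> borel_measurable borel" for i using L2_measurable[OF w2] .
  have wi: "integrable lborel (\<lambda>\<xi>. (norm (w i \<xi>))\<^sup>2)" for i using w2 by (simp add: L2_def)
  have ae: "AE \<xi> in lborel. (\<Sum>i\<in>UNIV. (norm (w i \<xi>))\<^sup>2) = (norm (norm \<xi> *\<^sub>R v \<xi>))\<^sup>2"
  proof -
    have "AE \<xi> in lborel. \<forall>i. w i \<xi> = \<i> * complex_of_real (\<xi> $ i) * v \<xi>"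
      unfolding AE_all_countable using weak_gradient_fourier[OF G f w] by blast
    then show ?thesis
    proof (rule AE_mp, intro AE_I2 impI)
      fix \<xi> :: "real^'n" assume *: "\<forall>i. w i \<xi> = \<i> * complex_of_real (\<xi> $ i) * v \<xi>"
      have n: "(norm \<xi>)\<^sup>2 = (\<Sum>i\<in>UNIV. (\<xi> $ i)\<^sup>2)"
        by (simp add: norm_vec_def L2_set_def sum_nonneg)
      show "(\<Sum>i\<in>UNIV. (norm (w i \<xi>))\<^sup>2) = (norm (norm \<xi> *\<^sub>R v \<xi>))\<^sup>2"
        by (simp add: * norm_mult power_mult_distrib n sum_distrib_right)
    qed
  qed
  have s: "integrable lborel (\<lambda>\<xi>. \<Sum>i\<in>UNIV. (norm (w i \<xi>))\<^sup>2)"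
    by (intro Bochner_Integration.integrable_sum wi)
  have n: "(\<lambda>\<xi>. (norm (norm \<xi> *\<^sub>R v \<xi>))\<^sup>2) \<in> borel_measurable lborel" by measurable
  have "integrable lborel (\<lambda>\<xi>. (norm (norm \<xi> *\<^sub>R v \<xi>))\<^sup>2)"
    by (rule iffD1[OF integrable_cong_AE[OF borel_measurable_integrable[OF s] n ae] s])
  then show "L2 (\<lambda>\<xi>. norm \<xi> *\<^sub>R v \<xi>)" by (simp add: L2_def)
  have "(L2_norm G)\<^sup>2 = (LINT x|lborel. (\<Sum>i\<in>UNIV. (norm (G x $ i))\<^sup>2))"
    unfolding L2_norm_square by (simp add: norm_vec_def L2_set_def sum_nonneg)
  also have "\<dots> = (\<Sum>i\<in>UNIV. (L2_norm (\<lambda>x. G x $ i))\<^sup>2)"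
    unfolding L2_norm_square using Gi by (intro Bochner_Integration.integral_sum) (auto simp: L2_def)
  also have "\<dots> = (\<Sum>i\<in>UNIV. (L2_norm (w i))\<^sup>2)"
    using Plancherel[OF w] by simp
  also have "\<dots> = (LINT \<xi>|lborel. (\<Sum>i\<in>UNIV. (norm (w i \<xi>))\<^sup>2))"
    unfolding L2_norm_square by (intro Bochner_Integration.integral_sum[symmetric] wi)
  also have "\<dots> = (LINT \<xi>|lborel. (norm (norm \<xi> *\<^sub>R v \<xi>))\<^sup>2)"
    by (rule integral_cong_AE[OF _ _ ae]) measurable
  also have "\<dots> = (L2_norm (\<lambda>\<xi>. norm \<xi> *\<^sub>R v \<xi>))\<^sup>2" by (simp add: L2_norm_square)
  finally show "L2_norm G = L2_norm (\<lambda>\<xi>. norm \<xi> *\<^sub>R v \<xi>)"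
    using L2_norm_nonneg by (metis power2_eq_iff_nonneg)
qed

section \<open>Coefficients and the oscillator equation\<close>

text \<open>The logarithm of \<open>G\<close> has a derivative between \<open>- k\<close> and \<open>k\<close>. Where \<open>G\<close> vanishes the logarithm
  is taken of \<open>G + e\<close>, with \<open>e\<close> tending to zero. The weight \<open>k\<close> need only be integrable; below it
  is a power of \<open>1 / \<Xi>\<close>, about which no continuity is known.\<close>

lemma gronwall_two_sided:
  fixes G G' k :: "real \<Rightarrow> real"
  assumes ab: "a \<le> b"
    and d: "\<And>t. t \<in> {a..b} \<Longrightarrow> (G has_real_derivative G' t) (at t within {a..b})"
    and bound: "\<And>t. t \<in> {a..b} \<Longrightarrow> \<bar>G' t\<bar> \<le> k t * G t"
    and G: "\<And>t. t \<in> {a..b} \<Longrightarrow> 0 \<le> G t" and k0: "\<And>t. t \<in> {a..b} \<Longrightarrow> 0 \<le> k t"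
    and k: "k integrable_on {a..b}" "integral {a..b} k \<le> K"
  shows "G b \<le> exp K * G a" "G a \<le> exp K * G b"
proof -
  have *: "G b + e \<le> exp K * (G a + e) \<and> G a + e \<le> exp K * (G b + e)" if e: "e > 0" for e
  proof -
    have pos: "0 < G t + e" if "t \<in> {a..b}" for t using G[OF that] e by linarith
    define L where "L t = G' t / (G t + e)" for t
    have "((\<lambda>t. ln (G t + e)) has_real_derivative L t) (at t within {a..b})" if t: "t \<in> {a..b}" for t
      using d[OF t] pos[OF t] unfolding L_def by (auto intro!: derivative_eq_intros)
    then have I: "(L has_integral (ln (G b + e) - ln (G a + e))) {a..b}"
      using ab by (intro fundamental_theorem_of_calculus) (auto simp: has_real_derivative_iff_has_vector_derivative)
    have L: "\<bar>L t\<bar> \<le> k t" if t: "t \<in> {a..b}" for t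
    proof -
      have "\<bar>G' t\<bar> \<le> k t * (G t + e)"
        using bound[OF t] mult_left_mono[of "G t" "G t + e" "k t"] k0[OF t] e by linarith
      then show ?thesis using pos[OF t] by (simp add: L_def abs_divide divide_le_eq)
    qed
    have kI: "(k has_integral integral {a..b} k) {a..b}" using k(1) by (rule integrable_integral)
    have 1: "ln (G b + e) - ln (G a + e) \<le> integral {a..b} k"
      by (rule has_integral_le[OF I kI]) (use L abs_le_D1 in blast)
    have 2: "- (ln (G b + e) - ln (G a + e)) \<le> integral {a..b} k"
      by (rule has_integral_le[OF has_integral_neg[OF I] kI]) (use L abs_le_D2 in blast)
    have "G x + e \<le> exp K * (G y + e)"
      if "x \<in> {a..b}" "y \<in> {a..b}" "ln (G x + e) - ln (G y + e) \<le> K" for x y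
    proof -
      have "exp (ln (G x + e)) \<le> exp (K + ln (G y + e))" using that(3) by simp
      then show ?thesis using pos that by (simp add: exp_add)
    qed
    from this[of b a] this[of a b] show ?thesis using 1 2 k(2) ab by auto
  qed
  have lim: "x \<le> exp K * y" if "\<And>e. e > 0 \<Longrightarrow> x + e \<le> exp K * (y + e)" for x y
  proof (rule field_le_epsilon)
    fix e :: real assume e: "e > 0"
    have "x + e / exp K \<le> exp K * (y + e / exp K)" by (rule that) (use e in simp)
    moreover have "0 < e / exp K" using e by simp
    moreover have "exp K * (y + e / exp K) = exp K * y + e" by (simp add: distrib_left)
    ultimately show "x \<le> exp K * y + e" by linarith
  qed
  show "G b \<le> exp K * G a" "G a \<le> exp K * G b" by (rule lim, use * in blast)+
qed

lemma antideriv_half: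
  fixes f :: "real \<Rightarrow> real"
  assumes f: "continuous_on {0..} f" and t: "t \<ge> 0"
  shows "((\<lambda>t. integral {0..t} f) has_real_derivative f t) (at t within {0..})"
proof -
  have "((\<lambda>t. integral {0..t} f) has_real_derivative f t) (at t within {0..t+1})"
    using t by (intro integral_has_real_derivative continuous_on_subset[OF f]) auto
  moreover have "at t within {0..t+1} = at t within {0..}"
    by (rule at_within_nhd[of _ "{..<t+1}"]) (use t in auto)
  ultimately show ?thesis by simp
qed

lemma deriv_half_works:
  assumes "f differentiable (at t within {0..})" "t \<ge> 0"
  shows "(f has_real_derivative deriv_half f t) (at t within {0..})"
  using assms by (simp add: deriv_half_def has_real_derivative_iff_has_vector_derivative vector_derivative_works)

lemma deriv_half_continuous:
  fixes f :: "real \<Rightarrow> real"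
  assumes "\<And>t. t \<ge> 0 \<Longrightarrow> f differentiable (at t within {0..})"
  shows "continuous_on {0..} f"
  unfolding continuous_on_eq_continuous_within using assms differentiable_imp_continuous_within by auto

lemma has_integral_of_derivative_half:
  fixes f :: "real \<Rightarrow> real"
  assumes "\<And>t. t \<ge> 0 \<Longrightarrow> (f has_real_derivative f' t) (at t within {0..})" "0 \<le> a" "a \<le> b"
  shows "(f' has_integral (f b - f a)) {a..b}"
proof (rule fundamental_theorem_of_calculus[OF assms(3)])
  fix t assume t: "t \<in> {a..b}"
  have "(f has_real_derivative f' t) (at t within {a..b})"
    by (rule has_field_derivative_subset[OF assms(1)]) (use t assms in auto)
  then show "(f has_vector_derivative f' t) (at t within {a..b})"
    by (simp add: has_real_derivative_iff_has_vector_derivative)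
qed

text \<open>The Fourier transform of a solution satisfies \<open>v'' + 2 b v' + r\<^sup>2 v = 0\<close> at each frequency of
  modulus \<open>r\<close>.\<close>

definition oscillator :: "(real \<Rightarrow> real) \<Rightarrow> real \<Rightarrow> (real \<Rightarrow> complex) \<Rightarrow> (real \<Rightarrow> complex) \<Rightarrow> bool" where
  "oscillator b r v v' \<longleftrightarrow> (\<forall>t\<ge>0. (v has_vector_derivative v' t) (at t within {0..}) \<and>
     (v' has_vector_derivative - ((r\<^sup>2) *\<^sub>R v t) - (2 * b t) *\<^sub>R v' t) (at t within {0..}))"

lemma inner_has_real_derivative:
  fixes f g :: "real \<Rightarrow> 'a::real_inner"
  assumes "(f has_vector_derivative f') (at t within S)" "(g has_vector_derivative g') (at t within S)"
  shows "((\<lambda>t. f t \<bullet> g t) has_real_derivative (f t \<bullet> g' + f' \<bullet> g t)) (at t within S)"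
  using bounded_bilinear.has_vector_derivative[OF bounded_bilinear_inner assms]
  by (simp add: has_real_derivative_iff_has_vector_derivative)

locale damping =
  fixes m :: nat and b \<mu> \<sigma> \<Theta> \<Xi> :: "real \<Rightarrow> real" and \<omega> :: real
  assumes m: "m \<ge> 1"
    and b_smooth: "C_half m b"
    and decomposition: "\<And>t. t \<ge> 0 \<Longrightarrow> 2 * b t = \<mu> t + \<sigma> t"
    and \<omega>_pos: "\<omega> > 0"
    and \<Theta>_pos: "\<And>t. t \<ge> 0 \<Longrightarrow> \<Theta> t > 0"
    and \<Xi>_pos: "\<And>t. t \<ge> 0 \<Longrightarrow> \<Xi> t > 0"
    and \<mu>_pos: "\<And>t. t \<ge> 0 \<Longrightarrow> \<mu> t > 0"
    and \<mu>_differentiable: "\<And>t. t \<ge> 0 \<Longrightarrow> \<mu> differentiable (at t within {0..})"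
    and \<mu>_decreasing: "\<And>t. t \<ge> 0 \<Longrightarrow> deriv_half \<mu> t < 0"
    and \<mu>_limsup: "Limsup at_top (\<lambda>t. ereal (t * \<mu> t)) < 1"
    and \<sigma>_bounded: "bdd_above ((\<lambda>t. \<bar>integral {0..t} \<sigma>\<bar>) ` {0..})"
    and stabilisation:
      "lesssim_half (\<lambda>t. integral {0..t} (\<lambda>\<theta>. \<bar>exp (integral {0..\<theta>} \<sigma>) - \<omega>\<bar>)) \<Theta>"
    and \<Theta>_sublinear: "\<Theta> \<in> o[at_top](\<lambda>t. t)"
    and b_derivs: "\<exists>C. \<forall>k\<in>{1..m}. \<forall>t\<ge>0. \<bar>(deriv_half ^^ k) b t\<bar> \<le> C k * (1 / \<Xi> t ^ (k + 1))"
    and \<Xi>_ge: "lesssim_half \<Theta> \<Xi>"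
    and \<Xi>_integrable: "(\<lambda>s. 1 / \<Xi> s ^ (m + 1)) integrable_on {0..}"
    and \<Xi>_tail:
      "lesssim_half (\<lambda>t. integral {t..} (\<lambda>s. 1 / \<Xi> s ^ (m + 1))) (\<lambda>t. 1 / \<Theta> t ^ m)"
begin

lemma b_continuous: "continuous_on {0..} b"
  using b_smooth unfolding C_half_def by (auto dest!: spec[of _ "0::nat"])

lemma \<mu>_continuous: "continuous_on {0..} \<mu>"
  by (rule deriv_half_continuous[OF \<mu>_differentiable])

lemma \<sigma>_continuous: "continuous_on {0..} \<sigma>"
proof -
  have "continuous_on {0..} (\<lambda>t. 2 * b t - \<mu> t)"
    by (intro continuous_intros b_continuous \<mu>_continuous)
  then show ?thesis
    by (rule continuous_on_eq) (use decomposition in \<open>force\<close>)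
qed

lemma \<mu>_deriv: "t \<ge> 0 \<Longrightarrow> (\<mu> has_real_derivative deriv_half \<mu> t) (at t within {0..})"
  by (rule deriv_half_works[OF \<mu>_differentiable])

lemma \<mu>_antimono: "0 \<le> s \<Longrightarrow> s \<le> t \<Longrightarrow> \<mu> t \<le> \<mu> s"
proof -
  assume st: "0 \<le> s" "s \<le> t"
  have "((\<lambda>t. - deriv_half \<mu> t) has_integral (- (\<mu> t - \<mu> s))) {s..t}"
    by (intro has_integral_neg has_integral_of_derivative_half[OF \<mu>_deriv] st)
  then have "0 \<le> - (\<mu> t - \<mu> s)"
  proof (rule has_integral_nonneg)
    fix x assume "x \<in> {s..t}"
    then show "0 \<le> - deriv_half \<mu> x" using \<mu>_decreasing[of x] st by simp
  qed
  then show "\<mu> t \<le> \<mu> s" by simp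
qed

text \<open>The square of the weight \<open>\<lambda>\<close>. All energies are quadratic, so only the square occurs in the
  estimates.\<close>

definition lam2 :: "real \<Rightarrow> real" where "lam2 t = exp (integral {0..t} \<mu>)"

definition eta :: "real \<Rightarrow> real" where "eta t = exp (integral {0..t} \<sigma>)"

lemma weight_square: "(weight \<mu> t)\<^sup>2 = lam2 t"
  by (simp add: weight_def lam2_def power2_eq_square flip: exp_add)

lemma lam2_pos: "0 < lam2 t" and eta_pos: "0 < eta t"
  by (simp_all add: lam2_def eta_def)

lemma lam2_deriv: "t \<ge> 0 \<Longrightarrow> (lam2 has_real_derivative lam2 t * \<mu> t) (at t within {0..})"
  unfolding lam2_def[abs_def]
  using antideriv_half[OF \<mu>_continuous, of t] by (auto intro!: derivative_eq_intros)

lemma eta_deriv: "t \<ge> 0 \<Longrightarrow> (eta has_real_derivative eta t * \<sigma> t) (at t within {0..})"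
  unfolding eta_def[abs_def]
  using antideriv_half[OF \<sigma>_continuous, of t] by (auto intro!: derivative_eq_intros)

lemma deriv_continuous_half:
  fixes f :: "real \<Rightarrow> real"
  assumes "\<And>t. t \<ge> 0 \<Longrightarrow> (f has_real_derivative f' t) (at t within {0..})"
  shows "continuous_on {0..} f"
  unfolding continuous_on_eq_continuous_within using assms DERIV_continuous by force

lemma lam2_continuous: "continuous_on {0..} lam2"
  by (rule deriv_continuous_half[OF lam2_deriv])

lemma eta_continuous: "continuous_on {0..} eta"
  by (rule deriv_continuous_half[OF eta_deriv])

lemma lam2_mono: "0 \<le> s \<Longrightarrow> s \<le> t \<Longrightarrow> lam2 s \<le> lam2 t"
proof -
  assume st: "0 \<le> s" "s \<le> t"
  have "((\<lambda>t. lam2 t * \<mu> t) has_integral (lam2 t - lam2 s)) {s..t}"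
    by (intro has_integral_of_derivative_half[OF lam2_deriv] st)
  then have "0 \<le> lam2 t - lam2 s"
    by (rule has_integral_nonneg) (use \<mu>_pos lam2_pos st in \<open>auto intro!: mult_nonneg_nonneg less_imp_le\<close>)
  then show "lam2 s \<le> lam2 t" by simp
qed

lemma lam2_0: "lam2 0 = 1" and eta_0: "eta 0 = 1"
  by (simp_all add: lam2_def eta_def)

lemma lam2_ge_1: "0 \<le> t \<Longrightarrow> 1 \<le> lam2 t"
  using lam2_mono[of 0 t] by (simp add: lam2_0)

lemma eta_bounds: "\<exists>S\<ge>1. \<forall>t\<ge>0. eta t \<le> S \<and> 1 / S \<le> eta t"
proof -
  obtain K where K: "\<And>t. t \<ge> 0 \<Longrightarrow> \<bar>integral {0..t} \<sigma>\<bar> \<le> K"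
    using \<sigma>_bounded unfolding bdd_above_def by auto
  have "K \<ge> 0" using K[of 0] by simp
  moreover have "eta t \<le> exp K \<and> 1 / exp K \<le> eta t" if "t \<ge> 0" for t
  proof -
    have "integral {0..t} \<sigma> \<le> K" "- K \<le> integral {0..t} \<sigma>" using K[OF that] by linarith+
    then show ?thesis unfolding eta_def by (simp flip: exp_minus add: divide_inverse)
  qed
  ultimately show ?thesis by (intro exI[of _ "exp K"]) auto
qed

text \<open>The strict inequality for the upper limit leaves room for a constant \<open>\<kappa> < 1\<close>.\<close>

lemma \<mu>_eventually: "\<exists>\<kappa>. 0 < \<kappa> \<and> \<kappa> < 1 \<and> (\<exists>T\<ge>1. \<forall>t\<ge>T. t * \<mu> t \<le> \<kappa>)"
proof -
  obtain c where c: "Limsup at_top (\<lambda>t. ereal (t * \<mu> t)) < ereal c" "ereal c < 1"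
    using ereal_dense2[OF \<mu>_limsup] by auto
  have "\<forall>\<^sub>F t in at_top. ereal (t * \<mu> t) < ereal c"
    using c(1) by (rule Limsup_lessD)
  then obtain T where T: "\<And>t. t \<ge> T \<Longrightarrow> t * \<mu> t < c"
    by (auto simp: eventually_at_top_linorder)
  have "0 < max 1 T * \<mu> (max 1 T)" using \<mu>_pos[of "max 1 T"] by simp
  then have "0 < c" using T[of "max 1 T"] by simp
  then show ?thesis using c(2) T by (intro exI[of _ c] conjI exI[of _ "max 1 T"]) (auto intro: less_imp_le)
qed

lemma \<mu>_decay: "\<exists>M>0. \<forall>t\<ge>0. (1 + t) * \<mu> t \<le> M"
proof -
  obtain \<kappa> T where \<kappa>: "0 < \<kappa>" "\<kappa> < 1" "T \<ge> 1" "\<And>t. t \<ge> T \<Longrightarrow> t * \<mu> t \<le> \<kappa>"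
    using \<mu>_eventually by auto
  have "(1 + t) * \<mu> t \<le> max 2 ((1 + T) * \<mu> 0)" if t: "t \<ge> 0" for t
  proof (cases "t \<ge> T")
    case True
    then have "1 * \<mu> t \<le> t * \<mu> t" using \<kappa> \<mu>_pos[OF t] by (intro mult_right_mono) auto
    then have "(1 + t) * \<mu> t \<le> 2 * (t * \<mu> t)" by (simp add: algebra_simps)
    then show ?thesis using \<kappa>(4)[OF True] \<kappa>(2) by linarith
  next
    case False
    have "(1 + t) * \<mu> t \<le> (1 + T) * \<mu> 0"
      using False t \<kappa> \<mu>_antimono[of 0 t] \<mu>_pos[OF t] by (intro mult_mono) auto
    then show ?thesis by simp
  qed
  then show ?thesis by (intro exI[of _ "max 2 ((1 + T) * \<mu> 0)"]) auto
qed

definition J :: "real \<Rightarrow> real" where "J t = integral {0..t} (\<lambda>s. 1 / lam2 s)"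

lemma J_deriv: "t \<ge> 0 \<Longrightarrow> (J has_real_derivative 1 / lam2 t) (at t within {0..})"
  unfolding J_def[abs_def]
  by (rule antideriv_half) (auto intro!: continuous_intros lam2_continuous simp: less_imp_neq[OF lam2_pos, symmetric])

text \<open>Since \<open>t \<mu>(t) \<le> \<kappa> < 1\<close> for large \<open>t\<close>, the function \<open>t / \<lambda>\<^sup>2\<close> eventually has a derivative
  of at least \<open>(1 - \<kappa>) / \<lambda>\<^sup>2\<close>. So it increases, and it dominates the integral of \<open>1 / \<lambda>\<^sup>2\<close>.\<close>

lemma J_bound: "\<exists>C\<ge>1. \<forall>t\<ge>0. J t \<le> C * (1 + t) / lam2 t \<and> lam2 t \<le> C * (1 + t)"
proof -
  obtain \<kappa> T where \<kappa>: "0 < \<kappa>" "\<kappa> < 1" "T \<ge> 1" "\<And>t. t \<ge> T \<Longrightarrow> t * \<mu> t \<le> \<kappa>"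
    using \<mu>_eventually by auto
  have J_mono: "J t - J s \<le> t - s" if "0 \<le> s" "s \<le> t" for s t
  proof -
    have 1: "((\<lambda>s. 1 / lam2 s) has_integral (J t - J s)) {s..t}"
      by (intro has_integral_of_derivative_half[OF J_deriv] that)
    have 2: "((\<lambda>s. 1) has_integral (t - s)) {s..t}" using has_integral_const_real[of "1::real" s t] that by simp
    show ?thesis
      by (rule has_integral_le[OF 1 2]) (use that lam2_ge_1 in \<open>auto simp: divide_le_eq intro: order_trans\<close>)
  qed
  define D where "D t = t / lam2 t - (1 - \<kappa>) * J t" for t
  have D: "(D has_real_derivative (1 - t * \<mu> t - (1 - \<kappa>)) / lam2 t) (at t within {0..})" if t: "t \<ge> 0" for t
    unfolding D_def[abs_def]
    using lam2_deriv[OF t] J_deriv[OF t] lam2_pos[of t]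
    by (auto intro!: derivative_eq_intros simp: field_simps)
  have D_mono: "D T \<le> D t" if t: "t \<ge> T" for t
  proof -
    have "((\<lambda>t. (1 - t * \<mu> t - (1 - \<kappa>)) / lam2 t) has_integral (D t - D T)) {T..t}"
      by (rule has_integral_of_derivative_half[OF D]) (use t \<kappa> in auto)
    then have "0 \<le> D t - D T"
      by (rule has_integral_nonneg) (use \<kappa>(4) less_imp_le[OF lam2_pos] in \<open>auto intro!: divide_nonneg_nonneg\<close>)
    then show ?thesis by simp
  qed
  define R where "R t = t / lam2 t" for t
  have R_mono: "R T \<le> R t" if t: "t \<ge> T" for t
  proof -
    have "((\<lambda>t. (1 - t * \<mu> t) / lam2 t) has_integral (R t - R T)) {T..t}"
    proof (rule has_integral_of_derivative_half)
      fix s :: real assume s: "s \<ge> 0"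
      show "(R has_real_derivative (1 - s * \<mu> s) / lam2 s) (at s within {0..})"
        unfolding R_def[abs_def] using lam2_deriv[OF s] lam2_pos[of s]
        by (auto intro!: derivative_eq_intros simp: field_simps)
    qed (use t \<kappa> in auto)
    then have "0 \<le> R t - R T"
      by (rule has_integral_nonneg) (use \<kappa>(2,4) less_imp_le[OF lam2_pos] in \<open>force intro!: divide_nonneg_nonneg\<close>)
    then show ?thesis by simp
  qed
  define C where "C = lam2 T + 1 / (1 - \<kappa>)"
  have lT: "1 \<le> lam2 T" using \<kappa> lam2_ge_1 by simp
  have C1: "lam2 T \<le> C" "1 \<le> C" using \<kappa> lT by (auto simp: C_def add_increasing2)
  have JT: "J T \<le> T" using J_mono[of 0 T] \<kappa> by (simp add: J_def)
  have "J t \<le> C * (1 + t) / lam2 t \<and> lam2 t \<le> C * (1 + t)" if t: "t \<ge> 0" for t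
  proof (cases "t \<ge> T")
    case True
    have RT: "T / lam2 T \<le> t / lam2 t" using R_mono[OF True] by (simp add: R_def)
    have "(1 - \<kappa>) * (J t - J T) \<le> t / lam2 t - T / lam2 T"
      using D_mono[OF True] by (simp add: D_def algebra_simps)
    also have "\<dots> \<le> t / lam2 t" using \<kappa> lT by simp
    finally have "J t - J T \<le> (t / lam2 t) / (1 - \<kappa>)"
      using \<kappa> by (simp only: pos_le_divide_eq diff_gt_0_iff_gt mult.commute)
    then have "J t - J T \<le> 1 / (1 - \<kappa>) * (t / lam2 t)" by (simp add: mult.commute)
    moreover have "J T \<le> lam2 T * (t / lam2 t)"
      using JT mult_left_mono[OF RT, of "lam2 T"] lT by simp
    ultimately have "J t \<le> C * (t / lam2 t)" by (simp add: C_def algebra_simps)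
    also have "\<dots> \<le> C * ((1 + t) / lam2 t)"
      using C1 lam2_pos[of t] by (intro mult_left_mono divide_right_mono) auto
    finally have 1: "J t \<le> C * (1 + t) / lam2 t" by simp
    have "1 / lam2 T \<le> t / lam2 t" using RT \<kappa>(3) lT by (smt (verit) divide_right_mono)
    then have "lam2 t \<le> lam2 T * t" using lT lam2_pos[of t] by (simp add: field_simps)
    also have "\<dots> \<le> C * (1 + t)" using C1 t by (intro mult_mono) auto
    finally show ?thesis using 1 by blast
  next
    case False
    have "lam2 t \<le> lam2 T" using False t by (intro lam2_mono) auto
    then have le: "lam2 t \<le> C" using C1 by simp
    have "1 * (1 + t) \<le> C / lam2 t * (1 + t)"
      using le t lam2_pos[of t] by (intro mult_right_mono) (auto simp: field_simps)
    moreover have "J t \<le> t" using J_mono[of 0 t] t by (simp add: J_def)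
    ultimately have "J t \<le> C * (1 + t) / lam2 t" by simp
    moreover have "lam2 t \<le> C * (1 + t)"
      using le mult_left_mono[of 1 "1 + t" C] C1 t by linarith
    ultimately show ?thesis by blast
  qed
  then show ?thesis using C1 by blast
qed

end

section \<open>The zone of stabilisation\<close>

text \<open>With \<open>X = \<bar>v\<bar>\<close>, \<open>Y = \<bar>w\<bar>\<close> and \<open>d\<close> the inner product of \<open>v\<close> and \<open>w\<close>, the left-hand side is what
  remains of the derivative of the quadratic form below after its exact decay at rate \<open>\<mu>\<close>. Each term
  contains one of the three integrable factors \<open>r \<bar>\<eta> - \<omega>\<bar>\<close>, \<open>\<bar>\<mu>'\<bar> / r\<close> and \<open>\<mu>\<^sup>2 / r\<close>.\<close>

lemma stabilised_zone_algebra: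
  fixes r X Y d A S M \<mu> \<mu>' \<eta> \<omega> :: real
  assumes r: "r > 0" and XY: "0 \<le> X" "0 \<le> Y" "\<bar>d\<bar> \<le> X * Y"
    and \<eta>: "0 < \<eta>" "\<eta> \<le> S" "1 / \<eta> \<le> S" and \<omega>: "\<omega> > 0" and \<mu>: "0 \<le> \<mu>" "\<mu> \<le> M * r"
  shows "\<bar>\<mu> * Y\<^sup>2 * (\<omega> - \<eta>) / \<eta> + 2 * r\<^sup>2 * (\<omega> - \<eta>) * (\<omega> + \<eta>) / \<eta> * d + \<mu> * \<omega> * r\<^sup>2 * (\<omega> - \<eta>) * X\<^sup>2
      + \<mu>' * \<omega> * d + 2 * \<mu> * \<mu>' * \<omega>\<^sup>2 * X\<^sup>2 + 2 * \<mu>\<^sup>2 * \<omega>\<^sup>2 * d / \<eta> + \<mu> ^ 3 * \<omega>\<^sup>2 * X\<^sup>2\<bar>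
    \<le> (S * M + (\<omega> + S) * S + M * \<omega> + \<omega> + 2 * M * \<omega>\<^sup>2 + \<omega>\<^sup>2 * S + M * \<omega>\<^sup>2)
       * (r * \<bar>\<eta> - \<omega>\<bar> + \<bar>\<mu>'\<bar> / r + \<mu>\<^sup>2 / r) * (Y\<^sup>2 + r\<^sup>2 * X\<^sup>2)" (is "\<bar>?L\<bar> \<le> ?C * ?k * ?e")
proof -
  define A where "A = \<bar>\<eta> - \<omega>\<bar>"
  have A: "\<bar>\<omega> - \<eta>\<bar> = A" "0 \<le> A" by (simp_all add: A_def abs_minus_commute)
  have S: "0 < S" using \<eta> by linarith
  have M: "0 \<le> M" using \<mu> r by (meson mult_neg_pos not_le order_trans)
  define e where "e = Y\<^sup>2 + r\<^sup>2 * X\<^sup>2"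
  have e0: "0 \<le> e" by (simp add: e_def)
  have Ye: "Y\<^sup>2 \<le> e" and Xe: "r\<^sup>2 * X\<^sup>2 \<le> e" by (simp_all add: e_def)
  have de: "2 * (r * \<bar>d\<bar>) \<le> e"
  proof -
    have "2 * (r * \<bar>d\<bar>) \<le> 2 * (r * (X * Y))" using XY r by (intro mult_left_mono) auto
    also have "\<dots> \<le> e" using sum_squares_ge_zero[of "Y - r * X" 0]
      by (simp add: e_def power2_eq_square algebra_simps)
    finally show ?thesis .
  qed
  have T1: "\<bar>\<mu> * Y\<^sup>2 * (\<omega> - \<eta>) / \<eta>\<bar> \<le> S * M * (r * A) * e"
  proof -
    have "\<bar>\<mu> * Y\<^sup>2 * (\<omega> - \<eta>) / \<eta>\<bar> = ((\<mu> * A) * (1 / \<eta>)) * Y\<^sup>2"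
      using \<mu> \<eta> by (simp add: abs_mult A)
    also have "\<dots> \<le> ((M * r * A) * S) * e"
      using \<mu> \<eta> A r M S Ye by (intro mult_mono) auto
    finally show ?thesis by (simp add: mult_ac)
  qed
  have T2: "\<bar>2 * r\<^sup>2 * (\<omega> - \<eta>) * (\<omega> + \<eta>) / \<eta> * d\<bar> \<le> (\<omega> + S) * S * (r * A) * e"
  proof -
    have "\<bar>2 * r\<^sup>2 * (\<omega> - \<eta>) * (\<omega> + \<eta>) / \<eta> * d\<bar> = ((r * A) * ((\<omega> + \<eta>) * (1 / \<eta>))) * (2 * (r * \<bar>d\<bar>))"
      using r \<omega> \<eta> by (simp add: abs_mult A power2_eq_square)
    also have "\<dots> \<le> ((r * A) * ((\<omega> + S) * S)) * e"
      using r \<omega> \<eta> A S de by (intro mult_mono) auto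
    finally show ?thesis by (simp add: mult_ac)
  qed
  have T3: "\<bar>\<mu> * \<omega> * r\<^sup>2 * (\<omega> - \<eta>) * X\<^sup>2\<bar> \<le> M * \<omega> * (r * A) * e"
  proof -
    have "\<bar>\<mu> * \<omega> * r\<^sup>2 * (\<omega> - \<eta>) * X\<^sup>2\<bar> = ((\<mu> * \<omega>) * A) * (r\<^sup>2 * X\<^sup>2)"
      using \<mu> \<omega> by (simp add: abs_mult A mult_ac)
    also have "\<dots> \<le> ((M * r * \<omega>) * A) * e"
      using \<mu> \<omega> A r M Xe by (intro mult_mono) auto
    finally show ?thesis by (simp add: mult_ac)
  qed
  have T4: "\<bar>\<mu>' * \<omega> * d\<bar> \<le> \<omega> * (\<bar>\<mu>'\<bar> / r) * e"
  proof -
    have "\<bar>\<mu>' * \<omega> * d\<bar> = (\<omega> * (\<bar>\<mu>'\<bar> / r)) * (r * \<bar>d\<bar>)"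
      using r \<omega> by (simp add: abs_mult)
    also have "\<dots> \<le> (\<omega> * (\<bar>\<mu>'\<bar> / r)) * e"
    proof (rule mult_left_mono)
      have "0 \<le> r * \<bar>d\<bar>" using r by simp
      then show "r * \<bar>d\<bar> \<le> e" using de by linarith
    qed (use r \<omega> in simp)
    finally show ?thesis .
  qed
  have X2: "X\<^sup>2 \<le> e / r / r" using Xe r by (simp add: field_simps power2_eq_square)
  have T5: "\<bar>2 * \<mu> * \<mu>' * \<omega>\<^sup>2 * X\<^sup>2\<bar> \<le> 2 * M * \<omega>\<^sup>2 * (\<bar>\<mu>'\<bar> / r) * e"
  proof -
    have "\<bar>2 * \<mu> * \<mu>' * \<omega>\<^sup>2 * X\<^sup>2\<bar> = (2 * \<mu> * \<bar>\<mu>'\<bar> * \<omega>\<^sup>2) * X\<^sup>2"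
      using \<mu> by (simp add: abs_mult)
    also have "\<dots> \<le> (2 * (M * r) * \<bar>\<mu>'\<bar> * \<omega>\<^sup>2) * (e / r / r)"
      using \<mu> r M X2 by (intro mult_mono) auto
    also have "\<dots> = 2 * M * \<omega>\<^sup>2 * (\<bar>\<mu>'\<bar> / r) * e" using r by (simp add: field_simps)
    finally show ?thesis .
  qed
  have T6: "\<bar>2 * \<mu>\<^sup>2 * \<omega>\<^sup>2 * d / \<eta>\<bar> \<le> \<omega>\<^sup>2 * S * (\<mu>\<^sup>2 / r) * e"
  proof -
    have "\<bar>2 * \<mu>\<^sup>2 * \<omega>\<^sup>2 * d / \<eta>\<bar> = ((\<mu>\<^sup>2 / r) * \<omega>\<^sup>2 * (1 / \<eta>)) * (2 * (r * \<bar>d\<bar>))"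
      using r \<eta> by (simp add: abs_mult)
    also have "\<dots> \<le> ((\<mu>\<^sup>2 / r) * \<omega>\<^sup>2 * S) * e"
      using r \<eta> S de by (intro mult_mono) auto
    finally show ?thesis by (simp add: mult_ac)
  qed
  have T7: "\<bar>\<mu> ^ 3 * \<omega>\<^sup>2 * X\<^sup>2\<bar> \<le> M * \<omega>\<^sup>2 * (\<mu>\<^sup>2 / r) * e"
  proof -
    have "\<bar>\<mu> ^ 3 * \<omega>\<^sup>2 * X\<^sup>2\<bar> = (\<mu> * \<mu>\<^sup>2 * \<omega>\<^sup>2) * X\<^sup>2"
      using \<mu> by (simp add: abs_mult power3_eq_cube power2_eq_square)
    also have "\<dots> \<le> (M * r * \<mu>\<^sup>2 * \<omega>\<^sup>2) * (e / r / r)"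
      using \<mu> r M X2 by (intro mult_mono) auto
    also have "\<dots> = M * \<omega>\<^sup>2 * (\<mu>\<^sup>2 / r) * e" using r by (simp add: field_simps)
    finally show ?thesis .
  qed
  define a1 a2 a3 where "a1 = r * A * e" and "a2 = (\<bar>\<mu>'\<bar> / r) * e" and "a3 = (\<mu>\<^sup>2 / r) * e"
  have a: "0 \<le> a1" "0 \<le> a2" "0 \<le> a3"
    using r A e0 by (auto simp: a1_def a2_def a3_def)
  define c1 c2 c3 where "c1 = S * M + (\<omega> + S) * S + M * \<omega>"
    and "c2 = \<omega> + 2 * M * \<omega>\<^sup>2" and "c3 = \<omega>\<^sup>2 * S + M * \<omega>\<^sup>2"
  have c: "0 \<le> c1" "0 \<le> c2" "0 \<le> c3" using S M \<omega> by (auto simp: c1_def c2_def c3_def)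
  have "\<bar>?L\<bar> \<le> c1 * a1 + c2 * a2 + c3 * a3"
  proof -
    have "\<bar>?L\<bar> \<le> S * M * (r * A) * e + (\<omega> + S) * S * (r * A) * e + M * \<omega> * (r * A) * e
      + \<omega> * (\<bar>\<mu>'\<bar> / r) * e + 2 * M * \<omega>\<^sup>2 * (\<bar>\<mu>'\<bar> / r) * e + \<omega>\<^sup>2 * S * (\<mu>\<^sup>2 / r) * e + M * \<omega>\<^sup>2 * (\<mu>\<^sup>2 / r) * e"
    proof -
      have add: "\<bar>x + y\<bar> \<le> p + q" if "\<bar>x\<bar> \<le> p" "\<bar>y\<bar> \<le> q" for x y p q :: real
        using that by linarith
      show ?thesis by (intro add T1 T2 T3 T4 T5 T6 T7)
    qed
    also have "\<dots> = c1 * a1 + c2 * a2 + c3 * a3"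
      unfolding c1_def c2_def c3_def a1_def a2_def a3_def by (simp only: distrib_right mult.assoc)
    finally show ?thesis .
  qed
  also have "\<dots> \<le> (c1 + c2 + c3) * a1 + (c1 + c2 + c3) * a2 + (c1 + c2 + c3) * a3"
    using a c by (intro add_mono mult_right_mono) auto
  also have "\<dots> = (c1 + c2 + c3) * (a1 + a2 + a3)" by (simp only: distrib_left)
  also have "\<dots> = (c1 + c2 + c3) * (r * A + \<bar>\<mu>'\<bar> / r + \<mu>\<^sup>2 / r) * e"
    unfolding a1_def a2_def a3_def by (simp only: distrib_right[of _ _ e] mult.assoc)
  finally show ?thesis by (simp add: c1_def c2_def c3_def A_def e_def add.assoc)
qed

context damping
begin

definition energy :: "real \<Rightarrow> (real \<Rightarrow> complex) \<Rightarrow> (real \<Rightarrow> complex) \<Rightarrow> real \<Rightarrow> real" where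
  "energy r v v' t = lam2 t * (r\<^sup>2 * (norm (v t))\<^sup>2 + (norm (v' t))\<^sup>2)"

lemma energy_nonneg: "0 \<le> energy r v v' t"
  using lam2_pos[of t] by (simp add: energy_def)

lemma energy_deriv:
  assumes v: "oscillator b r v v'" and t: "t \<ge> 0"
  shows "(energy r v v' has_real_derivative \<mu> t * energy r v v' t - 4 * b t * (lam2 t * (norm (v' t))\<^sup>2)) (at t within {0..})"
proof -
  have 1: "(v has_vector_derivative v' t) (at t within {0..})"
    and 2: "(v' has_vector_derivative - ((r\<^sup>2) *\<^sub>R v t) - (2 * b t) *\<^sub>R v' t) (at t within {0..})"
    using v t by (auto simp: oscillator_def)
  have e: "energy r v v' = (\<lambda>t. lam2 t * (r\<^sup>2 * (v t \<bullet> v t) + v' t \<bullet> v' t))"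
    by (simp add: energy_def[abs_def] power2_norm_eq_inner)
  show ?thesis
    unfolding e using lam2_deriv[OF t] inner_has_real_derivative[OF 1 1] inner_has_real_derivative[OF 2 2]
    by (auto intro!: derivative_eq_intros simp: power2_norm_eq_inner inner_diff inner_add inner_commute algebra_simps)
qed

text \<open>The derivative of \<open>r\<^sup>2 \<bar>v\<bar>\<^sup>2 + \<bar>v'\<bar>\<^sup>2\<close> is \<open>- 4 b \<bar>v'\<bar>\<^sup>2\<close>, which does not involve \<open>r\<close>.\<close>

lemma energy_compact:
  assumes T: "T \<ge> 0"
  shows "\<exists>C\<ge>1. \<forall>r v v' s t. oscillator b r v v' \<longrightarrow> 0 \<le> s \<longrightarrow> s \<le> t \<longrightarrow> t \<le> T \<longrightarrow>
    energy r v v' t \<le> C * energy r v v' s \<and> energy r v v' s \<le> C * energy r v v' t"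
proof -
  define k where "k t = \<mu> t + 4 * \<bar>b t\<bar>" for t
  have kc: "continuous_on {0..} k" unfolding k_def[abs_def]
    by (intro continuous_intros \<mu>_continuous b_continuous)
  have k0: "0 \<le> k t" if "t \<ge> 0" for t using \<mu>_pos[OF that] by (simp add: k_def)
  have ki: "k integrable_on {s..t}" if "0 \<le> s" for s t
    by (rule integrable_continuous_real[OF continuous_on_subset[OF kc]]) (use that in auto)
  define K where "K = integral {0..T} k"
  have K0: "0 \<le> K" unfolding K_def by (intro integral_nonneg ki) (use k0 in auto)
  have "energy r v v' t \<le> exp K * energy r v v' s \<and> energy r v v' s \<le> exp K * energy r v v' t"
    if v: "oscillator b r v v'" and st: "0 \<le> s" "s \<le> t" "t \<le> T" for r v v' s t
  proof -
    have d: "(energy r v v' has_real_derivative \<mu> x * energy r v v' x - 4 * b x * (lam2 x * (norm (v' x))\<^sup>2)) (at x within {s..t})"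
      if "x \<in> {s..t}" for x
      by (rule has_field_derivative_subset[OF energy_deriv[OF v]]) (use st that in auto)
    have bd: "\<bar>\<mu> x * energy r v v' x - 4 * b x * (lam2 x * (norm (v' x))\<^sup>2)\<bar> \<le> k x * energy r v v' x"
      if "x \<in> {s..t}" for x
    proof -
      have x: "0 \<le> x" using that st by simp
      have le: "lam2 x * (norm (v' x))\<^sup>2 \<le> energy r v v' x"
        unfolding energy_def using lam2_pos[of x] by (intro mult_left_mono) auto
      have "\<bar>4 * b x * (lam2 x * (norm (v' x))\<^sup>2)\<bar> = 4 * \<bar>b x\<bar> * (lam2 x * (norm (v' x))\<^sup>2)"
        using lam2_pos[of x] by (simp add: abs_mult)
      also have "\<dots> \<le> 4 * \<bar>b x\<bar> * energy r v v' x" by (rule mult_left_mono[OF le]) simp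
      finally have 2: "\<bar>4 * b x * (lam2 x * (norm (v' x))\<^sup>2)\<bar> \<le> 4 * \<bar>b x\<bar> * energy r v v' x" .
      have "\<bar>\<mu> x * energy r v v' x\<bar> = \<mu> x * energy r v v' x"
        using \<mu>_pos[OF x] energy_nonneg[of r v v' x] by (simp add: abs_mult)
      then show ?thesis using 2 unfolding k_def distrib_right by linarith
    qed
    have "integral {s..t} k \<le> K" unfolding K_def
      by (intro integral_subset_le ki) (use st k0 in auto)
    then show ?thesis
      using gronwall_two_sided[OF st(2) d bd energy_nonneg _ ki] st k0 by force
  qed
  then show ?thesis using K0 by (intro exI[of _ "exp K"]) auto
qed

text \<open>Replacing \<open>v'\<close> by \<open>w = \<eta> v'\<close> removes \<open>\<sigma>\<close> from the dissipation and puts \<open>\<eta> - \<omega>\<close> into the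
  coupling, where its integral is controlled. For the limiting equation the quadratic form below is
  the energy corrected by a cross term that makes the dissipation act equally on both
  components; the last summand keeps the form positive while \<open>\<mu> / r\<close> is not small.\<close>

lemma stabilised_zone:
  assumes k0: "k0 > 0" and K: "K \<ge> 0"
  shows "\<exists>C\<ge>1. \<forall>r>0. \<forall>v v' s t. oscillator b r v v' \<longrightarrow> k0 \<le> r * s \<longrightarrow> s \<le> t \<longrightarrow>
     r * integral {0..t} (\<lambda>\<theta>. \<bar>eta \<theta> - \<omega>\<bar>) \<le> K \<longrightarrow>
     energy r v v' t \<le> C * energy r v v' s \<and> energy r v v' s \<le> C * energy r v v' t"
proof -
  obtain S where S: "S \<ge> 1" "\<And>t. t \<ge> 0 \<Longrightarrow> eta t \<le> S" "\<And>t. t \<ge> 0 \<Longrightarrow> 1 / S \<le> eta t"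
    using eta_bounds by blast
  have S': "1 / eta t \<le> S" if "t \<ge> 0" for t
    using S(3)[OF that] S(1) eta_pos[of t] by (simp add: field_simps)
  obtain M where M: "M > 0" "\<And>t. t \<ge> 0 \<Longrightarrow> (1 + t) * \<mu> t \<le> M" using \<mu>_decay by blast
  define M' where "M' = M / k0"
  define C1 where "C1 = S * M' + (\<omega> + S) * S + M' * \<omega> + \<omega> + 2 * M' * \<omega>\<^sup>2 + \<omega>\<^sup>2 * S + M' * \<omega>\<^sup>2"
  define c0 where "c0 = min (1/2) (\<omega>\<^sup>2)"
  define C2 where "C2 = 1 + \<omega>\<^sup>2 + M' * \<omega> + M'\<^sup>2 * \<omega>\<^sup>2"
  have M'0: "0 < M'" using M k0 by (simp add: M'_def)
  have c0: "0 < c0" using \<omega>_pos by (simp add: c0_def)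
  have C10: "0 < C1" unfolding C1_def using M'0 S(1) \<omega>_pos by (intro add_pos_pos) auto
  have C20: "1 \<le> C2" unfolding C2_def using M'0 \<omega>_pos by simp
  define Kt where "Kt = C1 / c0 * (K + M' + M\<^sup>2 / k0)"
  have Kt0: "0 \<le> Kt" unfolding Kt_def using C10 c0 K M'0 k0 by simp
  define C where "C = S\<^sup>2 / c0 * exp Kt * C2 * S\<^sup>2"
  have "energy r v v' t \<le> C * energy r v v' s \<and> energy r v v' s \<le> C * energy r v v' t"
    if r: "r > 0" and v: "oscillator b r v v'" and rs: "k0 \<le> r * s" and st: "s \<le> t"
      and KI: "r * integral {0..t} (\<lambda>\<theta>. \<bar>eta \<theta> - \<omega>\<bar>) \<le> K" for r v v' s t
  proof -
    have s0: "s > 0" using rs r k0 by (smt (verit) mult_nonneg_nonpos)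
    define w where "w t = eta t *\<^sub>R v' t" for t
    (* P is the part of the derivative of F that does not come from decay at the rate mu. *)
    define F where "F t = w t \<bullet> w t + r\<^sup>2 * \<omega>\<^sup>2 * (v t \<bullet> v t) + \<mu> t * \<omega> * (v t \<bullet> w t) + (\<mu> t)\<^sup>2 * \<omega>\<^sup>2 * (v t \<bullet> v t)" for t
    define e0 where "e0 t = (norm (w t))\<^sup>2 + r\<^sup>2 * (norm (v t))\<^sup>2" for t
    define P where "P t = \<mu> t * (norm (w t))\<^sup>2 * (\<omega> - eta t) / eta t + 2 * r\<^sup>2 * (\<omega> - eta t) * (\<omega> + eta t) / eta t * (v t \<bullet> w t)
      + \<mu> t * \<omega> * r\<^sup>2 * (\<omega> - eta t) * (norm (v t))\<^sup>2
      + deriv_half \<mu> t * \<omega> * (v t \<bullet> w t) + 2 * \<mu> t * deriv_half \<mu> t * \<omega>\<^sup>2 * (norm (v t))\<^sup>2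
      + 2 * (\<mu> t)\<^sup>2 * \<omega>\<^sup>2 * (v t \<bullet> w t) / eta t + (\<mu> t) ^ 3 * \<omega>\<^sup>2 * (norm (v t))\<^sup>2" for t
    have \<mu>r: "\<mu> x \<le> M' * r" "\<mu> x \<le> M / x" if x: "x \<ge> s" for x
    proof -
      have x0: "x > 0" using x s0 by simp
      have "x * \<mu> x \<le> (1 + x) * \<mu> x" using \<mu>_pos[of x] x0 by (intro mult_right_mono) auto
      then have "x * \<mu> x \<le> M" using M(2)[of x] x0 by linarith
      then show 1: "\<mu> x \<le> M / x" using x0 by (simp add: field_simps)
      have "k0 \<le> r * x" using rs x r by (smt (verit) mult_left_mono)
      then have "M / x \<le> M / k0 * r" using k0 x0 r M(1) by (simp add: field_simps)
      then show "\<mu> x \<le> M' * r" using 1 by (simp add: M'_def)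
    qed
    have Fd: "(F has_real_derivative P x - \<mu> x * F x) (at x within {0..})" if x: "x \<ge> 0" for x
    proof -
      have 1: "(v has_vector_derivative (1 / eta x) *\<^sub>R w x) (at x within {0..})"
        using v x eta_pos[of x] by (simp add: oscillator_def w_def)
      have 2: "(w has_vector_derivative - (\<mu> x *\<^sub>R w x) - (r\<^sup>2 * eta x) *\<^sub>R v x) (at x within {0..})"
      proof -
        have "(v' has_vector_derivative - ((r\<^sup>2) *\<^sub>R v x) - (2 * b x) *\<^sub>R v' x) (at x within {0..})"
          using v x by (auto simp: oscillator_def)
        from has_vector_derivative_scaleR[OF eta_deriv[OF x] this]
        show ?thesis unfolding w_def[abs_def]
          by (rule has_vector_derivative_eq_rhs) (simp only: decomposition[OF x], simp add: scaleR_conv_of_real algebra_simps)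
      qed
      have \<mu>d: "(\<mu> has_real_derivative deriv_half \<mu> x) (at x within {0..})" by (rule \<mu>_deriv[OF x])
      note ww = inner_has_real_derivative[OF 2 2] and vv = inner_has_real_derivative[OF 1 1]
        and vw = inner_has_real_derivative[OF 1 2]
      have "(F has_real_derivative
          (w x \<bullet> (- (\<mu> x *\<^sub>R w x) - (r\<^sup>2 * eta x) *\<^sub>R v x) + (- (\<mu> x *\<^sub>R w x) - (r\<^sup>2 * eta x) *\<^sub>R v x) \<bullet> w x)
          + r\<^sup>2 * \<omega>\<^sup>2 * (v x \<bullet> (1 / eta x) *\<^sub>R w x + (1 / eta x) *\<^sub>R w x \<bullet> v x)
          + (deriv_half \<mu> x * \<omega> * (v x \<bullet> w x) + \<mu> x * \<omega> * (v x \<bullet> (- (\<mu> x *\<^sub>R w x) - (r\<^sup>2 * eta x) *\<^sub>R v x) + (1 / eta x) *\<^sub>R w x \<bullet> w x))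
          + (2 * \<mu> x * deriv_half \<mu> x * \<omega>\<^sup>2 * (v x \<bullet> v x) + (\<mu> x)\<^sup>2 * \<omega>\<^sup>2 * (v x \<bullet> (1 / eta x) *\<^sub>R w x + (1 / eta x) *\<^sub>R w x \<bullet> v x))) (at x within {0..})"
        unfolding F_def[abs_def]
        by (rule derivative_eq_intros ww vv vw \<mu>d refl)+ (simp add: algebra_simps)
      moreover have "(w x \<bullet> (- (\<mu> x *\<^sub>R w x) - (r\<^sup>2 * eta x) *\<^sub>R v x) + (- (\<mu> x *\<^sub>R w x) - (r\<^sup>2 * eta x) *\<^sub>R v x) \<bullet> w x)
          + r\<^sup>2 * \<omega>\<^sup>2 * (v x \<bullet> (1 / eta x) *\<^sub>R w x + (1 / eta x) *\<^sub>R w x \<bullet> v x)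
          + (deriv_half \<mu> x * \<omega> * (v x \<bullet> w x) + \<mu> x * \<omega> * (v x \<bullet> (- (\<mu> x *\<^sub>R w x) - (r\<^sup>2 * eta x) *\<^sub>R v x) + (1 / eta x) *\<^sub>R w x \<bullet> w x))
          + (2 * \<mu> x * deriv_half \<mu> x * \<omega>\<^sup>2 * (v x \<bullet> v x) + (\<mu> x)\<^sup>2 * \<omega>\<^sup>2 * (v x \<bullet> (1 / eta x) *\<^sub>R w x + (1 / eta x) *\<^sub>R w x \<bullet> v x))
          = P x - \<mu> x * F x"
      proof -
        define ww vv vw where "ww = w x \<bullet> w x" and "vv = v x \<bullet> v x" and "vw = v x \<bullet> w x"
        have wv: "w x \<bullet> v x = vw" by (simp add: vw_def inner_commute)
        show ?thesis
          unfolding F_def P_def power2_norm_eq_inner inner_diff_right inner_diff_left inner_minus_left inner_minus_right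
            inner_scaleR_left inner_scaleR_right wv
          unfolding ww_def[symmetric] vv_def[symmetric] vw_def[symmetric]
          using eta_pos[of x] by (simp add: field_simps power2_eq_square power3_eq_cube)
      qed
      ultimately show ?thesis by simp
    qed
    have F_low: "c0 * e0 x \<le> F x" and F_up: "F x \<le> C2 * e0 x" and P: "\<bar>P x\<bar> \<le> C1 * (r * \<bar>eta x - \<omega>\<bar> + \<bar>deriv_half \<mu> x\<bar> / r + (\<mu> x)\<^sup>2 / r) * e0 x"
      if x: "x \<ge> s" for x
    proof -
      define X Y d u where "X = norm (v x)" and "Y = norm (w x)" and "d = v x \<bullet> w x" and "u = \<mu> x * \<omega>"
      have XY: "0 \<le> X" "0 \<le> Y" "\<bar>d\<bar> \<le> X * Y" by (auto simp: X_def Y_def d_def Cauchy_Schwarz_ineq2)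
      have u0: "0 \<le> u" using \<mu>_pos[of x] x s0 \<omega>_pos by (simp add: u_def)
      have F: "F x = Y\<^sup>2 + r\<^sup>2 * \<omega>\<^sup>2 * X\<^sup>2 + u * d + u\<^sup>2 * X\<^sup>2"
        by (simp add: F_def X_def Y_def d_def u_def power2_norm_eq_inner power_mult_distrib)
      have e: "e0 x = Y\<^sup>2 + r\<^sup>2 * X\<^sup>2" by (simp add: e0_def X_def Y_def)
      have ud: "\<bar>u * d\<bar> \<le> (u * X) * Y" using XY u0 by (simp add: abs_mult mult.assoc mult_left_mono)
      have "2 * ((u * X) * Y) \<le> Y\<^sup>2 + (u * X)\<^sup>2"
        using sum_squares_ge_zero[of "Y - u * X" 0] by (simp add: power2_eq_square algebra_simps)
      then have "Y\<^sup>2 / 2 + r\<^sup>2 * \<omega>\<^sup>2 * X\<^sup>2 \<le> F x"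
      proof -
        have "- (u * d) \<le> (u * X) * Y" using ud by linarith
        moreover have "(u * X)\<^sup>2 = u\<^sup>2 * X\<^sup>2" by (rule power_mult_distrib)
        moreover have "0 \<le> u\<^sup>2 * X\<^sup>2" by simp
        ultimately show ?thesis using \<open>2 * ((u * X) * Y) \<le> Y\<^sup>2 + (u * X)\<^sup>2\<close> unfolding F by linarith
      qed
      moreover have "c0 * e0 x \<le> Y\<^sup>2 / 2 + r\<^sup>2 * \<omega>\<^sup>2 * X\<^sup>2"
      proof -
        have "c0 * Y\<^sup>2 \<le> 1/2 * Y\<^sup>2" "c0 * (r\<^sup>2 * X\<^sup>2) \<le> \<omega>\<^sup>2 * (r\<^sup>2 * X\<^sup>2)"
          by (intro mult_right_mono; simp add: c0_def)+
        then show ?thesis by (simp add: e algebra_simps)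
      qed
      ultimately show "c0 * e0 x \<le> F x" by linarith
      have uM: "u \<le> M' * \<omega> * r" using \<mu>r(1)[OF x] \<omega>_pos by (simp add: u_def mult_right_mono mult_ac)
      have "u * d \<le> (M' * \<omega>) * (r * X * Y)"
      proof -
        have "u * d \<le> u * X * Y" using ud by linarith
        also have "\<dots> \<le> (M' * \<omega> * r) * X * Y" using uM XY by (intro mult_right_mono) auto
        finally show ?thesis by (simp add: mult_ac)
      qed
      also have "\<dots> \<le> (M' * \<omega>) * e0 x"
      proof (rule mult_left_mono)
        have "2 * (r * X * Y) \<le> e0 x" using sum_squares_ge_zero[of "Y - r * X" 0]
          unfolding e by (simp add: power2_eq_square algebra_simps)
        moreover have "0 \<le> r * X * Y" using r XY by simp
        ultimately show "r * X * Y \<le> e0 x" by linarith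
      qed (use M'0 \<omega>_pos in simp)
      finally have 1: "u * d \<le> (M' * \<omega>) * e0 x" .
      have "u\<^sup>2 * X\<^sup>2 \<le> (M' * \<omega> * r)\<^sup>2 * X\<^sup>2" using uM u0 by (intro mult_right_mono power_mono) auto
      also have "\<dots> = (M'\<^sup>2 * \<omega>\<^sup>2) * (r\<^sup>2 * X\<^sup>2)" by (simp add: power_mult_distrib)
      also have "\<dots> \<le> (M'\<^sup>2 * \<omega>\<^sup>2) * e0 x" unfolding e by (intro mult_left_mono) auto
      finally have 2: "u\<^sup>2 * X\<^sup>2 \<le> (M'\<^sup>2 * \<omega>\<^sup>2) * e0 x" .
      have "r\<^sup>2 * \<omega>\<^sup>2 * X\<^sup>2 \<le> \<omega>\<^sup>2 * e0 x" unfolding e by (simp add: algebra_simps)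
      moreover have "Y\<^sup>2 \<le> e0 x" unfolding e by simp
      ultimately show "F x \<le> C2 * e0 x" using 1 2 unfolding F C2_def distrib_right by linarith
      have "\<mu> x \<ge> 0" "x \<ge> 0" using \<mu>_pos[of x] x s0 by auto
      then show "\<bar>P x\<bar> \<le> C1 * (r * \<bar>eta x - \<omega>\<bar> + \<bar>deriv_half \<mu> x\<bar> / r + (\<mu> x)\<^sup>2 / r) * e0 x"
        unfolding P_def C1_def e0_def
        by (intro stabilised_zone_algebra r norm_ge_zero Cauchy_Schwarz_ineq2 eta_pos S S' \<omega>_pos \<mu>r(1)[OF x])
    qed
    have e00: "0 \<le> e0 x" for x by (simp add: e0_def)
    define G where "G x = lam2 x * F x" for x
    have G_low: "c0 * (lam2 x * e0 x) \<le> G x" and G_up: "G x \<le> C2 * (lam2 x * e0 x)" if x: "x \<ge> s" for x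
      using mult_left_mono[OF F_low[OF x], of "lam2 x"] mult_left_mono[OF F_up[OF x], of "lam2 x"] lam2_pos[of x]
      by (auto simp: G_def mult_ac)
    define k where "k x = C1 / c0 * (r * \<bar>eta x - \<omega>\<bar> + (- deriv_half \<mu> x) / r + M\<^sup>2 / r * (1 / x\<^sup>2))" for x
    have Gd: "(G has_real_derivative lam2 x * P x) (at x within {s..t})" if x: "x \<in> {s..t}" for x
    proof (rule has_field_derivative_subset)
      have x0: "x \<ge> 0" using x s0 by simp
      show "(G has_real_derivative lam2 x * P x) (at x within {0..})"
        unfolding G_def[abs_def] using lam2_deriv[OF x0] Fd[OF x0]
        by (auto intro!: derivative_eq_intros simp: algebra_simps)
    qed (use s0 in auto)
    have Gb: "\<bar>lam2 x * P x\<bar> \<le> k x * G x" if x: "x \<in> {s..t}" for x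
    proof -
      have xs: "x \<ge> s" "x > 0" using x s0 by auto
      have "\<mu> x \<ge> 0" using \<mu>_pos[of x] xs by simp
      then have "(\<mu> x)\<^sup>2 \<le> (M / x)\<^sup>2" using \<mu>r(2)[OF xs(1)] by (intro power_mono) auto
      then have \<mu>2: "(\<mu> x)\<^sup>2 / r \<le> M\<^sup>2 / r * (1 / x\<^sup>2)" using r by (simp add: power_divide field_simps)
      have le: "r * \<bar>eta x - \<omega>\<bar> + \<bar>deriv_half \<mu> x\<bar> / r + (\<mu> x)\<^sup>2 / r \<le> c0 / C1 * k x"
        using \<mu>2 \<mu>_decreasing[of x] xs C10 c0 by (simp add: k_def)
      have "\<bar>lam2 x * P x\<bar> = lam2 x * \<bar>P x\<bar>" using lam2_pos[of x] by (simp add: abs_mult)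
      also have "\<dots> \<le> lam2 x * (C1 * (c0 / C1 * k x) * e0 x)"
      proof (rule mult_left_mono)
        have "C1 * (r * \<bar>eta x - \<omega>\<bar> + \<bar>deriv_half \<mu> x\<bar> / r + (\<mu> x)\<^sup>2 / r) * e0 x \<le> C1 * (c0 / C1 * k x) * e0 x"
          using le C10 e00 by (intro mult_right_mono mult_left_mono) auto
        then show "\<bar>P x\<bar> \<le> C1 * (c0 / C1 * k x) * e0 x" using P[OF xs(1)] by linarith
      qed (use lam2_pos[of x] in simp)
      also have "\<dots> = k x * (c0 * (lam2 x * e0 x))" using C10 by simp
      also have "\<dots> \<le> k x * G x"
      proof (rule mult_left_mono[OF G_low[OF xs(1)]])
        have "0 \<le> c0 / C1 * k x" by (rule order_trans[OF _ le]) (use r in auto)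
        then show "0 \<le> k x" using C10 c0 by (simp add: zero_le_mult_iff zero_le_divide_iff)
      qed
      finally show ?thesis .
    qed
    have G0: "0 \<le> G x" if "x \<in> {s..t}" for x
      using order_trans[OF _ G_low[of x]] that c0 lam2_pos[of x] e00[of x] by simp
    have k0': "0 \<le> k x" if x: "x \<in> {s..t}" for x
    proof -
      have "0 \<le> (- deriv_half \<mu> x) / r"
        by (rule divide_nonneg_nonneg) (use \<mu>_decreasing[of x] x s0 r in auto)
      then show ?thesis unfolding k_def using r C10 c0 by (intro mult_nonneg_nonneg add_nonneg_nonneg) auto
    qed
    have ki: "k integrable_on {s..t}" and kle: "integral {s..t} k \<le> Kt"
    proof -
      have "continuous_on {0..} (\<lambda>x. \<bar>eta x - \<omega>\<bar>)" by (intro continuous_intros eta_continuous)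
      then have ei: "(\<lambda>x. \<bar>eta x - \<omega>\<bar>) integrable_on {a..t}" if "0 \<le> a" for a
        by (intro integrable_continuous_real) (use that in \<open>auto elim: continuous_on_subset\<close>)
      have h1: "((\<lambda>x. \<bar>eta x - \<omega>\<bar>) has_integral integral {s..t} (\<lambda>x. \<bar>eta x - \<omega>\<bar>)) {s..t}"
        using ei[of s] s0 by (simp add: integrable_integral)
      have h2: "(deriv_half \<mu> has_integral (\<mu> t - \<mu> s)) {s..t}"
        by (rule has_integral_of_derivative_half[OF \<mu>_deriv]) (use s0 st in auto)
      have h3: "((\<lambda>x. 1 / x\<^sup>2) has_integral (- (1 / t) - (- (1 / s)))) {s..t}"
      proof (rule fundamental_theorem_of_calculus[OF st])
        fix x assume "x \<in> {s..t}"
        then have "((\<lambda>x. - (1 / x)) has_real_derivative 1 / x\<^sup>2) (at x within {s..t})"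
          using s0 by (auto intro!: derivative_eq_intros simp: power2_eq_square)
        then show "((\<lambda>x. - (1 / x)) has_vector_derivative 1 / x\<^sup>2) (at x within {s..t})"
          by (simp add: has_real_derivative_iff_has_vector_derivative)
      qed
      define I where "I = C1 / c0 * (r * integral {s..t} (\<lambda>x. \<bar>eta x - \<omega>\<bar>) + (- (\<mu> t - \<mu> s)) / r + M\<^sup>2 / r * (- (1 / t) - (- (1 / s))))"
      have kI: "(k has_integral I) {s..t}"
        unfolding k_def[abs_def] I_def
        by (intro has_integral_mult_right has_integral_add has_integral_divide has_integral_neg h1 h2 h3)
      then show "k integrable_on {s..t}" by blast
      have "integral {s..t} (\<lambda>x. \<bar>eta x - \<omega>\<bar>) \<le> integral {0..t} (\<lambda>x. \<bar>eta x - \<omega>\<bar>)"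
        by (rule integral_subset_le) (use s0 ei[of s] ei[of 0] in auto)
      then have "r * integral {s..t} (\<lambda>x. \<bar>eta x - \<omega>\<bar>) \<le> K"
        using KI r by (smt (verit) mult_left_mono)
      moreover have "(- (\<mu> t - \<mu> s)) / r \<le> M'"
      proof -
        have "- (\<mu> t - \<mu> s) \<le> M' * r" using \<mu>r(1)[of s] \<mu>_pos[of t] st s0 by simp
        then show ?thesis using r by (simp add: divide_le_eq)
      qed
      moreover have "M\<^sup>2 / r * (- (1 / t) - (- (1 / s))) \<le> M\<^sup>2 / k0"
      proof -
        have "M\<^sup>2 / r * (- (1 / t) - (- (1 / s))) \<le> M\<^sup>2 / r * (1 / s)"
          using s0 st r by (intro mult_left_mono) auto
        also have "\<dots> = M\<^sup>2 / (r * s)" by simp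
        also have "\<dots> \<le> M\<^sup>2 / k0" using rs k0 by (intro divide_left_mono) auto
        finally show ?thesis .
      qed
      ultimately have "I \<le> Kt" unfolding I_def Kt_def using C10 c0 by (intro mult_left_mono add_mono) auto
      then show "integral {s..t} k \<le> Kt" using kI by (simp add: integral_unique)
    qed
    note gr = gronwall_two_sided[OF st Gd Gb G0 k0' ki kle]
    have ev: "energy r v v' x \<le> S\<^sup>2 * (lam2 x * e0 x)" "lam2 x * e0 x \<le> S\<^sup>2 * energy r v v' x" if x: "x \<ge> 0" for x
    proof -
      have w2: "(norm (w x))\<^sup>2 = (eta x)\<^sup>2 * (norm (v' x))\<^sup>2"
        by (simp add: w_def power_mult_distrib)
      have a: "(eta x)\<^sup>2 \<le> S\<^sup>2" using S(2)[OF x] eta_pos[of x] by (intro power_mono) auto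
      have "(1 / eta x)\<^sup>2 \<le> S\<^sup>2" using S'[OF x] eta_pos[of x] by (intro power_mono) auto
      then have b: "1 \<le> S\<^sup>2 * (eta x)\<^sup>2" using eta_pos[of x] by (simp add: power_divide divide_le_eq)
      have one: "1 \<le> S\<^sup>2" using S(1) by (simp add: one_le_power)
      have "r\<^sup>2 * (norm (v x))\<^sup>2 + (norm (v' x))\<^sup>2 \<le> S\<^sup>2 * e0 x"
        using mult_right_mono[OF one, of "r\<^sup>2 * (norm (v x))\<^sup>2"] mult_right_mono[OF b, of "(norm (v' x))\<^sup>2"]
        unfolding e0_def w2 by (simp add: algebra_simps)
      from mult_left_mono[OF this, of "lam2 x"] show "energy r v v' x \<le> S\<^sup>2 * (lam2 x * e0 x)"
        using lam2_pos[of x] by (simp add: energy_def mult_ac)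
      have "e0 x \<le> S\<^sup>2 * (r\<^sup>2 * (norm (v x))\<^sup>2 + (norm (v' x))\<^sup>2)"
        using mult_right_mono[OF one, of "r\<^sup>2 * (norm (v x))\<^sup>2"] mult_right_mono[OF a, of "(norm (v' x))\<^sup>2"]
        unfolding e0_def w2 by (simp add: algebra_simps)
      from mult_left_mono[OF this, of "lam2 x"] show "lam2 x * e0 x \<le> S\<^sup>2 * energy r v v' x"
        using lam2_pos[of x] by (simp add: energy_def mult_ac)
    qed
    have chain: "energy r v v' x \<le> C * energy r v v' y" if "x \<ge> s" "y \<ge> s" "G x \<le> exp Kt * G y" for x y
    proof -
      have xy: "x \<ge> 0" "y \<ge> 0" using that s0 by auto
      have "energy r v v' x \<le> S\<^sup>2 * (lam2 x * e0 x)" by (rule ev(1)[OF xy(1)])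
      also have "\<dots> \<le> S\<^sup>2 * (G x / c0)"
        using G_low[OF that(1)] c0 by (intro mult_left_mono) (auto simp: le_divide_eq mult.commute)
      also have "\<dots> \<le> S\<^sup>2 * (exp Kt * (C2 * (S\<^sup>2 * energy r v v' y)) / c0)"
      proof -
        have "G y \<le> C2 * (lam2 y * e0 y)" by (rule G_up[OF that(2)])
        also have "\<dots> \<le> C2 * (S\<^sup>2 * energy r v v' y)" using ev(2)[OF xy(2)] C20 by (intro mult_left_mono) auto
        finally have "exp Kt * G y \<le> exp Kt * (C2 * (S\<^sup>2 * energy r v v' y))" by (intro mult_left_mono) auto
        from order_trans[OF that(3) this] show ?thesis using c0 by (intro mult_left_mono divide_right_mono) auto
      qed
      also have "\<dots> = C * energy r v v' y" by (simp add: C_def)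
      finally show ?thesis .
    qed
    show ?thesis using chain gr st by auto
  qed
  moreover have "1 \<le> C"
  proof -
    have "1 \<le> S\<^sup>2" using S(1) by (simp add: one_le_power)
    moreover have "1 \<le> 1 / c0" using c0 by (simp add: c0_def)
    ultimately have "1 \<le> S\<^sup>2 * (1 / c0)" by (metis mult_mono' mult_1 zero_le_one)
    then have "1 * 1 * 1 * 1 \<le> (S\<^sup>2 * (1 / c0)) * exp Kt * C2 * S\<^sup>2"
      using Kt0 C20 c0 \<open>1 \<le> S\<^sup>2\<close> by (intro mult_mono) auto
    then show ?thesis by (simp add: C_def)
  qed
  ultimately show ?thesis by blast
qed

end

section \<open>Low frequencies and early times\<close>

lemma has_vector_derivative_bound_half:
  fixes f :: "real \<Rightarrow> 'a::real_normed_vector"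
  assumes f: "\<And>x. x \<ge> 0 \<Longrightarrow> (f has_vector_derivative f' x) (at x within {0..})"
    and g: "\<And>x. x \<ge> 0 \<Longrightarrow> (g has_real_derivative g' x) (at x within {0..})"
    and le: "\<And>x. 0 < x \<Longrightarrow> x < t \<Longrightarrow> norm (f' x) \<le> g' x" and t: "0 \<le> t"
  shows "norm (f t - f 0) \<le> g t - g 0"
proof (cases "t = 0")
  case False
  have fd: "(f has_vector_derivative f' x) (at x)" "(g has_vector_derivative g' x) (at x)" if "0 < x" for x
    using f[of x] g[of x] that at_within_interior[of x "{0..}"]
    by (auto simp: has_real_derivative_iff_has_vector_derivative)
  show ?thesis
  proof (rule differentiable_bound_general[where f' = f' and \<phi>' = g'])
    show "continuous_on {0..t} f"
      unfolding continuous_on_eq_continuous_within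
      by (auto intro!: has_vector_derivative_continuous has_vector_derivative_within_subset[OF f])
    show "continuous_on {0..t} g"
      unfolding continuous_on_eq_continuous_within
      by (auto intro!: has_vector_derivative_continuous has_vector_derivative_within_subset
         [OF g[unfolded has_real_derivative_iff_has_vector_derivative]])
  qed (use False t le fd in auto)
qed simp

context damping
begin

text \<open>For \<open>r t \<lesssim> 1\<close> the term \<open>r\<^sup>2 v\<close> acts as a perturbation of the equation
  \<open>(\<lambda>\<^sup>2 \<eta> v')' = 0\<close>, whose solutions grow at most like the integral of \<open>1 / \<lambda>\<^sup>2\<close>. A bound of
  the maximum of \<open>\<lambda>\<^sup>2 \<eta> v'\<close> in terms of itself closes once \<open>r t\<close> is small.\<close>

lemma low_frequency_zone:
  "\<exists>k0>0. \<exists>C\<ge>1. \<forall>r v v' t. 0 < r \<longrightarrow> r \<le> 1 \<longrightarrow> oscillator b r v v' \<longrightarrow> 0 \<le> t \<longrightarrow> r * t \<le> k0 \<longrightarrow>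
     energy r v v' t \<le> C * ((norm (v 0))\<^sup>2 + (norm (v' 0))\<^sup>2)"
proof -
  obtain S where S: "S \<ge> 1" "\<And>t. t \<ge> 0 \<Longrightarrow> eta t \<le> S" "\<And>t. t \<ge> 0 \<Longrightarrow> 1 / S \<le> eta t"
    using eta_bounds by blast
  have S': "1 / eta t \<le> S" if "t \<ge> 0" for t
    using S(3)[OF that] S(1) eta_pos[of t] by (simp add: field_simps)
  obtain L where L: "L \<ge> 1" "\<And>t. t \<ge> 0 \<Longrightarrow> J t \<le> L * (1 + t) / lam2 t" "\<And>t. t \<ge> 0 \<Longrightarrow> lam2 t \<le> L * (1 + t)"
    using J_bound by blast
  (* This choice makes the factor by which the maximum M bounds itself equal to 1/2. *)
  define k0 where "k0 = 1 / (4 * S\<^sup>2 * L)"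
  have k0: "0 < k0" using S L by (simp add: k0_def)
  have k01: "k0 \<le> 1"
  proof -
    have "1 * 1 \<le> S\<^sup>2 * L" using S L by (intro mult_mono one_le_power) auto
    then have "1 \<le> 4 * S\<^sup>2 * L" by simp
    then have "k0 * 1 \<le> k0 * (4 * S\<^sup>2 * L)" using k0 by (intro mult_left_mono) auto
    also have "\<dots> = 1" using S(1) L(1) by (simp add: k0_def)
    finally show ?thesis by simp
  qed
  define C where "C = 4 * L + 100 * S ^ 6 * L\<^sup>2"
  have bound: "energy r v v' t \<le> C * ((norm (v 0))\<^sup>2 + (norm (v' 0))\<^sup>2)"
    if r: "0 < r" "r \<le> 1" and v: "oscillator b r v v'" and t: "0 \<le> t" "r * t \<le> k0" for r v v' t
  proof -
    (* Multiplication by lam2 eta = exp (2 int b) removes the damping term. *)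
    define a where "a s = (lam2 s * eta s) *\<^sub>R v' s" for s
    have vd: "(v has_vector_derivative v' s) (at s within {0..})"
      and v'd: "(v' has_vector_derivative - ((r\<^sup>2) *\<^sub>R v s) - (2 * b s) *\<^sub>R v' s) (at s within {0..})" if "s \<ge> 0" for s
      using v that by (auto simp: oscillator_def)
    have ad: "(a has_vector_derivative - ((r\<^sup>2 * (lam2 s * eta s)) *\<^sub>R v s)) (at s within {0..})" if s: "s \<ge> 0" for s
    proof -
      have "((\<lambda>s. lam2 s * eta s) has_real_derivative (2 * b s) * (lam2 s * eta s)) (at s within {0..})"
        using lam2_deriv[OF s] eta_deriv[OF s] decomposition[OF s]
        by (auto intro!: derivative_eq_intros simp: algebra_simps)
      from has_vector_derivative_scaleR[OF this v'd[OF s]] show ?thesis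
        unfolding a_def[abs_def] by (rule has_vector_derivative_eq_rhs) (simp add: algebra_simps)
    qed
    have "continuous_on {0..t} a"
      unfolding continuous_on_eq_continuous_within
      by (auto intro!: has_vector_derivative_continuous has_vector_derivative_within_subset[OF ad])
    then have "continuous_on {0..t} (\<lambda>s. norm (a s))" by (rule continuous_on_norm)
    then obtain \<tau> where \<tau>: "\<tau> \<in> {0..t}" "\<And>s. s \<in> {0..t} \<Longrightarrow> norm (a s) \<le> norm (a \<tau>)"
      using continuous_attains_sup[of "{0..t}" "\<lambda>s. norm (a s)"] t by auto
    define M where "M = norm (a \<tau>)"
    have M0: "0 \<le> M" by (simp add: M_def)
    have v'b: "norm (v' s) \<le> M * S * (1 / lam2 s)" if s: "s \<in> {0..t}" for s
    proof -
      have "norm (v' s) = norm (a s) * (1 / eta s) * (1 / lam2 s)"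
        using lam2_pos[of s] eta_pos[of s] by (simp add: a_def)
      also have "\<dots> \<le> M * S * (1 / lam2 s)"
        using \<tau>(2)[OF s] S'[of s] s lam2_pos[of s] eta_pos[of s] M0 by (intro mult_right_mono mult_mono) (auto simp: M_def)
      finally show ?thesis .
    qed
    have vb: "norm (v s) \<le> norm (v 0) + M * S * L * (1 + s) / lam2 s" if s: "s \<in> {0..t}" for s
    proof -
      have "norm (v s - v 0) \<le> M * S * J s - M * S * J 0"
        by (rule has_vector_derivative_bound_half[where f = v and g = "\<lambda>s. M * S * J s", OF vd DERIV_cmult[OF J_deriv]])
          (use v'b s in auto)
      also have "\<dots> \<le> M * S * (L * (1 + s) / lam2 s)"
        using mult_left_mono[OF L(2)[of s], of "M * S"] s M0 S(1) by (simp add: J_def[of 0])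
      finally have "norm (v s - v 0) \<le> M * S * L * (1 + s) / lam2 s" by (simp add: mult.assoc)
      then show ?thesis using norm_triangle_sub[of "v s" "v 0"] by simp
    qed
    define B where "B = r\<^sup>2 * S * L * (1 + t) * (norm (v 0) + M * S)"
    have Bb: "norm (- ((r\<^sup>2 * (lam2 s * eta s)) *\<^sub>R v s)) \<le> B" if s: "s \<in> {0..t}" for s
    proof -
      have "norm (- ((r\<^sup>2 * (lam2 s * eta s)) *\<^sub>R v s)) = r\<^sup>2 * eta s * (lam2 s * norm (v s))"
        using lam2_pos[of s] eta_pos[of s] by (simp add: abs_mult)
      also have "\<dots> \<le> r\<^sup>2 * S * (L * (1 + t) * (norm (v 0) + M * S))"
      proof (rule mult_mono)
        have "lam2 s * norm (v s) \<le> lam2 s * (norm (v 0) + M * S * L * (1 + s) / lam2 s)"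
          using vb[OF s] lam2_pos[of s] by (intro mult_left_mono) auto
        also have "\<dots> = lam2 s * norm (v 0) + L * (1 + s) * (M * S)"
          using lam2_pos[of s] by (simp add: field_simps)
        also have "\<dots> \<le> L * (1 + s) * norm (v 0) + L * (1 + s) * (M * S)"
          using L(3)[of s] s M0 S(1) by (intro add_mono mult_right_mono) auto
        also have "\<dots> = L * (1 + s) * (norm (v 0) + M * S)" by (simp add: distrib_left)
        also have "\<dots> \<le> L * (1 + t) * (norm (v 0) + M * S)"
          using s L(1) M0 S(1) by (intro mult_right_mono mult_left_mono) auto
        finally show "lam2 s * norm (v s) \<le> L * (1 + t) * (norm (v 0) + M * S)" .
        show "r\<^sup>2 * eta s \<le> r\<^sup>2 * S" using S(2)[of s] s by (intro mult_left_mono) auto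
      qed (use S(1) lam2_pos[of s] in auto)
      finally show ?thesis by (simp add: B_def mult.assoc)
    qed
    have rt: "r\<^sup>2 * (1 + t) * t \<le> 2 * k0" "r\<^sup>2 * (1 + t) \<le> 2" "r * (1 + t) \<le> 2"
    proof -
      have rt1: "r * t \<le> 1" using t k01 by linarith
      then show 3: "r * (1 + t) \<le> 2" using r by (simp add: algebra_simps)
      have "r * (r * (1 + t)) \<le> 1 * 2" using r 3 t by (intro mult_mono) auto
      then show "r\<^sup>2 * (1 + t) \<le> 2" by (simp add: power2_eq_square mult.assoc)
      have "(r * (1 + t)) * (r * t) \<le> 2 * k0" using 3 t r by (intro mult_mono) auto
      then show "r\<^sup>2 * (1 + t) * t \<le> 2 * k0" by (simp add: power2_eq_square mult_ac)
    qed
    have "norm (a \<tau> - a 0) \<le> B * \<tau> - B * 0"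
      by (rule has_vector_derivative_bound_half[where f = a and g = "\<lambda>s. B * s", OF ad])
        (use Bb \<tau> in \<open>auto intro!: derivative_eq_intros\<close>)
    also have "B * \<tau> - B * 0 \<le> B * t"
    proof -
      have "0 \<le> B" by (rule order_trans[OF norm_ge_zero Bb[of 0]]) (use t in simp)
      then show ?thesis using \<tau>(1) by (simp add: mult_left_mono)
    qed
    also have "B * t = (r\<^sup>2 * (1 + t) * t) * (S * L * (norm (v 0) + M * S))" by (simp add: B_def mult_ac)
    also have "\<dots> \<le> (2 * k0) * (S * L * (norm (v 0) + M * S))"
      using rt S(1) L(1) M0 by (intro mult_right_mono) auto
    also have "\<dots> = norm (v 0) / (2 * S) + M / 2"
      using S(1) L(1) by (simp add: k0_def field_simps power2_eq_square)
    also have "\<dots> \<le> norm (v 0) + M / 2"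
      using S(1) mult_left_mono[of 1 "2 * S" "norm (v 0)"] by (simp add: divide_le_eq)
    finally have "norm (a \<tau> - a 0) \<le> norm (v 0) + M / 2" .
    moreover have "norm (a 0) = norm (v' 0)" by (simp add: a_def lam2_0 eta_0)
    ultimately have M: "M \<le> 2 * (norm (v 0) + norm (v' 0))"
      using norm_triangle_sub[of "a \<tau>" "a 0"] by (simp add: M_def)
    define D where "D = (norm (v 0))\<^sup>2 + (norm (v' 0))\<^sup>2"
    have D: "(norm (v 0))\<^sup>2 \<le> D" "0 \<le> D" by (simp_all add: D_def)
    have M2: "M\<^sup>2 \<le> 8 * D"
    proof -
      have "M\<^sup>2 \<le> (2 * (norm (v 0) + norm (v' 0)))\<^sup>2" using M M0 by (intro power_mono)
      also have "\<dots> \<le> 8 * D" using sum_squares_ge_zero[of "norm (v 0) - norm (v' 0)" 0]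
        by (simp add: D_def power2_eq_square algebra_simps)
      finally show ?thesis .
    qed
    have tt: "t \<in> {0..t}" using t by simp
    have l1: "1 \<le> lam2 t" by (rule lam2_ge_1[OF t(1)])
    have 1: "lam2 t * (norm (v' t))\<^sup>2 \<le> 8 * S\<^sup>2 * D"
    proof -
      have "lam2 t * (norm (v' t))\<^sup>2 \<le> lam2 t * (M * S * (1 / lam2 t))\<^sup>2"
        using v'b[OF tt] l1 by (intro mult_left_mono power_mono) auto
      also have "\<dots> = M\<^sup>2 * S\<^sup>2 * (1 / lam2 t)"
        using l1 by (simp add: power_mult_distrib power_divide power2_eq_square)
      also have "\<dots> \<le> (8 * D) * S\<^sup>2 * 1"
        using M2 l1 D by (intro mult_mono) auto
      finally show ?thesis by (simp add: mult_ac)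
    qed
    have 2: "lam2 t * (r\<^sup>2 * (norm (v t))\<^sup>2) \<le> 4 * L * D + 64 * S\<^sup>2 * L\<^sup>2 * D"
    proof -
      define q where "q = M * S * L * (1 + t) / lam2 t"
      have q0: "0 \<le> q" using M0 S(1) L(1) t l1 by (simp add: q_def)
      have "(norm (v t))\<^sup>2 \<le> (norm (v 0) + q)\<^sup>2" using vb[OF tt] by (intro power_mono) (auto simp: q_def)
      also have "\<dots> \<le> 2 * (norm (v 0))\<^sup>2 + 2 * q\<^sup>2"
        using sum_squares_ge_zero[of "norm (v 0) - q" 0] by (simp add: power2_eq_square algebra_simps)
      finally have "lam2 t * (r\<^sup>2 * (norm (v t))\<^sup>2) \<le> lam2 t * (r\<^sup>2 * (2 * (norm (v 0))\<^sup>2 + 2 * q\<^sup>2))"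
        using l1 by (intro mult_left_mono) auto
      also have "\<dots> = 2 * ((lam2 t * r\<^sup>2) * (norm (v 0))\<^sup>2) + 2 * (r\<^sup>2 * (lam2 t * q\<^sup>2))" by (simp add: algebra_simps)
      also have "\<dots> \<le> 2 * ((2 * L) * D) + 2 * (32 * S\<^sup>2 * L\<^sup>2 * D)"
      proof -
        have "lam2 t * r\<^sup>2 \<le> (L * (1 + t)) * r\<^sup>2" using L(3)[OF t(1)] by (intro mult_right_mono) auto
        also have "\<dots> = L * (r\<^sup>2 * (1 + t))" by simp
        also have "\<dots> \<le> L * 2" using rt(2) L(1) by (intro mult_left_mono) auto
        finally have h1: "lam2 t * r\<^sup>2 \<le> 2 * L" by simp
        have h2: "(lam2 t * r\<^sup>2) * (norm (v 0))\<^sup>2 \<le> (2 * L) * D"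
          by (rule mult_mono[OF h1 D(1)]) (use L(1) in auto)
        have "r\<^sup>2 * (lam2 t * q\<^sup>2) = (r * (1 + t))\<^sup>2 * (M\<^sup>2 * (S\<^sup>2 * L\<^sup>2)) * (1 / lam2 t)"
          using l1 unfolding q_def by (simp add: power_mult_distrib power_divide power2_eq_square)
        also have "\<dots> \<le> 2\<^sup>2 * (8 * D * (S\<^sup>2 * L\<^sup>2)) * 1"
          using rt(3) M2 l1 r t D S(1) L(1) by (intro mult_mono power_mono) auto
        finally have "r\<^sup>2 * (lam2 t * q\<^sup>2) \<le> 32 * S\<^sup>2 * L\<^sup>2 * D" by (simp add: mult_ac)
        then show ?thesis using h2 by linarith
      qed
      finally show ?thesis by (simp add: mult_ac)
    qed
    have "energy r v v' t \<le> (4 * L + 64 * S\<^sup>2 * L\<^sup>2 + 8 * S\<^sup>2) * D"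
      using 1 2 unfolding energy_def by (simp add: algebra_simps)
    also have "\<dots> \<le> C * D"
    proof (intro mult_right_mono D)
      have "S\<^sup>2 * 1 \<le> S ^ 6 * L\<^sup>2" using S(1) L(1) by (intro mult_mono power_increasing one_le_power) auto
      moreover have "S\<^sup>2 * L\<^sup>2 \<le> S ^ 6 * L\<^sup>2" using S(1) by (intro mult_right_mono power_increasing) auto
      ultimately show "4 * L + 64 * S\<^sup>2 * L\<^sup>2 + 8 * S\<^sup>2 \<le> C" unfolding C_def mult.assoc using zero_le_power2[of S] by linarith
    qed
    finally show ?thesis by (simp add: D_def)
  qed
  have "0 \<le> 100 * S ^ 6 * L\<^sup>2" using S(1) by simp
  then have "1 \<le> C" using L(1) unfolding C_def by linarith
  then show ?thesis using k0 bound by blast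
qed

end

section \<open>Symbols in the hyperbolic zone\<close>

context damping
begin

text \<open>The hyperbolic zone at frequency \<open>r\<close>. As \<open>\<Theta>\<close> need not be monotone, the condition is imposed
  at all later times, so that a solution that has entered the zone stays in it.\<close>

definition zone :: "real \<Rightarrow> real \<Rightarrow> real set" where
  "zone N r = {t. 0 \<le> t \<and> (\<forall>s\<ge>t. N \<le> r * \<Theta> s)}"

definition X :: "real \<Rightarrow> real \<Rightarrow> real" where "X r t = 1 / (r * \<Xi> t)"

lemma zone_upward: "t \<in> zone N r \<Longrightarrow> t \<le> s \<Longrightarrow> s \<in> zone N r"
  by (auto simp: zone_def)

lemma zone_mono: "N \<le> N' \<Longrightarrow> zone N' r \<subseteq> zone N r"
  by (force simp: zone_def)

lemma X_pos: "r > 0 \<Longrightarrow> t \<in> zone N r \<Longrightarrow> 0 < X r t"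
  using \<Xi>_pos[of t] by (simp add: X_def zone_def)

text \<open>In the zone \<open>X = 1 / (r \<Xi>)\<close> is at most a multiple of \<open>1 / (r \<Theta>) \<le> 1 / N\<close>. A large \<open>N\<close> thus makes
  every expression that contains a factor \<open>X\<close> small.\<close>

lemma X_bound: "\<exists>c>0. \<forall>N>0. \<forall>r>0. \<forall>t\<in>zone N r. X r t \<le> c / N"
proof -
  obtain c where c: "c > 0" "\<And>t. t \<ge> 0 \<Longrightarrow> \<Theta> t \<le> c * \<Xi> t" using \<Xi>_ge by (auto simp: lesssim_half_def)
  have "X r t \<le> c / N" if N: "N > 0" and r: "r > 0" and t: "t \<in> zone N r" for N r t
  proof -
    have t0: "t \<ge> 0" using t by (simp add: zone_def)
    have "N \<le> r * \<Theta> t" using t by (auto simp: zone_def)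
    also have "r * \<Theta> t \<le> r * (c * \<Xi> t)" using c(2)[OF t0] r by (intro mult_left_mono) auto
    finally have "N \<le> c * (r * \<Xi> t)" by (simp add: mult_ac)
    then show ?thesis using N r \<Xi>_pos[OF t0] by (simp add: X_def field_simps)
  qed
  then show ?thesis using c by blast
qed

text \<open>The derivative is measured in units of the frequency, so that one differentiation costs
  one factor \<open>X = 1 / (r \<Xi>)\<close>.\<close>

definition has_D :: "real \<Rightarrow> (real \<Rightarrow> real \<Rightarrow> complex) \<Rightarrow> (real \<Rightarrow> real \<Rightarrow> complex) \<Rightarrow> bool" where
  "has_D N f g \<longleftrightarrow> (\<forall>r>0. \<forall>t\<in>zone N r. (f r has_vector_derivative r *\<^sub>R g r t) (at t within zone N r))"

text \<open>A symbol class in which \<open>c\<close> counts the powers of \<open>X\<close> in the bound of the function, each derivative gains one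
  more, and \<open>l\<close> is the number of derivatives that are controlled. All bounds are uniform in \<open>r\<close>.\<close>

primrec symb :: "nat \<Rightarrow> real \<Rightarrow> nat \<Rightarrow> (real \<Rightarrow> real \<Rightarrow> complex) \<Rightarrow> bool" where
  "symb 0 N c f \<longleftrightarrow> (\<exists>C\<ge>0. \<forall>r>0. \<forall>t\<in>zone N r. cmod (f r t) \<le> C * X r t ^ c)"
| "symb (Suc l) N c f \<longleftrightarrow> (\<exists>C\<ge>0. \<forall>r>0. \<forall>t\<in>zone N r. cmod (f r t) \<le> C * X r t ^ c) \<and>
     (\<exists>g. has_D N f g \<and> symb l N (Suc c) g)"

lemma symb_0: "symb l N c f \<Longrightarrow> symb 0 N c f"
  by (cases l) auto

lemma symb_SucI: "symb 0 N c f \<Longrightarrow> has_D N f g \<Longrightarrow> symb l N (Suc c) g \<Longrightarrow> symb (Suc l) N c f"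
  by auto

lemma symb_SucE:
  assumes "symb (Suc l) N c f"
  obtains g where "has_D N f g" "symb l N (Suc c) g"
  using assms by auto

lemma symb_less_smooth: "symb (Suc l) N c f \<Longrightarrow> symb l N c f"
proof (induction l arbitrary: c f)
  case (Suc l)
  obtain g where g: "has_D N f g" "symb (Suc l) N (Suc c) g" by (rule symb_SucE[OF Suc.prems])
  then show ?case using Suc.IH[OF g(2)] symb_0[OF Suc.prems] by (blast intro: symb_SucI)
qed (rule symb_0)

lemma symb_less_smooth': "symb l N c f \<Longrightarrow> k \<le> l \<Longrightarrow> symb k N c f"
proof (induction l)
  case (Suc l)
  then show ?case by (cases "k = Suc l") (auto dest: symb_less_smooth simp del: symb.simps)
qed simp

lemma symb_less_decay_0:
  assumes N: "N > 0" and f: "symb 0 N (Suc c) f"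
  shows "symb 0 N c f"
proof -
  obtain k where k: "k > 0" "\<And>r t. r > 0 \<Longrightarrow> t \<in> zone N r \<Longrightarrow> X r t \<le> k / N"
    using X_bound N by metis
  obtain C where C: "C \<ge> 0" "\<And>r t. r > 0 \<Longrightarrow> t \<in> zone N r \<Longrightarrow> cmod (f r t) \<le> C * X r t ^ Suc c"
    using f by auto
  have "cmod (f r t) \<le> (C * (k / N)) * X r t ^ c" if rt: "r > 0" "t \<in> zone N r" for r t
  proof -
    have "C * X r t ^ Suc c = (C * X r t) * X r t ^ c" by simp
    also have "\<dots> \<le> (C * (k / N)) * X r t ^ c"
      using C(1) k(2)[OF rt] X_pos[OF rt] by (intro mult_right_mono mult_left_mono) auto
    finally show ?thesis using C(2)[OF rt] by linarith
  qed
  moreover have "0 \<le> C * (k / N)" using C k N by simp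
  ultimately show ?thesis by auto
qed

lemma symb_less_decay:
  assumes N: "N > 0"
  shows "symb l N (Suc c) f \<Longrightarrow> symb l N c f"
proof (induction l arbitrary: c f)
  case 0
  then show ?case by (rule symb_less_decay_0[OF N])
next
  case (Suc l)
  obtain g where g: "has_D N f g" "symb l N (Suc (Suc c)) g" by (rule symb_SucE[OF Suc.prems])
  show ?case
    by (rule symb_SucI[OF symb_less_decay_0[OF N symb_0[OF Suc.prems]] g(1) Suc.IH[OF g(2)]])
qed

lemma symb_less_decay': "N > 0 \<Longrightarrow> symb l N d f \<Longrightarrow> c \<le> d \<Longrightarrow> symb l N c f"
proof (induction d)
  case (Suc d)
  then show ?case by (cases "c = Suc d") (auto dest: symb_less_decay simp del: symb.simps)
qed simp

lemma has_D_zone: "N \<le> N' \<Longrightarrow> has_D N f g \<Longrightarrow> has_D N' f g"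
  unfolding has_D_def using zone_mono[of N N'] by (meson has_vector_derivative_within_subset subsetD)

lemma symb_zone: "N \<le> N' \<Longrightarrow> symb l N c f \<Longrightarrow> symb l N' c f"
proof (induction l arbitrary: c f)
  case 0
  then show ?case using zone_mono[of N N'] by (simp) (meson subsetD)
next
  case (Suc l)
  obtain g where g: "has_D N f g" "symb l N (Suc c) g" by (rule symb_SucE[OF Suc.prems(2)])
  have "symb 0 N' c f" using symb_0[OF Suc.prems(2)] zone_mono[OF Suc.prems(1)] by (simp) (meson subsetD)
  then show ?case using Suc.IH[OF Suc.prems(1) g(2)] has_D_zone[OF Suc.prems(1) g(1)] by (blast intro: symb_SucI)
qed

lemma symb_add_0:
  assumes "symb 0 N c f" "symb 0 N c g"
  shows "symb 0 N c (\<lambda>r t. f r t + g r t)"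
proof -
  obtain C D where C: "C \<ge> 0" "\<And>r t. r > 0 \<Longrightarrow> t \<in> zone N r \<Longrightarrow> cmod (f r t) \<le> C * X r t ^ c"
    and D: "D \<ge> 0" "\<And>r t. r > 0 \<Longrightarrow> t \<in> zone N r \<Longrightarrow> cmod (g r t) \<le> D * X r t ^ c"
    using assms by auto
  have "cmod (f r t + g r t) \<le> (C + D) * X r t ^ c" if "r > 0" "t \<in> zone N r" for r t
    using norm_triangle_ineq[of "f r t" "g r t"] C(2)[OF that] D(2)[OF that] unfolding distrib_right by linarith
  then show ?thesis using C(1) D(1) by (auto intro!: exI[of _ "C + D"])
qed

lemma has_D_add:
  "has_D N f f' \<Longrightarrow> has_D N g g' \<Longrightarrow> has_D N (\<lambda>r t. f r t + g r t) (\<lambda>r t. f' r t + g' r t)"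
  unfolding has_D_def scaleR_add_right by (auto intro!: has_vector_derivative_add)

lemma symb_add: "symb l N c f \<Longrightarrow> symb l N c g \<Longrightarrow> symb l N c (\<lambda>r t. f r t + g r t)"
proof (induction l arbitrary: c f g)
  case 0
  then show ?case by (rule symb_add_0)
next
  case (Suc l)
  obtain f' where f': "has_D N f f'" "symb l N (Suc c) f'" by (rule symb_SucE[OF Suc.prems(1)])
  obtain g' where g': "has_D N g g'" "symb l N (Suc c) g'" by (rule symb_SucE[OF Suc.prems(2)])
  show ?case
    by (rule symb_SucI[OF symb_add_0[OF symb_0[OF Suc.prems(1)] symb_0[OF Suc.prems(2)]]
          has_D_add[OF f'(1) g'(1)] Suc.IH[OF f'(2) g'(2)]])
qed

lemma symb_mult_0:
  assumes "symb 0 N c f" "symb 0 N d g"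
  shows "symb 0 N (c + d) (\<lambda>r t. f r t * g r t)"
proof -
  obtain C D where C: "C \<ge> 0" "\<And>r t. r > 0 \<Longrightarrow> t \<in> zone N r \<Longrightarrow> cmod (f r t) \<le> C * X r t ^ c"
    and D: "D \<ge> 0" "\<And>r t. r > 0 \<Longrightarrow> t \<in> zone N r \<Longrightarrow> cmod (g r t) \<le> D * X r t ^ d" using assms by auto
  have "cmod (f r t * g r t) \<le> (C * D) * X r t ^ (c + d)" if "r > 0" "t \<in> zone N r" for r t
  proof -
    have "cmod (f r t * g r t) \<le> (C * X r t ^ c) * (D * X r t ^ d)"
      unfolding norm_mult using C D that X_pos[OF that] by (intro mult_mono) auto
    then show ?thesis by (simp add: power_add mult_ac)
  qed
  then show ?thesis using C(1) D(1) by (auto intro!: exI[of _ "C * D"])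
qed

lemma has_D_mult:
  assumes "has_D N f f'" "has_D N g g'"
  shows "has_D N (\<lambda>r t. f r t * g r t) (\<lambda>r t. f r t * g' r t + f' r t * g r t)"
  unfolding has_D_def
proof (intro allI impI ballI)
  fix r :: real and t assume "r > 0" "t \<in> zone N r"
  with assms have "(f r has_vector_derivative r *\<^sub>R f' r t) (at t within zone N r)"
    "(g r has_vector_derivative r *\<^sub>R g' r t) (at t within zone N r)" by (auto simp: has_D_def)
  from has_vector_derivative_mult[OF this]
  show "((\<lambda>t. f r t * g r t) has_vector_derivative r *\<^sub>R (f r t * g' r t + f' r t * g r t)) (at t within zone N r)"
    by (simp add: scaleR_add_right)
qed

text \<open>The product rule keeps the count of powers of \<open>X\<close>, since the derivative of either factor has
  one power more.\<close>

lemma symb_mult: "symb l N c f \<Longrightarrow> symb l N d g \<Longrightarrow> symb l N (c + d) (\<lambda>r t. f r t * g r t)"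
proof (induction l arbitrary: c d f g)
  case 0
  then show ?case by (rule symb_mult_0)
next
  case (Suc l)
  obtain f' where f': "has_D N f f'" "symb l N (Suc c) f'" by (rule symb_SucE[OF Suc.prems(1)])
  obtain g' where g': "has_D N g g'" "symb l N (Suc d) g'" by (rule symb_SucE[OF Suc.prems(2)])
  have 1: "symb l N (Suc (c + d)) (\<lambda>r t. f r t * g' r t)"
    using Suc.IH[OF symb_less_smooth[OF Suc.prems(1)] g'(2)] by simp
  have 2: "symb l N (Suc (c + d)) (\<lambda>r t. f' r t * g r t)"
    using Suc.IH[OF f'(2) symb_less_smooth[OF Suc.prems(2)]] by simp
  show ?case
    by (rule symb_SucI[OF symb_mult_0[OF symb_0[OF Suc.prems(1)] symb_0[OF Suc.prems(2)]]
          has_D_mult[OF f'(1) g'(1)] symb_add[OF 1 2]])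
qed

lemma has_D_const: "has_D N (\<lambda>r t. k) (\<lambda>r t. 0)"
  by (simp add: has_D_def)

lemma symb_zero: "symb l N c (\<lambda>r t. 0)"
proof (induction l arbitrary: c)
  case (Suc l)
  have "symb 0 N c (\<lambda>r t. 0)" by auto
  then show ?case using has_D_const[of N 0] Suc by (blast intro: symb_SucI)
qed auto

lemma symb_const: "symb l N 0 (\<lambda>r t. k)"
proof (cases l)
  case (Suc j)
  have "symb 0 N 0 (\<lambda>r t. k)" by (auto intro!: exI[of _ "cmod k"])
  then show ?thesis unfolding Suc using has_D_const[of N k] symb_zero by (blast intro: symb_SucI)
qed (auto intro!: exI[of _ "cmod k"])

lemma symb_cmult: "symb l N c f \<Longrightarrow> symb l N c (\<lambda>r t. k * f r t)"
  using symb_mult[OF symb_const, of l N c f k] by simp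

lemma symb_minus: "symb l N c f \<Longrightarrow> symb l N c (\<lambda>r t. - f r t)"
  using symb_cmult[of l N c f "-1"] by simp

lemma symb_diff: "symb l N c f \<Longrightarrow> symb l N c g \<Longrightarrow> symb l N c (\<lambda>r t. f r t - g r t)"
  using symb_add[OF _ symb_minus, of l N c f g] by simp

text \<open>The derivative of \<open>1 / f\<close> involves \<open>1 / f\<close> only to the order already treated, so the claim
  follows by induction on the smoothness.\<close>

lemma symb_inverse:
  assumes \<delta>: "\<delta> > 0" and low: "\<And>r t. r > 0 \<Longrightarrow> t \<in> zone N r \<Longrightarrow> \<delta> \<le> cmod (f r t)"
  shows "symb l N 0 f \<Longrightarrow> symb l N 0 (\<lambda>r t. inverse (f r t))"
proof (induction l)
  case 0
  have "cmod (inverse (f r t)) \<le> inverse \<delta>" if "r > 0" "t \<in> zone N r" for r t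
    unfolding norm_inverse using low[OF that] \<delta> by (intro le_imp_inverse_le) auto
  then show ?case using \<delta> by (auto intro!: exI[of _ "inverse \<delta>"])
next
  case (Suc l)
  have IH: "symb l N 0 (\<lambda>r t. inverse (f r t))" by (rule Suc.IH[OF symb_less_smooth[OF Suc.prems]])
  obtain f' where f': "has_D N f f'" "symb l N (Suc 0) f'" by (rule symb_SucE[OF Suc.prems])
  have "has_D N (\<lambda>r t. inverse (f r t)) (\<lambda>r t. - (f' r t * (inverse (f r t) * inverse (f r t))))"
    unfolding has_D_def
  proof (intro allI impI ballI)
    fix r :: real and t assume rt: "r > 0" "t \<in> zone N r"
    have nz: "f r t \<noteq> 0" using low[OF rt] \<delta> by auto
    have "(f r has_vector_derivative r *\<^sub>R f' r t) (at t within zone N r)"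
      using f'(1) rt by (auto simp: has_D_def)
    then have "(f r has_derivative (\<lambda>h. h *\<^sub>R (r *\<^sub>R f' r t))) (at t within zone N r)"
      by (simp add: has_vector_derivative_def)
    from Deriv.has_derivative_inverse[OF nz this]
    show "((\<lambda>t. inverse (f r t)) has_vector_derivative r *\<^sub>R - (f' r t * (inverse (f r t) * inverse (f r t)))) (at t within zone N r)"
      unfolding has_vector_derivative_def by (rule has_derivative_eq_rhs) (simp add: fun_eq_iff)
  qed
  moreover have "symb l N (Suc 0) (\<lambda>r t. - (f' r t * (inverse (f r t) * inverse (f r t))))"
    using symb_minus[OF symb_mult[OF f'(2) symb_mult[OF IH IH]]] by simp
  moreover have "symb 0 N 0 (\<lambda>r t. inverse (f r t))" by (rule symb_0[OF IH])
  ultimately show ?case by (blast intro: symb_SucI)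
qed

end

section \<open>Bounds of the coefficient in the hyperbolic zone\<close>

context damping
begin

abbreviation g_tail :: "real \<Rightarrow> real" where "g_tail s \<equiv> 1 / \<Xi> s ^ (m + 1)"

text \<open>Applied with \<open>y = N / r\<close>, which is a lower bound of \<open>\<Theta>\<close> in the zone, the estimate bounds
  the integral of \<open>X\<^sup>m\<^sup>+\<^sup>1 r\<close> independently of \<open>r\<close>.\<close>

lemma tail_bound:
  "\<exists>C>0. \<forall>s t y. 0 \<le> s \<longrightarrow> s \<le> t \<longrightarrow> 0 < y \<longrightarrow> y \<le> \<Theta> s \<longrightarrow>
     g_tail integrable_on {s..t} \<and> integral {s..t} g_tail \<le> C / y ^ m"
proof -
  obtain C where C: "C > 0" "\<And>t. t \<ge> 0 \<Longrightarrow> integral {t..} g_tail \<le> C * (1 / \<Theta> t ^ m)"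
    using \<Xi>_tail by (auto simp: lesssim_half_def)
  have g0: "0 \<le> g_tail x" if "x \<ge> 0" for x using \<Xi>_pos[OF that] by simp
  have abs: "g_tail absolutely_integrable_on {0..}"
    by (rule nonnegative_absolutely_integrable_1[OF \<Xi>_integrable]) (use g0 in auto)
  have ii: "g_tail integrable_on S" if "S \<subseteq> {0..}" "S \<in> sets lebesgue" for S
    using set_integrable_subset[OF abs that(2,1)] by (rule set_lebesgue_integral_eq_integral)
  have "g_tail integrable_on {s..t} \<and> integral {s..t} g_tail \<le> C / y ^ m"
    if st: "0 \<le> s" "s \<le> t" and y: "0 < y" "y \<le> \<Theta> s" for s t y
  proof
    show i: "g_tail integrable_on {s..t}" by (rule ii) (use st in auto)
    have "integral {s..t} g_tail \<le> integral {s..} g_tail"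
      by (rule integral_subset_le[OF _ i ii]) (use st g0 in auto)
    also have "\<dots> \<le> C * (1 / \<Theta> s ^ m)" by (rule C(2)[OF st(1)])
    also have "\<dots> \<le> C / y ^ m"
      using C(1) y by (simp add: frac_le power_mono)
    finally show "integral {s..t} g_tail \<le> C / y ^ m" .
  qed
  then show ?thesis using C(1) by blast
qed

text \<open>On a window of length \<open>y\<close> the values of \<open>b\<close> differ by at most \<open>C / y\<close>, because
  \<open>1 / \<Xi>\<^sup>2 \<le> 1 / y\<^sup>2 + y\<^sup>m\<^sup>-\<^sup>1 / \<Xi>\<^sup>m\<^sup>+\<^sup>1\<close> controls the integral of \<open>b'\<close>, and one of them is
  \<open>O(1 / y)\<close>, because the mean value of \<open>2 b = \<mu> + \<sigma>\<close> is.\<close>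

lemma b_bound: "\<exists>C>0. \<forall>t\<ge>0. \<forall>y>0. (\<forall>s\<ge>t. y \<le> \<Theta> s) \<longrightarrow> \<bar>b t\<bar> \<le> C / y"
proof -
  obtain C5 where C5: "C5 > 0" "\<And>s t y. 0 \<le> s \<Longrightarrow> s \<le> t \<Longrightarrow> 0 < y \<Longrightarrow> y \<le> \<Theta> s \<Longrightarrow>
     g_tail integrable_on {s..t} \<and> integral {s..t} g_tail \<le> C5 / y ^ m" using tail_bound by metis
  obtain Cd where Cd: "\<And>k t. k \<in> {1..m} \<Longrightarrow> t \<ge> 0 \<Longrightarrow> \<bar>(deriv_half ^^ k) b t\<bar> \<le> Cd k * (1 / \<Xi> t ^ (k + 1))"
    using b_derivs by blast
  define C1 where "C1 = max 1 (Cd 1)"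
  have b1: "\<bar>deriv_half b t\<bar> \<le> C1 * (1 / \<Xi> t)\<^sup>2" if t: "t \<ge> 0" for t
  proof -
    have "\<bar>deriv_half b t\<bar> \<le> Cd 1 * (1 / \<Xi> t ^ 2)" using Cd[of 1 t] m t by (simp add: numeral_2_eq_2)
    also have "\<dots> \<le> C1 * (1 / \<Xi> t ^ 2)" by (intro mult_right_mono) (auto simp: C1_def)
    finally show ?thesis by (simp add: power_divide)
  qed
  have bd: "(b has_real_derivative deriv_half b t) (at t within {0..})" if t: "t \<ge> 0" for t
    using b_smooth m t by (intro deriv_half_works) (auto simp: C_half_def dest!: spec[of _ "0::nat"])
  obtain K where K: "\<And>t. t \<ge> 0 \<Longrightarrow> \<bar>integral {0..t} \<sigma>\<bar> \<le> K"
    using \<sigma>_bounded unfolding bdd_above_def by auto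
  have K0: "0 \<le> K" using K[of 0] by simp
  obtain M where M: "M > 0" "\<And>t. t \<ge> 0 \<Longrightarrow> (1 + t) * \<mu> t \<le> M" using \<mu>_decay by blast
  have "\<forall>\<^sub>F t in at_top. norm (\<Theta> t) \<le> 1 * norm t"
    using landau_o.smallD[OF \<Theta>_sublinear, of 1] by simp
  then obtain T0 where T0: "\<And>t. t \<ge> T0 \<Longrightarrow> norm (\<Theta> t) \<le> norm t" by (auto simp: eventually_at_top_linorder)
  define T where "T = max 1 T0"
  have T: "\<Theta> t \<le> t" if "t \<ge> T" for t using T0[of t] that by (auto simp: T_def)
  define C where "C = (M * T + 2 * K) / 2 + C1 * (1 + C5)"
  have "\<bar>b t\<bar> \<le> C / y" if t: "t \<ge> 0" and y: "y > 0" and \<Theta>: "\<forall>s\<ge>t. y \<le> \<Theta> s" for t y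
  proof -
    have "y \<le> \<Theta> (max t T)" using \<Theta> by simp
    also have "\<dots> \<le> max t T" by (rule T) simp
    also have "\<dots> \<le> T * (1 + t)"
    proof -
      have T1: "1 \<le> T" by (simp add: T_def)
      have "1 * t \<le> T * t" by (rule mult_right_mono[OF T1 t])
      moreover have "0 \<le> T * t" using T1 t by simp
      ultimately show ?thesis using T1 by (simp add: distrib_left)
    qed
    finally have yT: "y \<le> T * (1 + t)" .
    have y\<mu>: "y * \<mu> t \<le> M * T"
    proof -
      have "y * \<mu> t \<le> (T * (1 + t)) * \<mu> t" using yT \<mu>_pos[OF t] by (intro mult_right_mono) auto
      also have "\<dots> = T * ((1 + t) * \<mu> t)" by simp
      also have "\<dots> \<le> T * M" using M(2)[OF t] by (intro mult_left_mono) (auto simp: T_def)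
      finally show ?thesis by (simp add: mult.commute)
    qed
    define A where "A x = integral {0..x} \<mu> + integral {0..x} \<sigma>" for x
    have Ad: "(A has_real_derivative 2 * b x) (at x within {0..})" if "x \<ge> 0" for x
      unfolding A_def[abs_def] using antideriv_half[OF \<mu>_continuous that] antideriv_half[OF \<sigma>_continuous that]
      by (auto intro!: derivative_eq_intros simp: decomposition[OF that])
    (* At some time x of the window, 2 b equals its mean value. *)
    have "\<exists>x\<in>{t<..<t+y}. A (t + y) - A t = (\<lambda>h. 2 * b x * h) (t + y - t)"
    proof (rule mvt_simple)
      fix x assume "t \<le> x" "x \<le> t + y"
      then have "(A has_real_derivative 2 * b x) (at x within {t..t+y})"
        using t by (intro has_field_derivative_subset[OF Ad]) auto
      then show "(A has_derivative (\<lambda>h. 2 * b x * h)) (at x within {t..t + y})"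
        by (simp add: has_field_derivative_def)
    qed (use y in simp)
    then obtain x where x: "t < x" "x < t + y" "A (t + y) - A t = 2 * b x * y" by auto
    have "integral {0..t+y} \<mu> - integral {0..t} \<mu> \<le> M * T" "0 \<le> integral {0..t+y} \<mu> - integral {0..t} \<mu>"
    proof -
      have 1: "(\<mu> has_integral (integral {0..t+y} \<mu> - integral {0..t} \<mu>)) {t..t+y}"
        by (rule has_integral_of_derivative_half[OF antideriv_half[OF \<mu>_continuous]]) (use t y in auto)
      have 2: "((\<lambda>_. \<mu> t) has_integral (y * \<mu> t)) {t..t+y}"
        using has_integral_const_real[of "\<mu> t" t "t + y"] y by simp
      have "integral {0..t+y} \<mu> - integral {0..t} \<mu> \<le> y * \<mu> t"
        by (rule has_integral_le[OF 1 2]) (use \<mu>_antimono t in auto)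
      then show "integral {0..t+y} \<mu> - integral {0..t} \<mu> \<le> M * T" using y\<mu> by simp
      show "0 \<le> integral {0..t+y} \<mu> - integral {0..t} \<mu>"
        by (rule has_integral_nonneg[OF 1]) (use \<mu>_pos t in \<open>auto intro: less_imp_le\<close>)
    qed
    moreover have "\<bar>integral {0..t+y} \<sigma> - integral {0..t} \<sigma>\<bar> \<le> 2 * K"
      using K[of "t+y"] K[OF t] t y by linarith
    ultimately have "\<bar>2 * b x * y\<bar> \<le> M * T + 2 * K" using x(3) by (simp add: A_def)
    then have bx: "\<bar>b x\<bar> \<le> ((M * T + 2 * K) / 2) / y" using y by (simp add: abs_mult field_simps)
    have tx: "0 \<le> t" "t \<le> x" using t x by auto
    have gi: "g_tail integrable_on {t..x}" "integral {t..x} g_tail \<le> C5 / y ^ m"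
      using C5(2)[OF tx y] \<Theta> by auto
    define h where "h s = C1 * ((1 / y)\<^sup>2 + y ^ (m - 1) * g_tail s)" for s
    have b1h: "\<bar>deriv_half b s\<bar> \<le> h s" if s: "s \<in> {t..x}" for s
    proof -
      have s0: "s \<ge> 0" using s t by simp
      define z where "z = 1 / \<Xi> s"
      have z: "z > 0" using \<Xi>_pos[OF s0] by (simp add: z_def)
      have gz: "g_tail s = z ^ (m + 1)" by (simp add: z_def power_divide)
      have "z\<^sup>2 \<le> (1 / y)\<^sup>2 + y ^ (m - 1) * z ^ (m + 1)"
      proof (cases "z \<le> 1 / y")
        case True
        then have "z\<^sup>2 \<le> (1 / y)\<^sup>2" using z by (intro power_mono) auto
        moreover have "0 \<le> y ^ (m - 1) * z ^ (m + 1)" using y z by simp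
        ultimately show ?thesis by linarith
      next
        case False
        then have "1 \<le> y * z" using y by (simp add: field_simps)
        then have "1 * z\<^sup>2 \<le> (y * z) ^ (m - 1) * z\<^sup>2" by (intro mult_right_mono one_le_power) auto
        also have "\<dots> = y ^ (m - 1) * (z ^ (m - 1) * z\<^sup>2)" by (simp add: power_mult_distrib)
        also have "z ^ (m - 1) * z\<^sup>2 = z ^ (m + 1)" using m by (simp flip: power_add)
        finally show ?thesis using zero_le_power2[of "1 / y"] by linarith
      qed
      then have "C1 * z\<^sup>2 \<le> h s" unfolding h_def gz by (intro mult_left_mono) (auto simp: C1_def)
      then show ?thesis using b1[OF s0] by (simp add: z_def)
    qed
    have hI: "(h has_integral (C1 * ((x - t) * (1 / y)\<^sup>2 + y ^ (m - 1) * integral {t..x} g_tail))) {t..x}"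
      unfolding h_def[abs_def]
      using has_integral_const_real[of "(1 / y)\<^sup>2" t x] tx
      by (intro has_integral_mult_right has_integral_add integrable_integral gi) auto
    have bI: "(deriv_half b has_integral (b x - b t)) {t..x}"
      by (rule has_integral_of_derivative_half[OF bd tx])
    have "b x - b t \<le> C1 * ((x - t) * (1 / y)\<^sup>2 + y ^ (m - 1) * integral {t..x} g_tail)"
      by (rule has_integral_le[OF bI hI]) (use b1h abs_le_D1 in blast)
    moreover have "- (b x - b t) \<le> C1 * ((x - t) * (1 / y)\<^sup>2 + y ^ (m - 1) * integral {t..x} g_tail)"
      by (rule has_integral_le[OF has_integral_neg[OF bI] hI]) (use b1h abs_le_D2 in blast)
    moreover have "C1 * ((x - t) * (1 / y)\<^sup>2 + y ^ (m - 1) * integral {t..x} g_tail) \<le> C1 * (1 + C5) / y"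
    proof -
      have "(x - t) * (1 / y)\<^sup>2 \<le> y * (1 / y)\<^sup>2" using x by (intro mult_right_mono) auto
      also have "\<dots> = 1 / y" using y by (simp add: power2_eq_square)
      finally have 1: "(x - t) * (1 / y)\<^sup>2 \<le> 1 / y" .
      have "y ^ (m - 1) * integral {t..x} g_tail \<le> y ^ (m - 1) * (C5 / y ^ m)"
        using gi(2) y by (intro mult_left_mono) auto
      also have "\<dots> = C5 / y"
      proof -
        have "y ^ m = y * y ^ (m - 1)" using m by (metis power_eq_if not_one_le_zero)
        then show ?thesis using y by simp
      qed
      finally have "y ^ (m - 1) * integral {t..x} g_tail \<le> C5 / y" .
      then have "(x - t) * (1 / y)\<^sup>2 + y ^ (m - 1) * integral {t..x} g_tail \<le> (1 + C5) / y"
        using 1 by (simp add: add_divide_distrib)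
      then have "C1 * ((x - t) * (1 / y)\<^sup>2 + y ^ (m - 1) * integral {t..x} g_tail) \<le> C1 * ((1 + C5) / y)"
        by (intro mult_left_mono) (auto simp: C1_def)
      then show ?thesis by simp
    qed
    ultimately have "\<bar>b t\<bar> \<le> ((M * T + 2 * K) / 2) / y + C1 * (1 + C5) / y" using bx by linarith
    then show ?thesis by (simp add: C_def add_divide_distrib)
  qed
  moreover have "C > 0"
  proof -
    have "0 < C1 * (1 + C5)" using C5(1) by (simp add: C1_def)
    moreover have "0 \<le> M * T" using M(1) by (simp add: T_def)
    moreover have "0 \<le> (M * T + 2 * K) / 2" using \<open>0 \<le> M * T\<close> K0 by simp
    ultimately show ?thesis unfolding C_def by (intro add_nonneg_pos)
  qed
  ultimately show ?thesis by blast
qed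

definition B :: "real \<Rightarrow> real \<Rightarrow> complex" where "B r t = complex_of_real (b t / r)"

lemma B_small: "\<exists>N0\<ge>1. \<forall>r>0. \<forall>t\<in>zone N0 r. \<bar>b t / r\<bar> \<le> 1 / 4"
proof -
  obtain C where C: "C > 0" "\<And>t y. t \<ge> 0 \<Longrightarrow> y > 0 \<Longrightarrow> (\<forall>s\<ge>t. y \<le> \<Theta> s) \<Longrightarrow> \<bar>b t\<bar> \<le> C / y"
    using b_bound by metis
  define N where "N = max 1 (4 * C)"
  have "\<bar>b t / r\<bar> \<le> 1 / 4" if r: "r > 0" and t: "t \<in> zone N r" for r t
  proof -
    have N: "N > 0" by (simp add: N_def)
    have "\<bar>b t\<bar> \<le> C / (N / r)"
      using t r N by (intro C(2)) (auto simp: zone_def divide_le_eq mult.commute)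
    then have "\<bar>b t\<bar> / r \<le> C / N" using r N by (simp add: field_simps)
    also have "\<dots> \<le> 1 / 4" using N by (simp add: N_def field_simps)
    finally show ?thesis using r by simp
  qed
  then show ?thesis by (intro exI[of _ N]) (auto simp: N_def)
qed

text \<open>Downward induction on \<open>k\<close>: the hypothesis on the derivatives of \<open>b\<close> gives each bound, and the
  last derivative has no smoothness left.\<close>

lemma symb_deriv_b:
  assumes N: "N > 0" and k: "1 \<le> k" "k \<le> m"
  shows "symb (m - k) N (k + 1) (\<lambda>r t. complex_of_real ((deriv_half ^^ k) b t / r ^ (k + 1)))"
  using k
proof (induction "m - k" arbitrary: k)
  have base: "symb 0 N (k + 1) (\<lambda>r t. complex_of_real ((deriv_half ^^ k) b t / r ^ (k + 1)))"
    if k: "1 \<le> k" "k \<le> m" for k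
  proof -
    obtain Cd where Cd: "\<And>t. t \<ge> 0 \<Longrightarrow> \<bar>(deriv_half ^^ k) b t\<bar> \<le> Cd * (1 / \<Xi> t ^ (k + 1))"
      using b_derivs k by (metis atLeastAtMost_iff)
    have "cmod (complex_of_real ((deriv_half ^^ k) b t / r ^ (k + 1))) \<le> max 0 Cd * X r t ^ (k + 1)"
      if r: "r > 0" and t: "t \<in> zone N r" for r t
    proof -
      have t0: "t \<ge> 0" using t by (simp add: zone_def)
      have "\<bar>(deriv_half ^^ k) b t\<bar> \<le> max 0 Cd * (1 / \<Xi> t ^ (k + 1))"
        using Cd[OF t0] \<Xi>_pos[OF t0] by (meson max.cobounded2 mult_right_mono order_trans zero_le_divide_1_iff zero_le_power less_imp_le)
      then have "\<bar>(deriv_half ^^ k) b t\<bar> / r ^ (k + 1) \<le> max 0 Cd * (1 / \<Xi> t ^ (k + 1)) / r ^ (k + 1)"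
        using r by (intro divide_right_mono) auto
      also have "\<dots> = max 0 Cd * X r t ^ (k + 1)"
        unfolding X_def by (simp add: power_divide power_mult_distrib mult.commute)
      finally show ?thesis using r by (simp add: norm_divide norm_mult norm_power)
    qed
    then show ?thesis by (auto intro!: exI[of _ "max 0 Cd"] simp del: power_Suc)
  qed
  {
    case 0
    then show ?case using base[OF 0(2,3)] by simp
  next
    case (Suc l)
    have lk: "l = m - Suc k" "1 \<le> Suc k" "Suc k \<le> m" using Suc.hyps(2) by auto
    have D: "has_D N (\<lambda>r t. complex_of_real ((deriv_half ^^ k) b t / r ^ (k + 1)))
        (\<lambda>r t. complex_of_real ((deriv_half ^^ Suc k) b t / r ^ (Suc k + 1)))"
      unfolding has_D_def
    proof (intro allI impI ballI)
      fix r :: real and t assume r: "r > 0" and t: "t \<in> zone N r"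
      have t0: "t \<ge> 0" using t by (simp add: zone_def)
      have "(deriv_half ^^ k) b differentiable (at t within {0..})"
        using b_smooth lk t0 by (auto simp: C_half_def)
      then have "((deriv_half ^^ k) b has_real_derivative (deriv_half ^^ Suc k) b t) (at t within {0..})"
        using deriv_half_works[OF _ t0] by simp
      then have "((deriv_half ^^ k) b has_real_derivative (deriv_half ^^ Suc k) b t) (at t within zone N r)"
        by (rule has_field_derivative_subset) (auto simp: zone_def)
      then have "((\<lambda>t. (deriv_half ^^ k) b t / r ^ (k + 1)) has_real_derivative (deriv_half ^^ Suc k) b t / r ^ (k + 1)) (at t within zone N r)"
        by (rule DERIV_cdivide)
      from has_vector_derivative_of_real[OF this]
      have "((\<lambda>t. complex_of_real ((deriv_half ^^ k) b t / r ^ (k + 1))) has_vector_derivative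
         complex_of_real ((deriv_half ^^ Suc k) b t / r ^ (k + 1))) (at t within zone N r)" .
      moreover have "complex_of_real ((deriv_half ^^ Suc k) b t / r ^ (k + 1))
          = r *\<^sub>R complex_of_real ((deriv_half ^^ Suc k) b t / r ^ (Suc k + 1))"
        using r by (simp add: scaleR_conv_of_real)
      ultimately show "((\<lambda>t. complex_of_real ((deriv_half ^^ k) b t / r ^ (k + 1))) has_vector_derivative
         r *\<^sub>R complex_of_real ((deriv_half ^^ Suc k) b t / r ^ (Suc k + 1))) (at t within zone N r)"
        by simp
    qed
    have IH: "symb (m - Suc k) N (Suc k + 1) (\<lambda>r t. complex_of_real ((deriv_half ^^ Suc k) b t / r ^ (Suc k + 1)))"
      using Suc.hyps(1)[OF lk] by blast
    have "symb (Suc (m - Suc k)) N (k + 1) (\<lambda>r t. complex_of_real ((deriv_half ^^ k) b t / r ^ (k + 1)))"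
      by (rule symb_SucI[OF base[OF Suc.prems] D]) (use IH in \<open>simp only: Suc_eq_plus1\<close>)
    then show ?case using lk Suc.hyps(2) by (metis)
  }
qed

end

section \<open>Approximate solutions of the Riccati equation\<close>

context damping
begin

lemma symb_B:
  assumes N0: "N \<ge> 1" "\<And>r t. r > 0 \<Longrightarrow> t \<in> zone N r \<Longrightarrow> \<bar>b t / r\<bar> \<le> 1 / 4"
  obtains DB where "has_D N B DB" "symb (m - 1) N 2 DB" "symb m N 0 B"
proof -
  let ?DB = "\<lambda>r t. complex_of_real ((deriv_half ^^ 1) b t / r ^ (1 + 1))"
  have DB: "symb (m - 1) N 2 ?DB"
    using symb_deriv_b[of N 1] N0(1) m by (simp add: numeral_2_eq_2)
  have D: "has_D N B ?DB"
    unfolding has_D_def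
  proof (intro allI impI ballI)
    fix r :: real and t assume r: "r > 0" and t: "t \<in> zone N r"
    have t0: "t \<ge> 0" using t by (simp add: zone_def)
    have "b differentiable (at t within {0..})"
      using b_smooth m t0 by (auto simp: C_half_def dest!: spec[of _ "0::nat"])
    then have "(b has_real_derivative deriv_half b t) (at t within {0..})"
      by (rule deriv_half_works[OF _ t0])
    then have "(b has_real_derivative deriv_half b t) (at t within zone N r)"
      by (rule has_field_derivative_subset) (auto simp: zone_def)
    then have "((\<lambda>t. b t / r) has_real_derivative deriv_half b t / r) (at t within zone N r)"
      by (rule DERIV_cdivide)
    from has_vector_derivative_of_real[OF this]
    have "(B r has_vector_derivative complex_of_real (deriv_half b t / r)) (at t within zone N r)"
      unfolding B_def[abs_def] .
    moreover have "complex_of_real (deriv_half b t / r) = r *\<^sub>R ?DB r t"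
      using r by (simp add: scaleR_conv_of_real)
    ultimately show "(B r has_vector_derivative r *\<^sub>R ?DB r t) (at t within zone N r)" by simp
  qed
  have B0: "symb 0 N 0 B"
    using N0(2) by (auto simp: B_def norm_divide norm_mult intro!: exI[of _ "1/4"])
  have "symb (Suc (m - 1)) N 0 B"
  proof (rule symb_SucI[OF B0 D])
    show "symb (m - 1) N (Suc 0) ?DB"
      by (rule symb_less_decay'[OF _ DB]) (use N0(1) in auto)
  qed
  then have "symb m N 0 B" using m by simp
  then show ?thesis using that D DB by blast
qed

text \<open>With \<open>B\<close> frozen, \<open>W\<close> is the frequency of the damped oscillation. Keeping the square root,
  rather than expanding it in powers of \<open>B\<close>, leaves in all residuals only terms that contain a
  derivative of \<open>b\<close>. The integrals of powers of \<open>b\<close> itself are not under control.\<close>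

definition W :: "real \<Rightarrow> real \<Rightarrow> complex" where "W r t = complex_of_real (sqrt (1 - (b t / r)\<^sup>2))"

lemma W_bounds:
  assumes "\<bar>b t / r\<bar> \<le> 1 / 4"
  shows "7 / 8 \<le> sqrt (1 - (b t / r)\<^sup>2)" "sqrt (1 - (b t / r)\<^sup>2) \<le> 1" "15 / 16 \<le> 1 - (b t / r)\<^sup>2"
proof -
  have "(b t / r)\<^sup>2 \<le> (1 / 4)\<^sup>2" using assms by (metis abs_ge_zero power2_abs power_mono)
  then show 1: "15 / 16 \<le> 1 - (b t / r)\<^sup>2" by (simp add: power2_eq_square)
  have "(7 / 8 :: real)\<^sup>2 \<le> 15 / 16" by (simp add: power2_eq_square)
  then have "(7 / 8)\<^sup>2 \<le> 1 - (b t / r)\<^sup>2" using 1 by linarith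
  then show "7 / 8 \<le> sqrt (1 - (b t / r)\<^sup>2)" by (rule real_le_rsqrt)
  show "sqrt (1 - (b t / r)\<^sup>2) \<le> 1" by simp
qed

text \<open>The derivative \<open>- B B' / W\<close> contains a derivative of \<open>B\<close>, so it decays to order 2 although \<open>W\<close>
  itself does not decay.\<close>

lemma symb_W:
  assumes N0: "N \<ge> 1" "\<And>r t. r > 0 \<Longrightarrow> t \<in> zone N r \<Longrightarrow> \<bar>b t / r\<bar> \<le> 1 / 4"
  obtains DW where "has_D N W DW" "symb (m - 1) N 2 DW" "symb m N 0 W"
proof -
  obtain DB where DB: "has_D N B DB" "symb (m - 1) N 2 DB" "symb m N 0 B" by (rule symb_B[OF N0])
  define DW where "DW r t = - (DB r t * (B r t * inverse (W r t)))" for r t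
  have D: "has_D N W DW"
    unfolding has_D_def
  proof (intro allI impI ballI)
    fix r :: real and t assume r: "r > 0" and t: "t \<in> zone N r"
    have w: "15 / 16 \<le> 1 - (b t / r)\<^sup>2" by (rule W_bounds(3)[OF N0(2)[OF r t]])
    have "(B r has_vector_derivative r *\<^sub>R DB r t) (at t within zone N r)"
      using DB(1) r t by (simp add: has_D_def)
    note Bd = this
    have "((\<lambda>t. Re (B r t)) has_real_derivative Re (r *\<^sub>R DB r t)) (at t within zone N r)"
      unfolding has_real_derivative_iff_has_vector_derivative
      by (rule bounded_linear.has_vector_derivative[OF bounded_linear_Re Bd])
    then have bd: "((\<lambda>t. b t / r) has_real_derivative r * Re (DB r t)) (at t within zone N r)"
      by (simp add: B_def)
    have im: "Im (DB r t) = 0"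
    proof -
      have 1: "((\<lambda>t. Im (B r t)) has_vector_derivative Im (r *\<^sub>R DB r t)) (at t within zone N r)"
        by (rule bounded_linear.has_vector_derivative[OF bounded_linear_Im Bd])
      have 2: "((\<lambda>t. Im (B r t)) has_vector_derivative 0) (at t within zone N r)"
        by (simp add: B_def)
      have nb: "at t within zone N r \<noteq> bot"
      proof -
        have "t \<in> {t..t+1}" by simp
        then have "at t within {t..t+1} \<noteq> bot"
          by (simp add: trivial_limit_within islimpt_Icc)
        moreover have "{t..t+1} \<subseteq> zone N r" using zone_upward[OF t] by auto
        ultimately show ?thesis by (metis at_le bot.extremum_uniqueI)
      qed
      have "Im (r *\<^sub>R DB r t) = 0" by (rule vector_derivative_unique_within[OF nb 1 2])
      then show ?thesis using r by simp
    qed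
    have q: "((\<lambda>t. 1 - (b t / r)\<^sup>2) has_real_derivative - (2 * (b t / r) * (r * Re (DB r t)))) (at t within zone N r)"
      by (rule DERIV_cong[OF DERIV_diff[OF DERIV_const[of 1] DERIV_power[OF bd, of 2]]]) simp
    have "((\<lambda>t. sqrt (1 - (b t / r)\<^sup>2)) has_real_derivative
        (inverse (sqrt (1 - (b t / r)\<^sup>2)) / 2) * (- (2 * (b t / r) * (r * Re (DB r t))))) (at t within zone N r)"
      by (rule DERIV_chain2[OF DERIV_real_sqrt q]) (use w in simp)
    then have "((\<lambda>t. sqrt (1 - (b t / r)\<^sup>2)) has_real_derivative
        (- (2 * (b t / r) * (r * Re (DB r t)))) * (inverse (sqrt (1 - (b t / r)\<^sup>2)) / 2)) (at t within zone N r)"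
      by (simp only: mult.commute)
    from has_vector_derivative_of_real[OF this]
    have "(W r has_vector_derivative complex_of_real ((- (2 * (b t / r) * (r * Re (DB r t)))) * (inverse (sqrt (1 - (b t / r)\<^sup>2)) / 2))) (at t within zone N r)"
      unfolding W_def[abs_def] .
    moreover have "complex_of_real ((- (2 * (b t / r) * (r * Re (DB r t)))) * (inverse (sqrt (1 - (b t / r)\<^sup>2)) / 2)) = r *\<^sub>R DW r t"
    proof -
      have "DB r t = complex_of_real (Re (DB r t))" using im by (simp add: complex_eq_iff)
      then have "DW r t = - (complex_of_real (Re (DB r t)) * (B r t * inverse (W r t)))" by (simp add: DW_def)
      then show ?thesis by (simp add: B_def W_def scaleR_conv_of_real)
    qed
    ultimately show "(W r has_vector_derivative r *\<^sub>R DW r t) (at t within zone N r)" by simp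
  qed
  have Wlow: "7 / 8 \<le> cmod (W r t)" and Wup: "cmod (W r t) \<le> 1" if "r > 0" "t \<in> zone N r" for r t
    using W_bounds(1,2)[OF N0(2)[OF that]] unfolding W_def norm_of_real by linarith+
  have W0: "symb 0 N 0 W" using Wup by (auto intro!: exI[of _ 1])
  have DWs: "symb l N 2 DW" if W: "symb l N 0 W" and l: "l \<le> m - 1" for l
  proof -
    have "symb l N 0 (\<lambda>r t. inverse (W r t))" by (rule symb_inverse[OF _ Wlow W]) auto
    moreover have "symb l N 0 B" by (rule symb_less_smooth'[OF DB(3)]) (use l in simp)
    ultimately have "symb l N (0 + 0) (\<lambda>r t. B r t * inverse (W r t))" by (rule symb_mult[rotated])
    moreover have "symb l N 2 DB" by (rule symb_less_smooth'[OF DB(2) l])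
    ultimately have "symb l N (2 + (0 + 0)) (\<lambda>r t. DB r t * (B r t * inverse (W r t)))" by (rule symb_mult[rotated])
    from symb_minus[OF this] show ?thesis unfolding DW_def[abs_def] by simp
  qed
  have "symb l N 0 W" if "l \<le> m" for l
    using that
  proof (induction l)
    case (Suc l)
    then have "symb l N 2 DW" by (intro DWs) auto
    then have "symb l N (Suc 0) DW" by (rule symb_less_decay'[rotated]) (use N0(1) in auto)
    then show ?case by (rule symb_SucI[OF W0 D])
  qed (rule W0)
  then show ?thesis using that D DWs[of "m - 1"] by simp
qed

lemma has_D_cong:
  assumes "has_D N f g" "\<And>r t. r > 0 \<Longrightarrow> t \<in> zone N r \<Longrightarrow> g r t = h r t"
  shows "has_D N f h"
  using assms by (simp add: has_D_def)

definition P0 :: "real \<Rightarrow> real \<Rightarrow> complex" where "P0 r t = - B r t + \<i> * W r t"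

text \<open>The exponent \<open>p = r P\<close> of a WKB solution satisfies a Riccati equation. With
  \<open>P0\<close>, the root of the characteristic polynomial with frozen coefficients, the residual is the
  derivative of \<open>P0\<close>. A Newton step in the algebraic part replaces the residual \<open>\<rho>\<close> by
  \<open>\<eta>\<^sup>2 - \<eta>'\<close> with \<open>\<eta> = \<rho> / (2 (P + B))\<close>; it costs one derivative of \<open>b\<close> and gains one factor
  \<open>X\<close>.\<close>

lemma riccati_approximation:
  assumes "k < m"
  shows "\<exists>N\<ge>1. \<exists>P \<rho>. symb (m - k) N 0 P \<and> symb (m - k - 1) N (k + 2) \<rho> \<and>
    has_D N P (\<lambda>r t. \<rho> r t - (P r t)\<^sup>2 - 2 * B r t * P r t - 1) \<and> symb 0 N 1 (\<lambda>r t. P r t - P0 r t) \<and>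
    (\<forall>r>0. \<forall>t\<in>zone N r. \<bar>b t / r\<bar> \<le> 1 / 4 \<and> cmod (P r t - P0 r t) \<le> 1 / 8)"
  using assms
proof (induction k)
  case 0
  obtain N where N: "N \<ge> 1" "\<And>r t. r > 0 \<Longrightarrow> t \<in> zone N r \<Longrightarrow> \<bar>b t / r\<bar> \<le> 1 / 4"
    using B_small by blast
  obtain DB where DB: "has_D N B DB" "symb (m - 1) N 2 DB" "symb m N 0 B" by (rule symb_B[OF N])
  obtain DW where DW: "has_D N W DW" "symb (m - 1) N 2 DW" "symb m N 0 W" by (rule symb_W[OF N])
  define \<rho> where "\<rho> r t = (-1) * DB r t + \<i> * DW r t" for r t
  have P: "P0 = (\<lambda>r t. (-1) * B r t + \<i> * W r t)" by (simp add: P0_def[abs_def])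
  have 1: "symb (m - 0) N 0 P0"
    unfolding P using symb_add[OF symb_cmult[OF DB(3), of "-1"] symb_cmult[OF DW(3), of \<i>]] by simp
  have "symb (m - 1) N 2 \<rho>"
    unfolding \<rho>_def[abs_def] using symb_add[OF symb_cmult[OF DB(2), of "-1"] symb_cmult[OF DW(2), of \<i>]] .
  then have 2: "symb (m - 0 - 1) N (0 + 2) \<rho>" by (simp only: add_0 diff_zero)
  have D0: "has_D N P0 \<rho>"
    unfolding P \<rho>_def[abs_def]
    using has_D_add[OF has_D_mult[OF has_D_const[of N "-1"] DB(1)] has_D_mult[OF has_D_const[of N \<i>] DW(1)]]
    by simp
  have 3: "has_D N P0 (\<lambda>r t. \<rho> r t - (P0 r t)\<^sup>2 - 2 * B r t * P0 r t - 1)"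
  proof (rule has_D_cong[OF D0])
    fix r t assume that: "r > 0" "t \<in> zone N r"
    have "0 \<le> 1 - (b t / r)\<^sup>2" using W_bounds(3)[OF N(2)[OF that]] by simp
    then have "(W r t)\<^sup>2 = 1 - (B r t)\<^sup>2"
      unfolding W_def B_def of_real_power[symmetric] by (simp add: real_sqrt_pow2)
    then show "\<rho> r t = \<rho> r t - (P0 r t)\<^sup>2 - 2 * B r t * P0 r t - 1"
      by (simp add: P0_def power2_eq_square algebra_simps)
  qed
  have 4: "symb 0 N 1 (\<lambda>r t. P0 r t - P0 r t)" using symb_zero[of 0 N 1] by simp
  have 5: "\<forall>r>0. \<forall>t\<in>zone N r. \<bar>b t / r\<bar> \<le> 1 / 4 \<and> cmod (P0 r t - P0 r t) \<le> 1 / 8" using N(2) by simp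
  show ?case using N(1) 1 2 3 4 5 by blast
next
  case (Suc k)
  have "k < m" using Suc.prems by simp
  from Suc.IH[OF this] obtain N P \<rho> where N: "N \<ge> 1" and P: "symb (m - k) N 0 P" and \<rho>: "symb (m - k - 1) N (k + 2) \<rho>"
    and D: "has_D N P (\<lambda>r t. \<rho> r t - (P r t)\<^sup>2 - 2 * B r t * P r t - 1)"
    and PP0: "symb 0 N 1 (\<lambda>r t. P r t - P0 r t)"
    and small: "\<And>r t. r > 0 \<Longrightarrow> t \<in> zone N r \<Longrightarrow> \<bar>b t / r\<bar> \<le> 1 / 4 \<and> cmod (P r t - P0 r t) \<le> 1 / 8"
    by blast
  have Npos: "N > 0" using N by simp
  define l where "l = m - Suc k - 1"
  have l: "m - k - 1 = Suc l" "m - k = Suc (Suc l)" "m - Suc k = Suc l" using Suc.prems by (auto simp: l_def)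
  obtain DB where DB: "has_D N B DB" "symb (m - 1) N 2 DB" "symb m N 0 B" by (rule symb_B[OF N]) (use small in auto)
  have low: "1 / 2 \<le> cmod (P r t + B r t)" if "r > 0" "t \<in> zone N r" for r t
  proof -
    have "7 / 8 \<le> cmod (\<i> * W r t)" using W_bounds(1)[of t r] small[OF that] by (simp add: W_def norm_mult)
    also have "\<i> * W r t = (P r t + B r t) - (P r t - P0 r t)" by (simp add: P0_def)
    also have "cmod \<dots> \<le> cmod (P r t + B r t) + cmod (P r t - P0 r t)" by (rule norm_triangle_ineq4)
    finally show ?thesis using small[OF that] by linarith
  qed
  have "symb (Suc l) N 0 (\<lambda>r t. P r t + B r t)"
    by (intro symb_add symb_less_smooth'[OF P] symb_less_smooth'[OF DB(3)]) (use l in auto)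
  from symb_inverse[OF _ low this]
  have inv: "symb (Suc l) N 0 (\<lambda>r t. inverse (P r t + B r t))" by simp
  define \<eta> where "\<eta> r t = (1/2) * (\<rho> r t * inverse (P r t + B r t))" for r t
  have \<rho>': "symb (Suc l) N (k + 2) \<rho>" using \<rho> unfolding l(1) .
  have \<eta>: "symb (Suc l) N (k + 2) \<eta>"
    unfolding \<eta>_def[abs_def] using symb_cmult[OF symb_mult[OF \<rho>' inv], of "1/2"] by simp
  obtain D\<eta> where D\<eta>: "has_D N \<eta> D\<eta>" "symb l N (Suc (k + 2)) D\<eta>" by (rule symb_SucE[OF \<eta>])
  define P' where "P' r t = P r t + (-1) * \<eta> r t" for r t
  define \<rho>' where "\<rho>' r t = \<eta> r t * \<eta> r t - D\<eta> r t" for r t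
  have 1: "symb (Suc l) N 0 P'"
    unfolding P'_def[abs_def]
    by (intro symb_add symb_cmult symb_less_smooth'[OF P] symb_less_decay'[OF Npos \<eta>]) (use l in auto)
  have 2: "symb l N (Suc k + 2) \<rho>'"
  proof -
    have "symb l N ((k + 2) + (k + 2)) (\<lambda>r t. \<eta> r t * \<eta> r t)"
      by (intro symb_mult symb_less_smooth[OF \<eta>])
    then have "symb l N (Suc k + 2) (\<lambda>r t. \<eta> r t * \<eta> r t)" by (rule symb_less_decay'[OF Npos]) simp
    moreover have "symb l N (Suc k + 2) D\<eta>" using D\<eta>(2) by simp
    ultimately show ?thesis unfolding \<rho>'_def[abs_def] by (rule symb_diff)
  qed
  have 3: "has_D N P' (\<lambda>r t. \<rho>' r t - (P' r t)\<^sup>2 - 2 * B r t * P' r t - 1)"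
  proof -
    have D': "has_D N P' (\<lambda>r t. (\<rho> r t - (P r t)\<^sup>2 - 2 * B r t * P r t - 1) + ((-1) * D\<eta> r t + 0 * \<eta> r t))"
      unfolding P'_def[abs_def] by (intro has_D_add D has_D_mult has_D_const D\<eta>)
    show ?thesis
    proof (rule has_D_cong[OF D'])
      fix r t assume that: "r > 0" "t \<in> zone N r"
      define q where "q = P r t + B r t"
      have "q \<noteq> 0" using low[OF that] by (auto simp: q_def)
      then have "\<rho> r t = 2 * q * \<eta> r t" by (simp add: \<eta>_def q_def[symmetric])
      then have "\<rho> r t = 2 * (P r t + B r t) * \<eta> r t" by (simp only: q_def)
      then show "(\<rho> r t - (P r t)\<^sup>2 - 2 * B r t * P r t - 1) + ((-1) * D\<eta> r t + 0 * \<eta> r t)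
        = \<rho>' r t - (P' r t)\<^sup>2 - 2 * B r t * P' r t - 1"
        by (simp add: \<rho>'_def P'_def power2_eq_square algebra_simps)
    qed
  qed
  have 4: "symb 0 N 1 (\<lambda>r t. P' r t - P0 r t)"
  proof -
    have "symb 0 N 1 (\<lambda>r t. (P r t - P0 r t) + (-1) * \<eta> r t)"
      by (intro symb_add PP0 symb_cmult symb_less_decay'[OF Npos symb_0[OF \<eta>]]) simp
    moreover have "(\<lambda>r t. (P r t - P0 r t) + (-1) * \<eta> r t) = (\<lambda>r t. P' r t - P0 r t)" by (simp add: P'_def fun_eq_iff)
    ultimately show ?thesis by (simp only:)
  qed
  obtain C where C: "C \<ge> 0" "\<And>r t. r > 0 \<Longrightarrow> t \<in> zone N r \<Longrightarrow> cmod (P' r t - P0 r t) \<le> C * X r t ^ 1"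
    using 4 by auto
  obtain c where c: "c > 0" "\<And>N r t. N > 0 \<Longrightarrow> r > 0 \<Longrightarrow> t \<in> zone N r \<Longrightarrow> X r t \<le> c / N" using X_bound by blast
  (* A larger N restores the smallness of the total correction, which later steps and the bounds
     of the imaginary part of P rely on. *)
  define N' where "N' = max N (8 * C * c)"
  have N': "N \<le> N'" "N' > 0" "8 * C * c \<le> N'" using Npos by (auto simp: N'_def)
  have 5: "\<bar>b t / r\<bar> \<le> 1 / 4 \<and> cmod (P' r t - P0 r t) \<le> 1 / 8" if rt: "r > 0" "t \<in> zone N' r" for r t
  proof -
    have t: "t \<in> zone N r" using rt(2) zone_mono[OF N'(1)] by blast
    have "cmod (P' r t - P0 r t) \<le> C * X r t" using C(2)[OF rt(1) t] by simp
    also have "\<dots> \<le> C * (c / N')" by (intro mult_left_mono c(2) rt N' C)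
    also have "\<dots> \<le> 1 / 8" using N' by (simp add: divide_le_eq mult_ac)
    finally show ?thesis using small[OF rt(1) t] by simp
  qed
  have "N' \<ge> 1" using N N' by simp
  moreover have "symb (m - Suc k) N' 0 P'" using symb_zone[OF N'(1) 1] l by simp
  moreover have "symb (m - Suc k - 1) N' (Suc k + 2) \<rho>'" using symb_zone[OF N'(1) 2] l by simp
  moreover note has_D_zone[OF N'(1) 3] symb_zone[OF N'(1) 4]
  ultimately show ?case using 5 by blast
qed

end

section \<open>Energy in the hyperbolic zone\<close>

context damping
begin

text \<open>For an approximate solution \<open>p\<close> of the Riccati equation, \<open>v' - p v\<close> and \<open>v' - cnj p v\<close>
  nearly diagonalise the equation. The imaginary part of the Riccati equation says that
  \<open>Re p + b\<close> is the logarithmic derivative of \<open>(Im p)\<^sup>-\<^sup>1\<^sup>/\<^sup>2\<close> up to the residual, so that no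
  bound of the integral of \<open>Re p + b\<close> is needed.\<close>

lemma hyperbolic_zone:
  "\<exists>N\<ge>1. \<exists>C\<ge>1. \<forall>r>0. \<forall>v v' s t. oscillator b r v v' \<longrightarrow> s \<in> zone N r \<longrightarrow> s \<le> t \<longrightarrow>
     energy r v v' t \<le> C * energy r v v' s \<and> energy r v v' s \<le> C * energy r v v' t"
proof -
  obtain S where S: "S \<ge> 1" "\<And>t. t \<ge> 0 \<Longrightarrow> eta t \<le> S" "\<And>t. t \<ge> 0 \<Longrightarrow> 1 / S \<le> eta t"
    using eta_bounds by blast
  have S': "1 / eta t \<le> S" if "t \<ge> 0" for t
    using S(3)[OF that] S(1) eta_pos[of t] by (simp add: field_simps)
  obtain C5 where C5: "C5 > 0" "\<And>s t y. 0 \<le> s \<Longrightarrow> s \<le> t \<Longrightarrow> 0 < y \<Longrightarrow> y \<le> \<Theta> s \<Longrightarrow>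
     g_tail integrable_on {s..t} \<and> integral {s..t} g_tail \<le> C5 / y ^ m" using tail_bound by metis
  have "m - 1 < m" using m by simp
  then obtain N P \<rho> where N: "N \<ge> 1" and \<rho>: "symb (m - (m - 1) - 1) N (m - 1 + 2) \<rho>"
    and D: "has_D N P (\<lambda>r t. \<rho> r t - (P r t)\<^sup>2 - 2 * B r t * P r t - 1)"
    and small: "\<And>r t. r > 0 \<Longrightarrow> t \<in> zone N r \<Longrightarrow> \<bar>b t / r\<bar> \<le> 1 / 4 \<and> cmod (P r t - P0 r t) \<le> 1 / 8"
    using riccati_approximation[of "m - 1"] by blast
  have "m - (m - 1) - 1 = 0" "m - 1 + 2 = m + 1" using m by auto
  then obtain C\<rho> where C\<rho>: "C\<rho> \<ge> 0" "\<And>r t. r > 0 \<Longrightarrow> t \<in> zone N r \<Longrightarrow> cmod (\<rho> r t) \<le> C\<rho> * X r t ^ (m + 1)"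
    using \<rho> by auto
  have Pb: "1 / 2 \<le> Im (P r t)" "cmod (P r t) \<le> 2" if rt: "r > 0" "t \<in> zone N r" for r t
  proof -
    note w = W_bounds[OF conjunct1[OF small[OF rt]]]
    have "\<bar>Im (P r t - P0 r t)\<bar> \<le> 1 / 8" using small[OF rt] abs_Im_le_cmod[of "P r t - P0 r t"] by linarith
    moreover have "Im (P0 r t) = sqrt (1 - (b t / r)\<^sup>2)" by (simp add: P0_def B_def W_def)
    ultimately show "1 / 2 \<le> Im (P r t)" using w(1) unfolding minus_complex.sel by linarith
    have "cmod (P0 r t) \<le> cmod (- B r t) + cmod (\<i> * W r t)" unfolding P0_def by (rule norm_triangle_ineq)
    also have "\<dots> \<le> 1 / 4 + 1" using small[OF rt] w
      by (intro add_mono) (auto simp: B_def W_def norm_mult norm_divide)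
    finally show "cmod (P r t) \<le> 2"
      using small[OF rt] norm_triangle_sub[of "P r t" "P0 r t"] by linarith
  qed
  define K where "K = 6 * C\<rho> * C5"
  define C where "C = 40 * S * exp K * (32 * S)"
  have "energy r v v' t \<le> C * energy r v v' s \<and> energy r v v' s \<le> C * energy r v v' t"
    if r: "r > 0" and v: "oscillator b r v v'" and s: "s \<in> zone N r" and st: "s \<le> t" for r v v' s t
  proof -
    have sub: "{s..t} \<subseteq> zone N r" using zone_upward[OF s] by auto
    have s0: "s \<ge> 0" using s by (simp add: zone_def)
    define p where "p x = complex_of_real r * P r x" for x
    define R where "R x = complex_of_real (r\<^sup>2) * \<rho> r x" for x
    define \<beta> where "\<beta> x = Im (p x)" for x
    define a1 where "a1 x = v' x - cnj (p x) * v x" for x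
    define a2 where "a2 x = v' x - p x * v x" for x
    define Z where "Z x = (norm (a1 x))\<^sup>2 + (norm (a2 x))\<^sup>2" for x
    have pb: "r / 2 \<le> \<beta> x" "cmod (p x) \<le> 2 * r" "\<beta> x \<le> 2 * r" if x: "x \<in> {s..t}" for x
    proof -
      have xz: "x \<in> zone N r" using x sub by blast
      show 1: "r / 2 \<le> \<beta> x" using mult_left_mono[OF Pb(1)[OF r xz], of r] r by (simp add: \<beta>_def p_def)
      show 2: "cmod (p x) \<le> 2 * r" using mult_left_mono[OF Pb(2)[OF r xz], of r] r by (simp add: p_def norm_mult)
      show "\<beta> x \<le> 2 * r" using 2 abs_Im_le_cmod[of "p x"] unfolding \<beta>_def by linarith
    qed
    have pd: "(p has_vector_derivative R x - (p x)\<^sup>2 - 2 * complex_of_real (b x) * p x - complex_of_real (r\<^sup>2)) (at x within {s..t})"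
      if x: "x \<in> {s..t}" for x
    proof -
      have xz: "x \<in> zone N r" using x sub by blast
      have "(P r has_vector_derivative r *\<^sub>R (\<rho> r x - (P r x)\<^sup>2 - 2 * B r x * P r x - 1)) (at x within {s..t})"
        using D r xz unfolding has_D_def by (blast intro: has_vector_derivative_within_subset[OF _ sub])
      from bounded_linear.has_vector_derivative[OF bounded_linear_mult_right this, of "complex_of_real r"]
      show ?thesis unfolding p_def[abs_def]
        by (rule has_vector_derivative_eq_rhs)
          (use r in \<open>simp add: R_def B_def scaleR_conv_of_real power2_eq_square algebra_simps\<close>)
    qed
    have vd: "(v has_vector_derivative v' x) (at x within {s..t})"
      and v'd: "(v' has_vector_derivative - (complex_of_real (r\<^sup>2) * v x) - 2 * complex_of_real (b x) * v' x) (at x within {s..t})"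
      if x: "x \<in> {s..t}" for x
    proof -
      have "x \<ge> 0" "{s..t} \<subseteq> {0..}" using x s0 by auto
      then show "(v has_vector_derivative v' x) (at x within {s..t})"
        "(v' has_vector_derivative - (complex_of_real (r\<^sup>2) * v x) - 2 * complex_of_real (b x) * v' x) (at x within {s..t})"
        using v has_vector_derivative_within_subset[of _ _ _ "{0..}" "{s..t}"]
        unfolding oscillator_def scaleR_conv_of_real of_real_mult of_real_numeral by blast+
    qed
    have cpd: "((\<lambda>x. cnj (p x)) has_vector_derivative cnj (R x - (p x)\<^sup>2 - 2 * complex_of_real (b x) * p x - complex_of_real (r\<^sup>2))) (at x within {s..t})"
      if x: "x \<in> {s..t}" for x
      by (rule bounded_linear.has_vector_derivative[OF bounded_linear_cnj pd[OF x]])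
    have a1d: "(a1 has_vector_derivative - ((2 * complex_of_real (b x) + cnj (p x)) * a1 x) - cnj (R x) * v x) (at x within {s..t})"
      if x: "x \<in> {s..t}" for x
      unfolding a1_def[abs_def]
      by (rule has_vector_derivative_eq_rhs[OF has_vector_derivative_diff[OF v'd[OF x] has_vector_derivative_mult[OF cpd[OF x] vd[OF x]]]])
        (simp add: power2_eq_square algebra_simps)
    have a2d: "(a2 has_vector_derivative - ((2 * complex_of_real (b x) + p x) * a2 x) - R x * v x) (at x within {s..t})"
      if x: "x \<in> {s..t}" for x
      unfolding a2_def[abs_def]
      by (rule has_vector_derivative_eq_rhs[OF has_vector_derivative_diff[OF v'd[OF x] has_vector_derivative_mult[OF pd[OF x] vd[OF x]]]])
        (simp add: power2_eq_square algebra_simps)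
    have \<beta>d: "(\<beta> has_real_derivative Im (R x) - 2 * (Re (p x) + b x) * \<beta> x) (at x within {s..t})"
      if x: "x \<in> {s..t}" for x
    proof -
      have "(\<beta> has_vector_derivative Im (R x - (p x)\<^sup>2 - 2 * complex_of_real (b x) * p x - complex_of_real (r\<^sup>2))) (at x within {s..t})"
        unfolding \<beta>_def[abs_def] by (rule bounded_linear.has_vector_derivative[OF bounded_linear_Im pd[OF x]])
      moreover have "Im (R x - (p x)\<^sup>2 - 2 * complex_of_real (b x) * p x - complex_of_real (r\<^sup>2)) = Im (R x) - 2 * (Re (p x) + b x) * \<beta> x"
        by (simp add: \<beta>_def power2_eq_square algebra_simps)
      ultimately show ?thesis unfolding has_real_derivative_iff_has_vector_derivative by (simp only:)
    qed
    (* E1 collects the effect of the residual R on Z. *)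
    define E1 where "E1 x = - 2 * (a1 x \<bullet> (cnj (R x) * v x)) - 2 * (a2 x \<bullet> (R x * v x))" for x
    have inner_mult: "y \<bullet> (z * y) = Re z * (norm y)\<^sup>2" for y z :: complex
      by (simp add: inner_complex_def cmod_power2) (simp add: power2_eq_square algebra_simps)
    have Zd: "(Z has_real_derivative - 2 * (2 * b x + Re (p x)) * Z x + E1 x) (at x within {s..t})"
      if x: "x \<in> {s..t}" for x
    proof -
      have Z: "Z = (\<lambda>x. a1 x \<bullet> a1 x + a2 x \<bullet> a2 x)" by (simp add: Z_def[abs_def] power2_norm_eq_inner)
      have 1: "a1 x \<bullet> ((2 * complex_of_real (b x) + cnj (p x)) * a1 x) = (2 * b x + Re (p x)) * (norm (a1 x))\<^sup>2"
        unfolding inner_mult by simp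
      have 2: "a2 x \<bullet> ((2 * complex_of_real (b x) + p x) * a2 x) = (2 * b x + Re (p x)) * (norm (a2 x))\<^sup>2"
        unfolding inner_mult by simp
      have "(Z has_real_derivative 2 * (a1 x \<bullet> (- ((2 * complex_of_real (b x) + cnj (p x)) * a1 x) - cnj (R x) * v x))
         + 2 * (a2 x \<bullet> (- ((2 * complex_of_real (b x) + p x) * a2 x) - R x * v x))) (at x within {s..t})"
        unfolding Z
        using DERIV_add[OF inner_has_real_derivative[OF a1d[OF x] a1d[OF x]] inner_has_real_derivative[OF a2d[OF x] a2d[OF x]]]
        by (simp only: inner_commute[of _ "a1 x"] inner_commute[of _ "a2 x"] mult_2)
      then show ?thesis
        unfolding inner_diff_right inner_minus_right 1 2
        by (rule DERIV_cong) (simp add: Z_def E1_def algebra_simps)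
    qed
    have Z0: "0 \<le> Z x" for x by (simp add: Z_def)
    have vZ: "(norm (v x))\<^sup>2 \<le> Z x / (2 * (\<beta> x)\<^sup>2)" "\<bar>E1 x\<bar> \<le> 2 * cmod (R x) / \<beta> x * Z x" if x: "x \<in> {s..t}" for x
    proof -
      have b0: "0 < \<beta> x" using pb(1)[OF x] r by linarith
      define A1 A2 V where "A1 = norm (a1 x)" and "A2 = norm (a2 x)" and "V = norm (v x)"
      have n: "0 \<le> A1" "0 \<le> A2" "0 \<le> V" by (simp_all add: A1_def A2_def V_def)
      have "a1 x - a2 x = (2 * \<i> * complex_of_real (\<beta> x)) * v x"
        by (simp add: a1_def a2_def \<beta>_def complex_eq_iff algebra_simps)
      then have "2 * \<beta> x * V = norm (a1 x - a2 x)" using b0 by (simp add: norm_mult V_def)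
      also have "\<dots> \<le> A1 + A2" unfolding A1_def A2_def by (rule norm_triangle_ineq4)
      finally have V: "2 * \<beta> x * V \<le> A1 + A2" .
      have sq: "(A1 + A2)\<^sup>2 \<le> 2 * Z x" using sum_squares_ge_zero[of "A1 - A2" 0]
        by (simp add: Z_def A1_def A2_def power2_eq_square algebra_simps)
      have "(2 * \<beta> x * V)\<^sup>2 \<le> (A1 + A2)\<^sup>2" using V n b0 by (intro power_mono) auto
      moreover have "(2 * \<beta> x * V)\<^sup>2 = 4 * (\<beta> x)\<^sup>2 * V\<^sup>2" by (simp add: power_mult_distrib)
      ultimately have "4 * (\<beta> x)\<^sup>2 * V\<^sup>2 \<le> 2 * Z x" using sq by linarith
      then show "(norm (v x))\<^sup>2 \<le> Z x / (2 * (\<beta> x)\<^sup>2)" using b0 by (simp add: V_def field_simps)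
      have "\<bar>a1 x \<bullet> (cnj (R x) * v x)\<bar> \<le> A1 * (cmod (R x) * V)" "\<bar>a2 x \<bullet> (R x * v x)\<bar> \<le> A2 * (cmod (R x) * V)"
        using Cauchy_Schwarz_ineq2[of "a1 x" "cnj (R x) * v x"] Cauchy_Schwarz_ineq2[of "a2 x" "R x * v x"]
        by (simp_all add: norm_mult A1_def A2_def V_def)
      then have "\<bar>E1 x\<bar> \<le> 2 * (A1 * (cmod (R x) * V)) + 2 * (A2 * (cmod (R x) * V))"
        unfolding E1_def by linarith
      also have "\<dots> = (cmod (R x) / \<beta> x * (A1 + A2)) * (2 * \<beta> x * V)" using b0 by (simp add: field_simps)
      also have "\<dots> \<le> (cmod (R x) / \<beta> x * (A1 + A2)) * (A1 + A2)"
        using V n b0 by (intro mult_left_mono) auto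
      also have "\<dots> = cmod (R x) / \<beta> x * (A1 + A2)\<^sup>2" by (simp add: power2_eq_square)
      also have "\<dots> \<le> cmod (R x) / \<beta> x * (2 * Z x)" using sq b0 by (intro mult_left_mono) auto
      finally show "\<bar>E1 x\<bar> \<le> 2 * cmod (R x) / \<beta> x * Z x" by (simp add: mult_ac)
    qed
    (* lam2 eta compensates the damping 2 b, and 1 / beta the change of the amplitude. *)
    define G where "G x = lam2 x * eta x * Z x / \<beta> x" for x
    define k where "k x = 6 * C\<rho> / r ^ m * g_tail x" for x
    have Gd: "(G has_real_derivative lam2 x * eta x / \<beta> x * (E1 x - Z x * Im (R x) / \<beta> x)) (at x within {s..t})"
      if x: "x \<in> {s..t}" for x
    proof -
      have x0: "x \<ge> 0" and sub0: "{s..t} \<subseteq> {0..}" using x s0 by auto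
      have b0: "0 < \<beta> x" using pb(1)[OF x] r by linarith
      have l: "(lam2 has_real_derivative lam2 x * \<mu> x) (at x within {s..t})"
        by (rule has_field_derivative_subset[OF lam2_deriv[OF x0] sub0])
      have e: "(eta has_real_derivative eta x * \<sigma> x) (at x within {s..t})"
        by (rule has_field_derivative_subset[OF eta_deriv[OF x0] sub0])
      have \<mu>: "\<mu> x = 2 * b x - \<sigma> x" using decomposition[OF x0] by simp
      have "(G has_real_derivative
        (((lam2 x * \<mu> x * eta x + eta x * \<sigma> x * lam2 x) * Z x + (- 2 * (2 * b x + Re (p x)) * Z x + E1 x) * (lam2 x * eta x)) * \<beta> x
          - (lam2 x * eta x * Z x) * (Im (R x) - 2 * (Re (p x) + b x) * \<beta> x)) / (\<beta> x * \<beta> x)) (at x within {s..t})"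
        unfolding G_def[abs_def]
        by (rule DERIV_divide[OF DERIV_mult[OF DERIV_mult[OF l e] Zd[OF x]] \<beta>d[OF x]]) (use b0 in simp)
      moreover have "(((lam2 x * \<mu> x * eta x + eta x * \<sigma> x * lam2 x) * Z x + (- 2 * (2 * b x + Re (p x)) * Z x + E1 x) * (lam2 x * eta x)) * \<beta> x
          - (lam2 x * eta x * Z x) * (Im (R x) - 2 * (Re (p x) + b x) * \<beta> x)) / (\<beta> x * \<beta> x)
         = lam2 x * eta x / \<beta> x * (E1 x - Z x * Im (R x) / \<beta> x)"
        unfolding \<mu> using b0 by (simp add: field_simps)
      ultimately show ?thesis by simp
    qed
    have le0: "0 < lam2 x * eta x" for x using lam2_pos[of x] eta_pos[of x] by simp
    have Gb: "\<bar>lam2 x * eta x / \<beta> x * (E1 x - Z x * Im (R x) / \<beta> x)\<bar> \<le> k x * G x" if x: "x \<in> {s..t}" for x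
    proof -
      have xz: "x \<in> zone N r" using x sub by blast
      have b0: "0 < \<beta> x" using pb(1)[OF x] r by linarith
      have "\<bar>Z x * Im (R x) / \<beta> x\<bar> \<le> cmod (R x) / \<beta> x * Z x"
        using abs_Im_le_cmod[of "R x"] b0 Z0[of x]
        by (simp add: abs_mult divide_right_mono mult.commute mult_left_mono)
      from order_trans[OF abs_triangle_ineq4 add_mono[OF vZ(2)[OF x] this]]
      have "\<bar>E1 x - Z x * Im (R x) / \<beta> x\<bar> \<le> 2 * cmod (R x) / \<beta> x * Z x + cmod (R x) / \<beta> x * Z x" .
      also have "\<dots> = 3 * (cmod (R x) / \<beta> x) * Z x" using b0 by (simp add: field_simps)
      also have "\<dots> \<le> k x * Z x"
      proof (rule mult_right_mono[OF _ Z0])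
        have h: "cmod (R x) \<le> r\<^sup>2 * (C\<rho> * X r x ^ (m + 1))"
          unfolding R_def norm_mult using C\<rho>(2)[OF r xz] by (simp add: mult_left_mono norm_power)
        have "cmod (R x) / \<beta> x \<le> r\<^sup>2 * (C\<rho> * X r x ^ (m + 1)) / (r / 2)"
          by (rule frac_le[OF order_trans[OF norm_ge_zero h] h _ pb(1)[OF x]]) (use r in simp)
        also have "\<dots> = 2 * C\<rho> * (r * X r x ^ (m + 1))" using r by (simp add: power2_eq_square)
        also have "r * X r x ^ (m + 1) = 1 / r ^ m * g_tail x"
          using r unfolding X_def by (simp add: power_divide power_mult_distrib)
        finally show "3 * (cmod (R x) / \<beta> x) \<le> k x" unfolding k_def by simp
      qed
      finally have "\<bar>E1 x - Z x * Im (R x) / \<beta> x\<bar> \<le> k x * Z x" .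
      then have "lam2 x * eta x / \<beta> x * \<bar>E1 x - Z x * Im (R x) / \<beta> x\<bar> \<le> lam2 x * eta x / \<beta> x * (k x * Z x)"
        using le0[of x] b0 by (intro mult_left_mono) auto
      moreover have "\<bar>lam2 x * eta x / \<beta> x\<bar> = lam2 x * eta x / \<beta> x" using le0[of x] b0 by simp
      ultimately show ?thesis by (simp only: abs_mult[of "lam2 x * eta x / \<beta> x"] G_def) (simp add: mult_ac)
    qed
    have G0: "0 \<le> G x" if x: "x \<in> {s..t}" for x
      unfolding G_def using less_imp_le[OF lam2_pos[of x]] less_imp_le[OF eta_pos[of x]] Z0[of x] pb(1)[OF x] r
      by (intro divide_nonneg_nonneg mult_nonneg_nonneg) auto
    have k0: "0 \<le> k x" if x: "x \<in> {s..t}" for x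
      using \<Xi>_pos[of x] x s0 C\<rho>(1) r by (simp add: k_def)
    have N\<Theta>: "N / r \<le> \<Theta> s" using s r by (auto simp: zone_def divide_le_eq mult.commute)
    note gt = C5(2)[OF s0 st _ N\<Theta>]
    have Nr: "0 < N / r" using N r by simp
    have ki: "k integrable_on {s..t}" "integral {s..t} k \<le> K"
    proof -
      show "k integrable_on {s..t}" unfolding k_def[abs_def]
        by (rule integrable_on_mult_right) (use gt Nr in blast)
      have "integral {s..t} k = 6 * C\<rho> / r ^ m * integral {s..t} g_tail"
        unfolding k_def[abs_def] by (rule integral_mult_right)
      also have "\<dots> \<le> 6 * C\<rho> / r ^ m * (C5 / (N / r) ^ m)"
        using gt Nr C\<rho>(1) r by (intro mult_left_mono) auto
      also have "\<dots> = K / N ^ m" using r by (simp add: K_def power_divide)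
      also have "\<dots> \<le> K / 1" using N C\<rho>(1) C5(1) by (intro divide_left_mono) (auto simp: K_def)
      finally show "integral {s..t} k \<le> K" by simp
    qed
    note gr = gronwall_two_sided[OF st Gd Gb G0 k0 ki]
    have ev: "energy r v v' x \<le> (40 * r * S) * G x" "G x \<le> (32 * S / r) * energy r v v' x" if x: "x \<in> {s..t}" for x
    proof -
      have x0: "x \<ge> 0" using x s0 by simp
      have b0: "0 < \<beta> x" using pb(1)[OF x] r by linarith
      define V V' where "V = norm (v x)" and "V' = norm (v' x)"
      have n: "0 \<le> V" "0 \<le> V'" by (simp_all add: V_def V'_def)
      have pV: "cmod (p x) * V \<le> 2 * r * V" using pb(2)[OF x] n by (intro mult_right_mono) auto
      have a: "norm (a1 x) \<le> V' + 2 * r * V" "norm (a2 x) \<le> V' + 2 * r * V"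
        using norm_triangle_ineq4[of "v' x" "cnj (p x) * v x"] norm_triangle_ineq4[of "v' x" "p x * v x"] pV
        by (simp_all add: a1_def a2_def norm_mult V_def V'_def)
      have sq: "(V' + 2 * r * V)\<^sup>2 \<le> 8 * (r\<^sup>2 * V\<^sup>2 + V'\<^sup>2)"
      proof -
        have "(V' + 2 * r * V)\<^sup>2 \<le> 2 * V'\<^sup>2 + 2 * (2 * r * V)\<^sup>2"
          using sum_squares_ge_zero[of "V' - 2 * r * V" 0] by (simp add: power2_eq_square algebra_simps)
        also have "\<dots> = 8 * (r\<^sup>2 * V\<^sup>2 + V'\<^sup>2) - 6 * V'\<^sup>2" by (simp add: power_mult_distrib)
        also have "\<dots> \<le> 8 * (r\<^sup>2 * V\<^sup>2 + V'\<^sup>2)" by simp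
        finally show ?thesis .
      qed
      have "(norm (a1 x))\<^sup>2 \<le> (V' + 2 * r * V)\<^sup>2" "(norm (a2 x))\<^sup>2 \<le> (V' + 2 * r * V)\<^sup>2"
        using a by (auto intro!: power_mono)
      then have Zup: "Z x \<le> 16 * (r\<^sup>2 * V\<^sup>2 + V'\<^sup>2)" unfolding Z_def using sq by linarith
      have rV: "r\<^sup>2 * V\<^sup>2 \<le> 2 * Z x"
      proof -
        have "V\<^sup>2 \<le> Z x / (2 * (\<beta> x)\<^sup>2)" using vZ(1)[OF x] by (simp add: V_def)
        also have "\<dots> \<le> Z x / (2 * (r / 2)\<^sup>2)"
          using pb(1)[OF x] r Z0[of x] b0 by (intro divide_left_mono mult_left_mono power_mono) auto
        also have "\<dots> = 2 * Z x / r\<^sup>2" using r by (simp add: power_divide)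
        finally show ?thesis using r by (simp add: field_simps)
      qed
      have "V' \<le> norm (a2 x) + 2 * r * V"
        using norm_triangle_sub[of "v' x" "p x * v x"] pV by (simp add: a2_def norm_mult V_def V'_def)
      then have "V'\<^sup>2 \<le> (norm (a2 x) + 2 * r * V)\<^sup>2" using n by (intro power_mono) auto
      also have "\<dots> \<le> 2 * (norm (a2 x))\<^sup>2 + 2 * (2 * r * V)\<^sup>2"
        using sum_squares_ge_zero[of "norm (a2 x) - 2 * r * V" 0] by (simp add: power2_eq_square algebra_simps)
      also have "\<dots> = 2 * (norm (a2 x))\<^sup>2 + 8 * (r\<^sup>2 * V\<^sup>2)" by (simp add: power_mult_distrib)
      also have "\<dots> \<le> 2 * (norm (a2 x))\<^sup>2 + 8 * (2 * Z x)"
        using rV by (intro add_mono mult_left_mono) auto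
      also have "\<dots> \<le> 18 * Z x" by (simp add: Z_def)
      finally have Elow: "r\<^sup>2 * V\<^sup>2 + V'\<^sup>2 \<le> 20 * Z x" using rV by linarith
      have "energy r v v' x = lam2 x * (r\<^sup>2 * V\<^sup>2 + V'\<^sup>2)" by (simp add: energy_def V_def V'_def)
      also have "\<dots> \<le> lam2 x * (20 * Z x)" using Elow lam2_pos[of x] by (intro mult_left_mono) auto
      also have "\<dots> = 20 * (\<beta> x * (1 / eta x)) * G x"
        using b0 eta_pos[of x] by (simp add: G_def)
      also have "\<dots> \<le> 20 * ((2 * r) * S) * G x"
        using pb(3)[OF x] S'[OF x0] b0 eta_pos[of x] r G0[OF x] by (intro mult_right_mono mult_left_mono mult_mono) auto
      finally show "energy r v v' x \<le> (40 * r * S) * G x" by simp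
      have "G x = (lam2 x * Z x) * (eta x * (1 / \<beta> x))" by (simp add: G_def)
      also have "\<dots> \<le> (lam2 x * (16 * (r\<^sup>2 * V\<^sup>2 + V'\<^sup>2))) * (S * (1 / (r / 2)))"
      proof (rule mult_mono)
        show "lam2 x * Z x \<le> lam2 x * (16 * (r\<^sup>2 * V\<^sup>2 + V'\<^sup>2))" using Zup lam2_pos[of x] by (intro mult_left_mono) auto
        have "1 / \<beta> x \<le> 1 / (r / 2)" using pb(1)[OF x] r by (intro divide_left_mono) auto
        then show "eta x * (1 / \<beta> x) \<le> S * (1 / (r / 2))" using S(2)[OF x0] S(1) b0 by (intro mult_mono) auto
      qed (use lam2_pos[of x] eta_pos[of x] b0 in auto)
      also have "\<dots> = (32 * S / r) * energy r v v' x" by (simp add: energy_def V_def V'_def)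
      finally show "G x \<le> (32 * S / r) * energy r v v' x" .
    qed
    have chain: "energy r v v' x \<le> C * energy r v v' y" if x: "x \<in> {s..t}" and y: "y \<in> {s..t}" and G: "G x \<le> exp K * G y" for x y
    proof -
      have "energy r v v' x \<le> (40 * r * S) * G x" by (rule ev(1)[OF x])
      also have "\<dots> \<le> (40 * r * S) * (exp K * ((32 * S / r) * energy r v v' y))"
      proof (rule mult_left_mono)
        have "exp K * G y \<le> exp K * ((32 * S / r) * energy r v v' y)" using ev(2)[OF y] by (intro mult_left_mono) auto
        then show "G x \<le> exp K * ((32 * S / r) * energy r v v' y)" using G by linarith
      qed (use r S(1) in auto)
      also have "\<dots> = C * energy r v v' y" using r by (simp add: C_def)
      finally show ?thesis .
    qed
    show ?thesis using chain[of t s] chain[of s t] gr st by auto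
  qed
  moreover have "1 \<le> C"
  proof -
    have "0 \<le> K" using C\<rho>(1) C5(1) by (simp add: K_def)
    then have "1 * 1 * 1 \<le> (40 * S) * exp K * (32 * S)" using S(1) by (intro mult_mono) auto
    then show ?thesis by (simp add: C_def)
  qed
  ultimately show ?thesis using N by blast
qed

end

section \<open>Uniform energy estimates\<close>

context damping
begin

lemma energy_continuous: "oscillator b r v v' \<Longrightarrow> continuous_on {0..} (energy r v v')"
  by (rule deriv_continuous_half[OF energy_deriv])

text \<open>Before the hyperbolic zone is entered, some later value of \<open>\<Theta>\<close> is below \<open>N / r\<close>, and
  the stabilisation condition at that time bounds \<open>r\<close> times the integral of \<open>\<bar>\<eta> - \<omega>\<bar>\<close>. The
  two zones meet at a single time, which is handled by continuity of the energy.\<close>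

lemma energy_comparable:
  assumes k0: "k0 > 0"
  shows "\<exists>C\<ge>1. \<forall>r>0. \<forall>v v' s t. oscillator b r v v' \<longrightarrow> k0 \<le> r * s \<longrightarrow> s \<le> t \<longrightarrow>
     energy r v v' t \<le> C * energy r v v' s \<and> energy r v v' s \<le> C * energy r v v' t"
proof -
  obtain N C1 where N: "N \<ge> 1" and C1: "C1 \<ge> 1"
    and hyp: "\<And>r v v' s t. r > 0 \<Longrightarrow> oscillator b r v v' \<Longrightarrow> s \<in> zone N r \<Longrightarrow> s \<le> t \<Longrightarrow>
     energy r v v' t \<le> C1 * energy r v v' s \<and> energy r v v' s \<le> C1 * energy r v v' t"
    using hyperbolic_zone by blast
  obtain Cs where Cs: "Cs > 0" "\<And>t. t \<ge> 0 \<Longrightarrow> integral {0..t} (\<lambda>\<theta>. \<bar>eta \<theta> - \<omega>\<bar>) \<le> Cs * \<Theta> t"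
    using stabilisation by (auto simp: lesssim_half_def eta_def)
  define K where "K = Cs * N"
  have K0: "K \<ge> 0" using Cs N by (simp add: K_def)
  obtain C2 where C2: "C2 \<ge> 1"
    and stab: "\<And>r v v' s t. r > 0 \<Longrightarrow> oscillator b r v v' \<Longrightarrow> k0 \<le> r * s \<Longrightarrow> s \<le> t \<Longrightarrow>
     r * integral {0..t} (\<lambda>\<theta>. \<bar>eta \<theta> - \<omega>\<bar>) \<le> K \<Longrightarrow>
     energy r v v' t \<le> C2 * energy r v v' s \<and> energy r v v' s \<le> C2 * energy r v v' t"
    using stabilised_zone[OF k0 K0] by blast
  have ec: "continuous_on {0..} (\<lambda>x. \<bar>eta x - \<omega>\<bar>)" by (intro continuous_intros eta_continuous)
  have ei: "(\<lambda>x. \<bar>eta x - \<omega>\<bar>) integrable_on {0..t}" for t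
    by (intro integrable_continuous_real continuous_on_subset[OF ec]) auto
  have outside: "r * integral {0..t} (\<lambda>\<theta>. \<bar>eta \<theta> - \<omega>\<bar>) \<le> K" if r: "r > 0" and t: "t \<ge> 0" "t \<notin> zone N r" for r t
  proof -
    obtain s where s: "s \<ge> t" "r * \<Theta> s < N" using t by (auto simp: zone_def not_le)
    have "integral {0..t} (\<lambda>\<theta>. \<bar>eta \<theta> - \<omega>\<bar>) \<le> integral {0..s} (\<lambda>\<theta>. \<bar>eta \<theta> - \<omega>\<bar>)"
      by (rule integral_subset_le) (use s ei in auto)
    also have "\<dots> \<le> Cs * \<Theta> s" using Cs(2)[of s] s t by simp
    finally have "r * integral {0..t} (\<lambda>\<theta>. \<bar>eta \<theta> - \<omega>\<bar>) \<le> r * (Cs * \<Theta> s)"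
      using r by (intro mult_left_mono) auto
    also have "\<dots> = Cs * (r * \<Theta> s)" by simp
    also have "\<dots> \<le> K" unfolding K_def using s Cs by (intro mult_left_mono) auto
    finally show ?thesis .
  qed
  have "energy r v v' t \<le> (C1 * C2) * energy r v v' s \<and> energy r v v' s \<le> (C1 * C2) * energy r v v' t"
    if r: "r > 0" and v: "oscillator b r v v'" and s: "k0 \<le> r * s" and st: "s \<le> t" for r v v' s t
  proof -
    let ?f = "energy r v v'"
    have s0: "s > 0" using s r k0 by (smt (verit) mult_nonneg_nonpos)
    have up1: "?f x \<le> (C1 * C2) * ?f y" if "?f x \<le> C1 * ?f y" for x y
    proof -
      have "C1 * ?f y \<le> (C1 * C2) * ?f y"
        using C1 C2 energy_nonneg[of r v v' y] mult_left_mono[of 1 C2 C1] by (intro mult_right_mono) auto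
      then show ?thesis using that by linarith
    qed
    have up2: "?f x \<le> (C1 * C2) * ?f y" if "?f x \<le> C2 * ?f y" for x y
    proof -
      have "C2 * ?f y \<le> (C1 * C2) * ?f y"
        using C1 C2 energy_nonneg[of r v v' y] mult_right_mono[of 1 C1 C2] by (intro mult_right_mono) auto
      then show ?thesis using that by linarith
    qed
    consider "s \<in> zone N r" | "s \<notin> zone N r" "t \<notin> zone N r" | "s \<notin> zone N r" "t \<in> zone N r" by blast
    then show ?thesis
    proof cases
      case 1
      then show ?thesis using hyp[OF r v 1 st] up1 by blast
    next
      case 2
      then show ?thesis using stab[OF r v s st outside[OF r]] up2 s0 st by auto
    next
      case 3
      define \<tau> where "\<tau> = Inf (zone N r)"
      have bdd: "bdd_below (zone N r)" by (rule bdd_belowI[of _ 0]) (simp add: zone_def)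
      have below: "x \<notin> zone N r" if "x < \<tau>" for x
        using cInf_lower[OF _ bdd, of x] that by (auto simp: \<tau>_def)
      have above: "x \<in> zone N r" if x: "x > \<tau>" for x
      proof -
        have "zone N r \<noteq> {}" using 3(2) by blast
        from cInf_lessD[OF this x[unfolded \<tau>_def]] obtain y where "y \<in> zone N r" "y < x" by blast
        then show ?thesis using zone_upward[of y N r x] by simp
      qed
      have s\<tau>: "s \<le> \<tau>" using above[of s] 3(1) by linarith
      have \<tau>t: "\<tau> \<le> t" using below[of t] 3(2) by linarith
      have \<tau>0: "\<tau> > 0" using s\<tau> s0 by linarith
      have stab\<tau>: "r * integral {0..\<tau>} (\<lambda>\<theta>. \<bar>eta \<theta> - \<omega>\<bar>) \<le> K"
      proof (rule tendsto_upperbound)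
        have "((\<lambda>t. integral {0..t} (\<lambda>\<theta>. \<bar>eta \<theta> - \<omega>\<bar>)) has_real_derivative \<bar>eta \<tau> - \<omega>\<bar>) (at \<tau> within {0..})"
          by (rule antideriv_half[OF ec]) (use \<tau>0 in simp)
        then have "continuous (at \<tau> within {0..}) (\<lambda>t. integral {0..t} (\<lambda>\<theta>. \<bar>eta \<theta> - \<omega>\<bar>))"
          by (rule DERIV_continuous)
        then have "((\<lambda>t. integral {0..t} (\<lambda>\<theta>. \<bar>eta \<theta> - \<omega>\<bar>)) \<longlongrightarrow> integral {0..\<tau>} (\<lambda>\<theta>. \<bar>eta \<theta> - \<omega>\<bar>)) (at \<tau>)"
          using \<tau>0 at_within_interior[of \<tau> "{0..}"] by (simp add: continuous_within)
        then have "((\<lambda>t. integral {0..t} (\<lambda>\<theta>. \<bar>eta \<theta> - \<omega>\<bar>)) \<longlongrightarrow> integral {0..\<tau>} (\<lambda>\<theta>. \<bar>eta \<theta> - \<omega>\<bar>)) (at_left \<tau>)"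
          by (rule tendsto_mono[OF at_le, rotated]) auto
        then show "((\<lambda>t. r * integral {0..t} (\<lambda>\<theta>. \<bar>eta \<theta> - \<omega>\<bar>)) \<longlongrightarrow> r * integral {0..\<tau>} (\<lambda>\<theta>. \<bar>eta \<theta> - \<omega>\<bar>)) (at_left \<tau>)"
          by (intro tendsto_intros)
        show "\<forall>\<^sub>F x in at_left \<tau>. r * integral {0..x} (\<lambda>\<theta>. \<bar>eta \<theta> - \<omega>\<bar>) \<le> K"
          using eventually_at_left_real[OF \<tau>0] by (elim eventually_mono) (auto intro!: outside r below)
      qed simp
      have 1: "?f \<tau> \<le> C2 * ?f s \<and> ?f s \<le> C2 * ?f \<tau>" by (rule stab[OF r v s s\<tau> stab\<tau>])
      have 2: "?f t \<le> C1 * ?f \<tau> \<and> ?f \<tau> \<le> C1 * ?f t"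
      proof (cases "\<tau> = t")
        case True
        then show ?thesis using C1 energy_nonneg[of r v v' t] mult_right_mono[of 1 C1 "?f t"] by simp
      next
        case False
        then have lt: "\<tau> < t" using \<tau>t by simp
        have "continuous (at \<tau> within {0..}) ?f"
          using energy_continuous[OF v] \<tau>0 by (simp add: continuous_on_eq_continuous_within)
        then have "(?f \<longlongrightarrow> ?f \<tau>) (at \<tau>)"
          using \<tau>0 at_within_interior[of \<tau> "{0..}"] by (simp add: continuous_within)
        then have lim: "(?f \<longlongrightarrow> ?f \<tau>) (at_right \<tau>)"
          by (rule tendsto_mono[OF at_le, rotated]) auto
        have ev: "\<forall>\<^sub>F x in at_right \<tau>. ?f t \<le> C1 * ?f x \<and> ?f x \<le> C1 * ?f t"
          using eventually_at_right_real[OF lt] by (elim eventually_mono) (use hyp[OF r v above] in auto)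
        have "?f t \<le> C1 * ?f \<tau>"
          by (rule tendsto_lowerbound[OF tendsto_mult[OF tendsto_const lim]])
            (use ev in \<open>auto elim: eventually_mono\<close>)
        moreover have "?f \<tau> \<le> C1 * ?f t"
          by (rule tendsto_upperbound[OF lim]) (use ev in \<open>auto elim: eventually_mono\<close>)
        ultimately show ?thesis by blast
      qed
      have "?f t \<le> C1 * (C2 * ?f s)" "?f s \<le> C2 * (C1 * ?f t)"
        using C1 C2 order_trans[OF conjunct1[OF 2] mult_left_mono[OF conjunct1[OF 1]]]
          order_trans[OF conjunct2[OF 1] mult_left_mono[OF conjunct2[OF 2]]] by auto
      then show ?thesis by (simp add: mult_ac)
    qed
  qed
  moreover have "1 \<le> C1 * C2" using C1 C2 mult_mono[of 1 C1 1 C2] by simp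
  ultimately show ?thesis by blast
qed

text \<open>The time \<open>k0 / r\<close> separates the early times, where the data enter with the weight
  \<open>1 + r\<^sup>2\<close>, from the times at which energies are comparable. For \<open>r > 1\<close> the early times lie in a
  fixed compact interval.\<close>

theorem energy_upper_bound:
  "\<exists>C>0. \<forall>r>0. \<forall>v v' t. oscillator b r v v' \<longrightarrow> 0 \<le> t \<longrightarrow>
     energy r v v' t \<le> C * ((1 + r\<^sup>2) * (norm (v 0))\<^sup>2 + (norm (v' 0))\<^sup>2)"
proof -
  obtain k0 C1 where k0: "k0 > 0" and C1: "C1 \<ge> 1"
    and low: "\<And>r v v' t. 0 < r \<Longrightarrow> r \<le> 1 \<Longrightarrow> oscillator b r v v' \<Longrightarrow> 0 \<le> t \<Longrightarrow> r * t \<le> k0 \<Longrightarrow>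
     energy r v v' t \<le> C1 * ((norm (v 0))\<^sup>2 + (norm (v' 0))\<^sup>2)"
    using low_frequency_zone by blast
  obtain C2 where C2: "C2 \<ge> 1"
    and high: "\<And>r v v' s t. r > 0 \<Longrightarrow> oscillator b r v v' \<Longrightarrow> k0 \<le> r * s \<Longrightarrow> s \<le> t \<Longrightarrow>
     energy r v v' t \<le> C2 * energy r v v' s \<and> energy r v v' s \<le> C2 * energy r v v' t"
    using energy_comparable[OF k0] by blast
  obtain C3 where C3: "C3 \<ge> 1"
    and comp: "\<And>r v v' s t. oscillator b r v v' \<Longrightarrow> 0 \<le> s \<Longrightarrow> s \<le> t \<Longrightarrow> t \<le> k0 \<Longrightarrow>
    energy r v v' t \<le> C3 * energy r v v' s \<and> energy r v v' s \<le> C3 * energy r v v' t"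
    using energy_compact[of k0] k0 by auto
  define C where "C = C2 * (C1 + C3)"
  have "energy r v v' t \<le> C * ((1 + r\<^sup>2) * (norm (v 0))\<^sup>2 + (norm (v' 0))\<^sup>2)"
    if r: "r > 0" and v: "oscillator b r v v'" and t: "0 \<le> t" for r v v' t
  proof -
    define d where "d = (1 + r\<^sup>2) * (norm (v 0))\<^sup>2 + (norm (v' 0))\<^sup>2"
    have d0: "0 \<le> d" by (simp add: d_def)
    have d1: "(norm (v 0))\<^sup>2 + (norm (v' 0))\<^sup>2 \<le> d" "energy r v v' 0 \<le> d"
      by (simp_all add: d_def energy_def lam2_0 distrib_right)
    have near: "energy r v v' x \<le> (C1 + C3) * d" if x: "0 \<le> x" "r * x \<le> k0" for x
    proof (cases "r \<le> 1")
      case True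
      have "energy r v v' x \<le> C1 * ((norm (v 0))\<^sup>2 + (norm (v' 0))\<^sup>2)" by (rule low[OF r True v x])
      also have "\<dots> \<le> C1 * d" using d1 C1 by (intro mult_left_mono) auto
      also have "\<dots> \<le> (C1 + C3) * d" using C3 d0 by (intro mult_right_mono) auto
      finally show ?thesis .
    next
      case False
      have "x \<le> r * x" using False x mult_right_mono[of 1 r x] by simp
      then have "energy r v v' x \<le> C3 * energy r v v' 0" using comp[OF v, of 0 x] x by simp
      also have "\<dots> \<le> C3 * d" using d1 C3 by (intro mult_left_mono) auto
      also have "\<dots> \<le> (C1 + C3) * d" using C1 d0 by (intro mult_right_mono) auto
      finally show ?thesis .
    qed
    have big: "(C1 + C3) * d \<le> C * d"
      unfolding C_def using C1 C2 C3 d0 mult_right_mono[of 1 C2 "C1 + C3"] by (intro mult_right_mono) auto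
    show "energy r v v' t \<le> C * d"
    proof (cases "r * t \<le> k0")
      case True
      then show ?thesis using near[OF t True] big by linarith
    next
      case False
      define s where "s = k0 / r"
      have s: "r * s = k0" "0 \<le> s" "s \<le> t" using r k0 False by (auto simp: s_def divide_le_eq mult.commute)
      have "energy r v v' t \<le> C2 * energy r v v' s" using high[OF r v _ s(3)] s(1) by simp
      also have "\<dots> \<le> C2 * ((C1 + C3) * d)" using near[OF s(2)] s(1) C2 by (intro mult_left_mono) auto
      finally show ?thesis by (simp add: C_def)
    qed
  qed
  moreover have "C > 0" using C1 C2 C3 by (simp add: C_def)
  ultimately show ?thesis by blast
qed

text \<open>For \<open>r \<ge> \<epsilon>\<close> the early times lie in the compact interval up to \<open>1 / \<epsilon>\<close>, on which energies are
  comparable as well.\<close>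

theorem energy_lower_bound:
  assumes \<epsilon>: "\<epsilon> > 0"
  shows "\<exists>C>0. \<forall>r\<ge>\<epsilon>. \<forall>v v' t. oscillator b r v v' \<longrightarrow> 0 \<le> t \<longrightarrow> energy r v v' 0 \<le> C * energy r v v' t"
proof -
  obtain C2 where C2: "C2 \<ge> 1"
    and high: "\<And>r v v' s t. r > 0 \<Longrightarrow> oscillator b r v v' \<Longrightarrow> 1 \<le> r * s \<Longrightarrow> s \<le> t \<Longrightarrow>
     energy r v v' t \<le> C2 * energy r v v' s \<and> energy r v v' s \<le> C2 * energy r v v' t"
    using energy_comparable[of 1] by auto
  define T where "T = 1 / \<epsilon>"
  have T0: "T \<ge> 0" using \<epsilon> by (simp add: T_def)
  obtain C3 where C3: "C3 \<ge> 1"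
    and comp: "\<And>r v v' s t. oscillator b r v v' \<Longrightarrow> 0 \<le> s \<Longrightarrow> s \<le> t \<Longrightarrow> t \<le> T \<Longrightarrow>
    energy r v v' t \<le> C3 * energy r v v' s \<and> energy r v v' s \<le> C3 * energy r v v' t"
    using energy_compact[OF T0] by auto
  have "energy r v v' 0 \<le> (C3 * C2) * energy r v v' t"
    if r: "r \<ge> \<epsilon>" and v: "oscillator b r v v'" and t: "0 \<le> t" for r v v' t
  proof (cases "t \<le> T")
    case True
    have "energy r v v' 0 \<le> C3 * energy r v v' t" using comp[OF v _ t True] by simp
    also have "\<dots> \<le> (C3 * C2) * energy r v v' t"
      using C2 C3 energy_nonneg[of r v v' t] mult_left_mono[of 1 C2 C3] by (intro mult_right_mono) auto
    finally show ?thesis .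
  next
    case False
    have "1 \<le> r * T" using r \<epsilon> by (simp add: T_def divide_simps)
    then have 1: "energy r v v' T \<le> C2 * energy r v v' t" using high[OF _ v, of T t] r \<epsilon> False by simp
    have "energy r v v' 0 \<le> C3 * energy r v v' T" using comp[OF v _ T0] by simp
    also have "\<dots> \<le> C3 * (C2 * energy r v v' t)" using 1 C3 by (intro mult_left_mono) auto
    finally show ?thesis by simp
  qed
  moreover have "C3 * C2 > 0" using C2 C3 by simp
  ultimately show ?thesis by blast
qed

end

section \<open>From frequencies to the solution\<close>

context damping
begin

lemma cauchy_solution_fourier:
  assumes "cauchy_solution b u1 u2 u ut"
  shows "\<exists>v v'. (\<forall>t\<ge>0. fourier_transform (u t) (v t)) \<and> (\<forall>t\<ge>0. fourier_transform (ut t) (v' t)) \<and>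
    (\<forall>\<xi>. oscillator b (norm \<xi>) (\<lambda>t. v t \<xi>) (\<lambda>t. v' t \<xi>))"
proof -
  obtain v v' v'' where v: "\<And>t. t \<ge> 0 \<Longrightarrow> fourier_transform (u t) (v t)"
    "\<And>t. t \<ge> 0 \<Longrightarrow> fourier_transform (ut t) (v' t)"
    and ode: "\<And>\<xi> t. t \<ge> 0 \<Longrightarrow> ((\<lambda>s. v s \<xi>) has_vector_derivative v' t \<xi>) (at t within {0..}) \<and>
           ((\<lambda>s. v' s \<xi>) has_vector_derivative v'' t \<xi>) (at t within {0..}) \<and>
           v'' t \<xi> + (norm \<xi>)\<^sup>2 *\<^sub>R v t \<xi> + (2 * b t) *\<^sub>R v' t \<xi> = 0"
    using assms unfolding cauchy_solution_def by blast
  have osc: "oscillator b (norm \<xi>) (\<lambda>t. v t \<xi>) (\<lambda>t. v' t \<xi>)" for \<xi>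
    unfolding oscillator_def
  proof (intro allI impI conjI)
    fix t :: real assume t: "t \<ge> 0"
    show "((\<lambda>s. v s \<xi>) has_vector_derivative v' t \<xi>) (at t within {0..})" using ode[OF t] by blast
    have "v'' t \<xi> = - ((norm \<xi>)\<^sup>2 *\<^sub>R v t \<xi>) - (2 * b t) *\<^sub>R v' t \<xi>"
      using ode[OF t, of \<xi>] by (simp add: eq_neg_iff_add_eq_0 algebra_simps)
    then show "((\<lambda>s. v' s \<xi>) has_vector_derivative - ((norm \<xi>)\<^sup>2 *\<^sub>R v t \<xi>) - (2 * b t) *\<^sub>R v' t \<xi>) (at t within {0..})"
      using ode[OF t, of \<xi>] by simp
  qed
  show ?thesis
    by (rule exI[of _ v], rule exI[of _ v'], intro conjI allI impI v osc)
qed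

text \<open>The weak gradient contributes \<open>r\<^sup>2 \<bar>v\<bar>\<^sup>2\<close> and the time derivative \<open>\<bar>v'\<bar>\<^sup>2\<close>.\<close>

lemma energy_integral:
  fixes u ut :: "real \<Rightarrow> real ^ 'n::finite \<Rightarrow> complex"
  assumes sol: "cauchy_solution b u1 u2 u ut" and t: "t \<ge> 0"
    and v: "fourier_transform (u t) (v t)" and v': "fourier_transform (ut t) (v' t)"
  shows "L2 (\<lambda>\<xi>. norm \<xi> *\<^sub>R v t \<xi>)"
    and "integrable lborel (\<lambda>\<xi>. energy (norm \<xi>) (\<lambda>s. v s \<xi>) (\<lambda>s. v' s \<xi>) t)"
    and "(LINT \<xi>|lborel. energy (norm \<xi>) (\<lambda>s. v s \<xi>) (\<lambda>s. v' s \<xi>) t)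
      = lam2 t * ((L2_norm (grad (u t)))\<^sup>2 + (L2_norm (ut t))\<^sup>2)"
proof -
  have "H1 (u t)" using sol t by (simp add: cauchy_solution_def)
  then have "\<exists>G. weak_gradient (u t) G" by (simp add: H1_def)
  then have "weak_gradient (u t) (grad (u t))" unfolding grad_def by (rule someI_ex)
  note g = weak_gradient_norm[OF this v]
  show gL: "L2 (\<lambda>\<xi>. norm \<xi> *\<^sub>R v t \<xi>)" by (rule g(1))
  have v'L: "L2 (v' t)" using v' by (simp add: fourier_transform_def)
  have i: "integrable lborel (\<lambda>\<xi>. (norm (norm \<xi> *\<^sub>R v t \<xi>))\<^sup>2)" "integrable lborel (\<lambda>\<xi>. (norm (v' t \<xi>))\<^sup>2)"
    using gL v'L by (auto simp: L2_def)
  have e: "energy (norm \<xi>) (\<lambda>s. v s \<xi>) (\<lambda>s. v' s \<xi>) t = lam2 t * ((norm (norm \<xi> *\<^sub>R v t \<xi>))\<^sup>2 + (norm (v' t \<xi>))\<^sup>2)" for \<xi>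
    by (simp add: energy_def power_mult_distrib)
  show "integrable lborel (\<lambda>\<xi>. energy (norm \<xi>) (\<lambda>s. v s \<xi>) (\<lambda>s. v' s \<xi>) t)"
    unfolding e by (intro integrable_mult_right Bochner_Integration.integrable_add i)
  have "(LINT \<xi>|lborel. energy (norm \<xi>) (\<lambda>s. v s \<xi>) (\<lambda>s. v' s \<xi>) t)
     = lam2 t * ((LINT \<xi>|lborel. (norm (norm \<xi> *\<^sub>R v t \<xi>))\<^sup>2) + (LINT \<xi>|lborel. (norm (v' t \<xi>))\<^sup>2))"
    unfolding e integral_mult_right_zero using Bochner_Integration.integral_add[OF i] by (simp only:)
  also have "\<dots> = lam2 t * ((L2_norm (grad (u t)))\<^sup>2 + (L2_norm (ut t))\<^sup>2)"
    by (simp only: L2_norm_square[symmetric] g(2) Plancherel[OF v'])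
  finally show "(LINT \<xi>|lborel. energy (norm \<xi>) (\<lambda>s. v s \<xi>) (\<lambda>s. v' s \<xi>) t)
      = lam2 t * ((L2_norm (grad (u t)))\<^sup>2 + (L2_norm (ut t))\<^sup>2)" .
qed

lemma weight_pos: "0 < weight \<mu> t"
  by (simp add: weight_def)

lemma sum_le_of_squares:
  assumes "lam2 t * (x\<^sup>2 + y\<^sup>2) \<le> q" "0 \<le> x" "0 \<le> y"
  shows "weight \<mu> t * (x + y) \<le> sqrt (2 * q)"
proof (rule real_le_rsqrt)
  have "(x + y)\<^sup>2 \<le> 2 * (x\<^sup>2 + y\<^sup>2)"
    using sum_squares_ge_zero[of "x - y" 0] by (simp add: power2_eq_square algebra_simps)
  then have "lam2 t * (x + y)\<^sup>2 \<le> lam2 t * (2 * (x\<^sup>2 + y\<^sup>2))"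
    using lam2_pos[of t] by (intro mult_left_mono) auto
  also have "\<dots> = 2 * (lam2 t * (x\<^sup>2 + y\<^sup>2))" by simp
  also have "\<dots> \<le> 2 * q" using assms(1) by simp
  finally show "(weight \<mu> t * (x + y))\<^sup>2 \<le> 2 * q"
    by (simp add: power_mult_distrib weight_square)
qed

lemma sum_ge_of_squares:
  assumes "q \<le> lam2 t * (x\<^sup>2 + y\<^sup>2)" "0 \<le> x" "0 \<le> y"
  shows "sqrt q \<le> weight \<mu> t * (x + y)"
proof (rule real_le_lsqrt)
  show "0 \<le> weight \<mu> t * (x + y)" using weight_pos[of t] assms by simp
  have "x\<^sup>2 + y\<^sup>2 \<le> (x + y)\<^sup>2" using assms by (simp add: power2_sum)
  then have "lam2 t * (x\<^sup>2 + y\<^sup>2) \<le> lam2 t * (x + y)\<^sup>2"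
    using lam2_pos[of t] by (intro mult_left_mono) auto
  then show "q \<le> (weight \<mu> t * (x + y))\<^sup>2"
    using assms(1) by (simp add: power_mult_distrib weight_square)
qed

text \<open>The upper bound integrates because the data have finite norms. For the lower bound, \<open>\<epsilon>\<close> is
  chosen such that the transform of the data does not vanish almost everywhere on \<open>\<bar>\<xi>\<bar> \<ge> \<epsilon>\<close>. The
  constants are computed from one solution; they serve for all, because the transforms of the data
  agree almost everywhere.\<close>

theorem energy_two_sided:
  fixes u1 u2 :: "real ^ 'n::finite \<Rightarrow> complex"
  assumes nontrivial: "\<not> ((AE x in lborel. u1 x = 0) \<and> (AE x in lborel. u2 x = 0))"
  shows "\<exists>c>0. \<exists>C>0. \<forall>u ut. cauchy_solution b u1 u2 u ut \<longrightarrow>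
    (\<forall>t\<ge>0. c \<le> weight \<mu> t * (L2_norm (grad (u t)) + L2_norm (ut t)) \<and>
            weight \<mu> t * (L2_norm (grad (u t)) + L2_norm (ut t)) \<le> C)"
proof (cases "\<exists>u ut. cauchy_solution b u1 u2 u ut")
  case False
  then show ?thesis by (intro exI[of _ "1::real"] conjI) auto
next
  case True
  then obtain w wt where sol: "cauchy_solution b u1 u2 w wt" by blast
  obtain z z' where z: "\<And>t. t \<ge> 0 \<Longrightarrow> fourier_transform (w t) (z t)"
    and z': "\<And>t. t \<ge> 0 \<Longrightarrow> fourier_transform (wt t) (z' t)"
    using cauchy_solution_fourier[OF sol] by blast
  note zi = energy_integral[of u1 u2 w wt 0 z z', OF sol order_refl z[OF order_refl] z'[OF order_refl]]
  have zL: "L2 (z 0)" "L2 (z' 0)" using z[of 0] z'[of 0] by (auto simp: fourier_transform_def)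
  define E0 where "E0 \<xi> = (norm \<xi>)\<^sup>2 * (norm (z 0 \<xi>))\<^sup>2 + (norm (z' 0 \<xi>))\<^sup>2" for \<xi>
  define D where "D \<xi> = (1 + (norm \<xi>)\<^sup>2) * (norm (z 0 \<xi>))\<^sup>2 + (norm (z' 0 \<xi>))\<^sup>2" for \<xi>
  have E0i: "integrable lborel E0"
    using zi(2) by (simp add: energy_def lam2_0 E0_def[abs_def])
  have E00: "0 \<le> E0 \<xi>" for \<xi> by (simp add: E0_def)
  have Dsum: "D = (\<lambda>\<xi>. (norm (z 0 \<xi>))\<^sup>2 + E0 \<xi>)" by (simp add: D_def E0_def fun_eq_iff algebra_simps)
  have Di: "integrable lborel D" unfolding Dsum
    using zL(1) E0i by (intro Bochner_Integration.integrable_add) (auto simp: L2_def)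
  have "\<exists>j. 0 < (LINT \<xi>|lborel. indicator {\<xi>. 1 / real (Suc j) \<le> norm \<xi>} \<xi> * E0 \<xi>)"
  proof (rule ccontr)
    assume "\<not> ?thesis"
    then have le: "(LINT \<xi>|lborel. indicator {\<xi>. 1 / real (Suc j) \<le> norm \<xi>} \<xi> * E0 \<xi>) \<le> 0" for j
      by (simp add: not_less)
    have "AE \<xi> in lborel. indicator {\<xi>. 1 / real (Suc j) \<le> norm \<xi>} \<xi> * E0 \<xi> = 0" for j
    proof -
      have i: "integrable lborel (\<lambda>\<xi>. indicator {\<xi>. 1 / real (Suc j) \<le> norm \<xi>} \<xi> * E0 \<xi>)"
        by (rule integrable_real_mult_indicator[OF _ E0i, unfolded mult.commute[of "E0 _"]]) measurable
      have n: "AE \<xi> in lborel. 0 \<le> indicator {\<xi>. 1 / real (Suc j) \<le> norm \<xi>} \<xi> * E0 \<xi>"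
        using E00 by (intro AE_I2 mult_nonneg_nonneg) auto
      have "(LINT \<xi>|lborel. indicator {\<xi>. 1 / real (Suc j) \<le> norm \<xi>} \<xi> * E0 \<xi>) = 0"
        using le[of j] integral_nonneg_AE[OF n] by linarith
      then show ?thesis using integral_nonneg_eq_0_iff_AE[OF i n] by simp
    qed
    then have "AE \<xi> in lborel. \<forall>j. indicator {\<xi>. 1 / real (Suc j) \<le> norm \<xi>} \<xi> * E0 \<xi> = 0"
      unfolding AE_all_countable by blast
    then have "AE \<xi> in lborel. z 0 \<xi> = 0 \<and> z' 0 \<xi> = 0"
      using AE_lborel_singleton[of "0 :: real ^ 'n"]
    proof (eventually_elim)
      fix \<xi> :: "real ^ 'n"
      assume *: "\<forall>j. indicator {\<xi>. 1 / real (Suc j) \<le> norm \<xi>} \<xi> * E0 \<xi> = 0" and "\<xi> \<noteq> 0"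
      then have "0 < norm \<xi>" by simp
      then obtain j where "1 / real (Suc j) < norm \<xi>"
        using nat_approx_posE by blast
      then have "E0 \<xi> = 0" using *[rule_format, of j] by simp
      then have "(norm \<xi>)\<^sup>2 * (norm (z 0 \<xi>))\<^sup>2 = 0 \<and> (norm (z' 0 \<xi>))\<^sup>2 = 0"
        unfolding E0_def by (subst (asm) add_nonneg_eq_0_iff) auto
      then show "z 0 \<xi> = 0 \<and> z' 0 \<xi> = 0" using \<open>\<xi> \<noteq> 0\<close> by simp
    qed
    then have "L2_norm (z 0) = 0" "L2_norm (z' 0) = 0"
      using L2_norm_eq_0_iff[OF zL(1)] L2_norm_eq_0_iff[OF zL(2)] by (auto elim: AE_mp)
    then have "L2_norm (w 0) = 0" "L2_norm (wt 0) = 0"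
      using Plancherel[OF z[of 0]] Plancherel[OF z'[of 0]] by auto
    moreover have "L2 (w 0)" "L2 (wt 0)" using z[of 0] z'[of 0] by (auto simp: fourier_transform_def)
    ultimately have w0: "AE x in lborel. w 0 x = 0" and wt0: "AE x in lborel. wt 0 x = 0"
      using L2_norm_eq_0_iff by blast+
    have u1: "AE x in lborel. w 0 x = u1 x" and u2: "AE x in lborel. wt 0 x = u2 x"
      using sol by (auto simp: cauchy_solution_def)
    have "AE x in lborel. u1 x = 0" using w0 u1 by eventually_elim simp
    moreover have "AE x in lborel. u2 x = 0" using wt0 u2 by eventually_elim simp
    ultimately show False using nontrivial by blast
  qed
  then obtain j where j: "0 < (LINT \<xi>|lborel. indicator {\<xi>. 1 / real (Suc j) \<le> norm \<xi>} \<xi> * E0 \<xi>)" by blast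
  define \<epsilon> where "\<epsilon> = 1 / real (Suc j)"
  define I where "I = (LINT \<xi>|lborel. indicator {\<xi>. \<epsilon> \<le> norm \<xi>} \<xi> * E0 \<xi>)"
  have I: "0 < I" using j by (simp add: I_def \<epsilon>_def)
  have \<epsilon>: "\<epsilon> > 0" by (simp add: \<epsilon>_def)
  obtain C1 where C1: "C1 > 0"
    and upper: "\<And>r v v' t. r > 0 \<Longrightarrow> oscillator b r v v' \<Longrightarrow> 0 \<le> t \<Longrightarrow>
     energy r v v' t \<le> C1 * ((1 + r\<^sup>2) * (norm (v 0))\<^sup>2 + (norm (v' 0))\<^sup>2)"
    using energy_upper_bound by blast
  obtain C2 where C2: "C2 > 0"
    and lower: "\<And>r v v' t. r \<ge> \<epsilon> \<Longrightarrow> oscillator b r v v' \<Longrightarrow> 0 \<le> t \<Longrightarrow> energy r v v' 0 \<le> C2 * energy r v v' t"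
    using energy_lower_bound[OF \<epsilon>] by blast
  define Q where "Q = C1 * (LINT \<xi>|lborel. D \<xi>)"
  have bounds: "sqrt (I / C2) \<le> weight \<mu> t * (L2_norm (grad (u t)) + L2_norm (ut t)) \<and>
      weight \<mu> t * (L2_norm (grad (u t)) + L2_norm (ut t)) \<le> sqrt (2 * Q)"
    if s: "cauchy_solution b u1 u2 u ut" and t: "t \<ge> 0" for u ut t
  proof -
    obtain v v' where v: "\<And>t. t \<ge> 0 \<Longrightarrow> fourier_transform (u t) (v t)"
      and v': "\<And>t. t \<ge> 0 \<Longrightarrow> fourier_transform (ut t) (v' t)"
      and osc: "\<And>\<xi>. oscillator b (norm \<xi>) (\<lambda>t. v t \<xi>) (\<lambda>t. v' t \<xi>)"
      using cauchy_solution_fourier[OF s] by blast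
    let ?E = "\<lambda>\<xi>. energy (norm \<xi>) (\<lambda>s. v s \<xi>) (\<lambda>s. v' s \<xi>) t"
    note ei = energy_integral[of u1 u2 u ut t v v', OF s t v[OF t] v'[OF t]]
    have u0: "AE x in lborel. u 0 x = w 0 x" and ut0: "AE x in lborel. ut 0 x = wt 0 x"
    proof -
      have "AE x in lborel. u 0 x = u1 x" "AE x in lborel. w 0 x = u1 x"
        "AE x in lborel. ut 0 x = u2 x" "AE x in lborel. wt 0 x = u2 x"
        using s sol by (auto simp: cauchy_solution_def)
      then show "AE x in lborel. u 0 x = w 0 x" "AE x in lborel. ut 0 x = wt 0 x"
        by (eventually_elim, simp)+
    qed
    have vz: "AE \<xi> in lborel. v 0 \<xi> = z 0 \<xi>" and v'z: "AE \<xi> in lborel. v' 0 \<xi> = z' 0 \<xi>"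
      using fourier_transform_unique[OF v[of 0] z[of 0] u0] fourier_transform_unique[OF v'[of 0] z'[of 0] ut0] by auto
    have "AE \<xi> in lborel. ?E \<xi> \<le> C1 * D \<xi>"
      using vz v'z AE_lborel_singleton[of "0 :: real ^ 'n"]
    proof eventually_elim
      fix \<xi> assume "v 0 \<xi> = z 0 \<xi>" "v' 0 \<xi> = z' 0 \<xi>" "\<xi> \<noteq> 0"
      then show "?E \<xi> \<le> C1 * D \<xi>" using upper[OF _ osc t, of \<xi>] by (simp add: D_def)
    qed
    then have "(LINT \<xi>|lborel. ?E \<xi>) \<le> (LINT \<xi>|lborel. C1 * D \<xi>)"
      by (intro integral_mono_AE ei(2) integrable_mult_right Di)
    then have up: "lam2 t * ((L2_norm (grad (u t)))\<^sup>2 + (L2_norm (ut t))\<^sup>2) \<le> Q"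
      unfolding ei(3) Q_def by simp
    have "AE \<xi> in lborel. indicator {\<xi>. \<epsilon> \<le> norm \<xi>} \<xi> * E0 \<xi> \<le> C2 * ?E \<xi>"
      using vz v'z
    proof eventually_elim
      fix \<xi> assume "v 0 \<xi> = z 0 \<xi>" "v' 0 \<xi> = z' 0 \<xi>"
      then show "indicator {\<xi>. \<epsilon> \<le> norm \<xi>} \<xi> * E0 \<xi> \<le> C2 * ?E \<xi>"
        using lower[OF _ osc t, of \<xi>] C2 energy_nonneg
        by (auto simp: E0_def energy_def[of _ _ _ 0] lam2_0 indicator_def)
    qed
    then have "I \<le> (LINT \<xi>|lborel. C2 * ?E \<xi>)"
      unfolding I_def
      by (intro integral_mono_AE ei(2) integrable_mult_right
          integrable_real_mult_indicator[OF _ E0i, unfolded mult.commute[of "E0 _"]]) measurable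
    then have "I / C2 \<le> lam2 t * ((L2_norm (grad (u t)))\<^sup>2 + (L2_norm (ut t))\<^sup>2)"
      using C2 ei(3) by (simp add: divide_le_eq mult.commute)
    then show ?thesis
      using sum_ge_of_squares[OF _ L2_norm_nonneg L2_norm_nonneg] sum_le_of_squares[OF up L2_norm_nonneg L2_norm_nonneg]
      by blast
  qed
  have "0 < sqrt (I / C2)" using I C2 by simp
  moreover have "0 < sqrt (2 * Q) + 1"
  proof -
    have "0 \<le> Q" unfolding Q_def using C1 by (intro mult_nonneg_nonneg integral_nonneg_AE AE_I2) (auto simp: D_def)
    then show ?thesis by (simp add: add_nonneg_pos)
  qed
  ultimately show ?thesis
    using bounds by (intro exI[of _ "sqrt (I / C2)"] conjI exI[of _ "sqrt (2 * Q) + 1"]) force+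
qed

end

theorem theorem2:
  fixes m :: nat and b \<mu> \<sigma> \<Theta> \<Xi> :: "real \<Rightarrow> real" and \<omega> :: real
    and u1 u2 :: "real ^ 'n::finite \<Rightarrow> complex"
  assumes m: "m \<ge> 1"
    and b_smooth: "C_half m b"
    and decomposition: "\<And>t. t \<ge> 0 \<Longrightarrow> 2 * b t = \<mu> t + \<sigma> t"
    and \<omega>_pos: "\<omega> > 0"
    and \<Theta>_pos: "\<And>t. t \<ge> 0 \<Longrightarrow> \<Theta> t > 0"
    and \<Xi>_pos: "\<And>t. t \<ge> 0 \<Longrightarrow> \<Xi> t > 0"
    and \<mu>_pos: "\<And>t. t \<ge> 0 \<Longrightarrow> \<mu> t > 0"
    and \<mu>_differentiable: "\<And>t. t \<ge> 0 \<Longrightarrow> \<mu> differentiable (at t within {0..})"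
    and \<mu>_decreasing: "\<And>t. t \<ge> 0 \<Longrightarrow> deriv_half \<mu> t < 0"
    and \<mu>_limsup: "Limsup at_top (\<lambda>t. ereal (t * \<mu> t)) < 1"
    and \<sigma>_bounded: "bdd_above ((\<lambda>t. \<bar>integral {0..t} \<sigma>\<bar>) ` {0..})"
    and stabilisation:
      "lesssim_half (\<lambda>t. integral {0..t} (\<lambda>\<theta>. \<bar>exp (integral {0..\<theta>} \<sigma>) - \<omega>\<bar>)) \<Theta>"
    and \<Theta>_sublinear: "\<Theta> \<in> o[at_top](\<lambda>t. t)"
    and \<Theta>_normalised: "\<Theta> 0 = \<mu> 0"
    and b_derivs: "\<exists>C. \<forall>k\<in>{1..m}. \<forall>t\<ge>0. \<bar>(deriv_half ^^ k) b t\<bar> \<le> C k * (1 / \<Xi> t ^ (k + 1))"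
    and \<Xi>_ge: "lesssim_half \<Theta> \<Xi>"
    and \<Xi>_integrable: "(\<lambda>s. 1 / \<Xi> s ^ (m + 1)) integrable_on {0..}"
    and \<Xi>_tail:
      "lesssim_half (\<lambda>t. integral {t..} (\<lambda>s. 1 / \<Xi> s ^ (m + 1))) (\<lambda>t. 1 / \<Theta> t ^ m)"
    and u1: "H1 u1"
    and u2: "L2 u2"
    and nontrivial: "\<not> ((AE x in lborel. u1 x = 0) \<and> (AE x in lborel. u2 x = 0))"
  shows "\<exists>c>0. \<exists>C>0. \<forall>u ut. cauchy_solution b u1 u2 u ut \<longrightarrow>
    (\<forall>t\<ge>0. c \<le> weight \<mu> t * (L2_norm (grad (u t)) + L2_norm (ut t)) \<and>
            weight \<mu> t * (L2_norm (grad (u t)) + L2_norm (ut t)) \<le> C)"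
proof -
  interpret damping m b \<mu> \<sigma> \<Theta> \<Xi> \<omega>
    by (unfold_locales; fact)
  show ?thesis by (rule energy_two_sided[OF nontrivial])
qed

end
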